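(* Consider a Hamiltonian $\{(a,E_a,\lambda_a):a\in[M]\}$ on $N$ qubits such that the $E_a$ are traceless and orthonormal with respect to the Hilbert–Schmidt inner product, i.e. $\operatorname{Tr}(E_aE_b)=2^N\delta_{ab}$. Then for any $\beta>0$ with $100e^6(\mathfrak{d}+1)^8\beta\le1$, one can find $x\in[-1,1]^M$ with $\|x-\lambda\|_\infty\le\varepsilon$ with probability at least $1-\delta$ using only $O\bigl(\frac{\mathfrak{d}}{\beta^2\varepsilon^2}\log\frac M\delta\bigr)$ copies of the Gibbs state $\rho=e^{-\beta H}/\operatorname{Tr}e^{-\beta H}$.
   Context: Standing assumption: the terms $E_a$ are distinct non-identity tensor products of Pauli matrices on $N$ qubits (known to the learner), the coefficients $\lambda_a\in[-1,1]$ are unknown, and $H=\sum_a\lambda_aE_a$; $\beta$ is known. The support of an operator is the minimal set of qubits outside which it acts as the identity. The dual interaction graph has vertex set $[M]$ and an edge between $a\neq b$ iff the supports of $E_a,E_b$ intersect; $\mathfrak{d}$ is its maximum degree.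
   Formalization: The factor 𝔡 in the copy bound is replaced by 𝔡+1, since for 𝔡=0 the stated bound would allow no copies; the claim is stated for M≥1, 0<ε≤1 and 0<δ≤1/2 (for 𝔡≥1 the other values follow by outputting x=0 or by using δ=1/2). *)

theory Defs
  imports Complex_Main "Jordan_Normal_Form.Matrix"
begin

definition kron :: "complex mat \<Rightarrow> complex mat \<Rightarrow> complex mat" where
  "kron A B = mat (dim_row A * dim_row B) (dim_col A * dim_col B)
     (\<lambda>(i,j). A $$ (i div dim_row B, j div dim_col B) * B $$ (i mod dim_row B, j mod dim_col B))"

definition pauli :: "nat \<Rightarrow> complex mat" where
  "pauli k = (if k = 1 then mat_of_rows_list 2 [[0, 1], [1, 0]]
              else if k = 2 then mat_of_rows_list 2 [[0, -\<i>], [\<i>, 0]]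
              else if k = 3 then mat_of_rows_list 2 [[1, 0], [0, -1]]
              else 1\<^sub>m 2)"

definition pauli_word :: "nat \<Rightarrow> nat list \<Rightarrow> bool" where
  "pauli_word N p \<longleftrightarrow> length p = N \<and> (\<forall>k\<in>set p. k < 4)"

definition pauli_string :: "nat list \<Rightarrow> complex mat" where
  "pauli_string p = foldr (\<lambda>k A. kron (pauli k) A) p (1\<^sub>m 1)"

text \<open>Support of a Pauli string: the qubits on which it acts non-trivially
  (= minimal set of qubits outside which the operator acts as identity).\<close>
definition pauli_support :: "nat list \<Rightarrow> nat set" where
  "pauli_support p = {i. i < length p \<and> p ! i \<noteq> 0}"

text \<open>Maximum degree of the dual interaction graph on [M]: vertices a, b (a \<noteq> b)
  adjacent iff the supports of E a and E b intersect.\<close>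
definition dual_degree :: "nat \<Rightarrow> (nat \<Rightarrow> nat list) \<Rightarrow> nat" where
  "dual_degree M E = Max (insert 0 ((\<lambda>a. card {b. b < M \<and> b \<noteq> a \<and>
        pauli_support (E a) \<inter> pauli_support (E b) \<noteq> {}}) ` {..<M}))"

definition hamiltonian :: "nat \<Rightarrow> nat \<Rightarrow> (nat \<Rightarrow> nat list) \<Rightarrow> (nat \<Rightarrow> real) \<Rightarrow> complex mat" where
  "hamiltonian N M E lam = mat (2^N) (2^N)
     (\<lambda>(i,j). \<Sum>a<M. complex_of_real (lam a) * pauli_string (E a) $$ (i,j))"

definition mexp :: "complex mat \<Rightarrow> complex mat" where
  "mexp A = mat (dim_row A) (dim_col A) (\<lambda>(i,j). \<Sum>k. (A ^\<^sub>m k) $$ (i,j) / of_nat (fact k))"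

definition mtrace :: "complex mat \<Rightarrow> complex" where
  "mtrace A = (\<Sum>i<dim_row A. A $$ (i,i))"

definition gibbs :: "real \<Rightarrow> complex mat \<Rightarrow> complex mat" where
  "gibbs \<beta> H = (1 / mtrace (mexp (complex_of_real (-\<beta>) \<cdot>\<^sub>m H))) \<cdot>\<^sub>m mexp (complex_of_real (-\<beta>) \<cdot>\<^sub>m H)"

fun tensor_pow :: "complex mat \<Rightarrow> nat \<Rightarrow> complex mat" where
  "tensor_pow A 0 = 1\<^sub>m 1"
| "tensor_pow A (Suc n) = kron A (tensor_pow A n)"

definition psd :: "nat \<Rightarrow> complex mat \<Rightarrow> bool" where
  "psd d A \<longleftrightarrow> A \<in> carrier_mat d d \<and>
     (\<forall>i<d. \<forall>j<d. A $$ (i,j) = cnj (A $$ (j,i))) \<and>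
     (\<forall>v::complex vec. v \<in> carrier_vec d \<longrightarrow>
        (let q = (\<Sum>i<d. \<Sum>j<d. cnj (v $ i) * A $$ (i,j) * v $ j) in Im q = 0 \<and> 0 \<le> Re q))"

definition povm :: "nat \<Rightarrow> 'x set \<Rightarrow> ('x \<Rightarrow> complex mat) \<Rightarrow> bool" where
  "povm d X F \<longleftrightarrow> finite X \<and> (\<forall>x\<in>X. psd d (F x)) \<and>
     (\<forall>i<d. \<forall>j<d. (\<Sum>x\<in>X. F x $$ (i,j)) = 1\<^sub>m d $$ (i,j))"

definition outcome_prob :: "complex mat \<Rightarrow> complex mat \<Rightarrow> real" where
  "outcome_prob F \<rho> = Re (mtrace (F * \<rho>))"

end

(*
The information is extracted from the expectations f_a = Tr (E_a rho), of which lambda is a stable function.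

Stability. Put x_a = - beta lambda_a and allow complex x. Expanding exp (sum x_a E_a) into words, the normalized
trace of a word factorizes over letters with disjoint supports. A polymer-type induction then shows that the partition
function has no zeros and that |f_a| <= e on the polydisc |x_a| <= 1 / (10 (d + 1)). The function h_a(x) = f_a(x) - x_a is
analytic and bounded there and vanishes to second order at 0, by tracelessness and orthonormality. The Schwarz lemma and
the Cauchy estimate, applied along complex lines, make h_a 1/2-Lipschitz for the supremum norm on |x_a| <= beta,
hence |x - x'| <= 2 |f(x) - f(x')|.

Measurement. The graph of intersecting supports has a proper colouring with d + 1 colours. The terms of one colour have
disjoint supports, so they are all measured at once by measuring every qubit of a copy in a suitable Pauli basis. With
m = O (log (M / delta) / (beta epsilon)^2) copies per colour, a Chernoff bound and a union bound give all f_a up to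
beta epsilon / 4, and any x compatible with these data is within epsilon of lambda.
*)
theory Submission
  imports Defs "HOL-Complex_Analysis.Conformal_Mappings"
begin

subsection \<open>Cluster expansion over words\<close>

text \<open>The obstacle is the number of terms. Estimating the numerator and the partition function
  of an expectation separately gives factors exp (sum of |x_a|), which grow with M; only the
  quotient has a bound in terms of d alone. Hence the expansion over a set R of letters is always
  compared with the partition function over the same R, and deleting a letter from R must be paid
  for by a bounded ratio. The letters do not commute, so the expansion runs over words, not
  multisets; a fixed prefix plays the inserted operator, which makes numerator and denominator
  instances of one object. The inversion meets the same obstacle: a row of the Jacobian has M
  entries. Instead all coordinates move together in a direction of supremum norm at most 1; the
  polydisc contains a disc in that direction whose radius does not depend on M, and one complex
  variable suffices. Positivity of the outcome probabilities comes from exp (- beta H) being the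
  square of a Hermitian matrix, so nothing has to be diagonalized.\<close>

definition words :: "'a set \<Rightarrow> nat \<Rightarrow> 'a list set" where
  "words A k = {w. set w \<subseteq> A \<and> length w = k}"

lemma finite_words: "finite A \<Longrightarrow> finite (words A k)"
  unfolding words_def by (rule finite_lists_length_eq)

lemma words_0 [simp]: "words A 0 = {[]}"
  by (auto simp: words_def)

lemma sum_words_Suc:
  "(\<Sum>w\<in>words A (Suc k). f w) = (\<Sum>a\<in>A. \<Sum>w\<in>words A k. f (a # w))"
proof -
  have eq: "words A (Suc k) = (\<lambda>(a,w). a # w) ` (A \<times> words A k)"
    by (auto simp: words_def length_Suc_conv image_iff)
  have inj: "inj_on (\<lambda>(a,w). a # w) (A \<times> words A k)"
    by (auto simp: inj_on_def)
  show ?thesis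
    unfolding eq by (subst sum.reindex[OF inj]) (simp add: sum.cartesian_product case_prod_unfold comp_def)
qed

lemma sum_words_prod:
  fixes x :: "'a \<Rightarrow> 'b::comm_semiring_1"
  shows "(\<Sum>w\<in>words A k. prod_list (map x w)) = (\<Sum>a\<in>A. x a) ^ k"
  by (induction k) (simp_all add: sum_words_Suc sum_distrib_right flip: sum_distrib_left)

text \<open>A word over a disjoint union is an interleaving of its restrictions to \<open>A\<close>
  and \<open>B\<close>, and a pair of restrictions of lengths i and k - i arises from k choose i
  words. The induction strips the first letter and absorbs it into \<open>F\<close> or
  \<open>G\<close>, hence both are arbitrary; the two resulting sums combine by Pascal's
  rule.\<close>

lemma sum_words_shuffle:
  fixes F G :: "'a list \<Rightarrow> 'b::comm_semiring_1"
  assumes fin: "finite A" "finite B" and disj: "A \<inter> B = {}"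
  shows "(\<Sum>w\<in>words (A \<union> B) k. F (filter (\<lambda>z. z \<in> A) w) * G (filter (\<lambda>z. z \<in> B) w)) =
    (\<Sum>i\<le>k. of_nat (k choose i) * ((\<Sum>u\<in>words A i. F u) * (\<Sum>v\<in>words B (k - i). G v)))"
proof (induction k arbitrary: F G)
  case 0
  then show ?case by simp
next
  case (Suc k)
  define f where "f i = (\<Sum>u\<in>words A i. F u)" for i
  define g where "g i = (\<Sum>v\<in>words B i. G v)" for i
  define h where "h i = f i * g (Suc k - i)" for i
  let ?SA = "\<lambda>w. filter (\<lambda>z. z \<in> A) w" and ?SB = "\<lambda>w. filter (\<lambda>z. z \<in> B) w"
  have A: "(\<Sum>w\<in>words (A \<union> B) k. F (?SA (a # w)) * G (?SB (a # w))) =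
      (\<Sum>i\<le>k. of_nat (k choose i) * ((\<Sum>u\<in>words A i. F (a # u)) * g (k - i)))" if "a \<in> A" for a
  proof -
    have "a \<notin> B" using that disj by blast
    then show ?thesis
      using that Suc.IH[of "\<lambda>u. F (a # u)" G] by (simp add: g_def)
  qed
  have B: "(\<Sum>w\<in>words (A \<union> B) k. F (?SA (a # w)) * G (?SB (a # w))) =
      (\<Sum>i\<le>k. of_nat (k choose i) * (f i * (\<Sum>v\<in>words B (k - i). G (a # v))))" if "a \<in> B" for a
  proof -
    have "a \<notin> A" using that disj by blast
    then show ?thesis
      using that Suc.IH[of F "\<lambda>u. G (a # u)"] by (simp add: f_def)
  qed
  have "(\<Sum>w\<in>words (A \<union> B) (Suc k). F (?SA w) * G (?SB w)) =
     (\<Sum>a\<in>A. \<Sum>i\<le>k. of_nat (k choose i) * ((\<Sum>u\<in>words A i. F (a # u)) * g (k - i))) +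
     (\<Sum>a\<in>B. \<Sum>i\<le>k. of_nat (k choose i) * (f i * (\<Sum>v\<in>words B (k - i). G (a # v))))"
    unfolding sum_words_Suc by (subst sum.union_disjoint[OF fin disj]) (simp only: A B cong: sum.cong)
  also have "(\<Sum>a\<in>A. \<Sum>i\<le>k. of_nat (k choose i) * ((\<Sum>u\<in>words A i. F (a # u)) * g (k - i))) =
     (\<Sum>i\<le>k. of_nat (k choose i) * h (Suc i))"
    unfolding h_def f_def sum_words_Suc
    by (subst sum.swap) (simp add: sum_distrib_left sum_distrib_right)
  also have "(\<Sum>a\<in>B. \<Sum>i\<le>k. of_nat (k choose i) * (f i * (\<Sum>v\<in>words B (k - i). G (a # v)))) =
     (\<Sum>i\<le>k. of_nat (k choose i) * h i)"
    unfolding h_def g_def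
    by (subst sum.swap) (simp add: Suc_diff_le sum_words_Suc sum_distrib_left)
  also have "(\<Sum>i\<le>k. of_nat (k choose i) * h i) = (\<Sum>i\<le>Suc k. of_nat (k choose i) * h i)"
    by (simp add: binomial_eq_0)
  also have "\<dots> = h 0 + (\<Sum>i\<le>k. of_nat (k choose Suc i) * h (Suc i))"
    by (subst sum.atMost_Suc_shift) simp
  also have "(\<Sum>i\<le>k. of_nat (k choose i) * h (Suc i)) + \<dots> =
      (\<Sum>i\<le>Suc k. of_nat (Suc k choose i) * h i)"
    by (subst sum.atMost_Suc_shift) (simp add: distrib_right sum.distrib algebra_simps)
  finally show ?case
    unfolding h_def f_def g_def .
qed

text \<open>With \<open>c\<close> the normalized trace of a product of Hamiltonian terms, \<open>cluster_sum c x {} R\<close> is the normalized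
  trace of \<open>exp (\<Sum>a\<in>R. x a * E a)\<close>; a nonempty \<open>S\<close> selects the part of this expansion in which every
  letter of \<open>S\<close> occurs. Prefixing the words in \<open>c\<close> inserts an operator under the trace.\<close>
definition cluster_term :: "('i list \<Rightarrow> 'a) \<Rightarrow> ('i \<Rightarrow> 'a) \<Rightarrow> 'i set \<Rightarrow> 'i set \<Rightarrow> nat \<Rightarrow> 'a::real_normed_field" where
  "cluster_term c x S R k =
     (\<Sum>w\<in>words (S \<union> R) k. if S \<subseteq> set w then prod_list (map x w) * c w else 0) / fact k"

definition cluster_sum :: "('i list \<Rightarrow> 'a) \<Rightarrow> ('i \<Rightarrow> 'a) \<Rightarrow> 'i set \<Rightarrow> 'i set \<Rightarrow> 'a::{real_normed_field,banach}" where
  "cluster_sum c x S R = (\<Sum>k. cluster_term c x S R k)"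

lemma cluster_sum_empty: "cluster_sum c x {} {} = c []"
proof -
  have "cluster_term c x {} {} k = (if k = 0 then c [] else 0)" for k
    by (cases k) (simp_all add: cluster_term_def sum_words_Suc)
  then have "(\<lambda>k. cluster_term c x {} {} k) sums (c [])"
    using sums_single[of 0 "\<lambda>_. c []"] by (simp add: eq_commute[of 0])
  then show ?thesis
    by (simp add: cluster_sum_def sums_iff)
qed

lemma norm_prod_list: "norm (prod_list (map x w)) = prod_list (map (\<lambda>a. norm (x a :: 'a::real_normed_field)) w)"
  by (induction w) (simp_all add: norm_mult)

text \<open>This crude bound grows with the number of letters and serves only convergence: absolute
  summability, and later uniformity in the parameters.\<close>

lemma norm_cluster_term_le:
  assumes "\<And>w. norm (c w) \<le> 1"
  shows "norm (cluster_term c x S R k) \<le> (\<Sum>a\<in>S\<union>R. norm (x a)) ^ k / fact k"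
proof -
  have "norm (\<Sum>w\<in>words (S \<union> R) k. if S \<subseteq> set w then prod_list (map x w) * c w else 0)
      \<le> (\<Sum>w\<in>words (S \<union> R) k. prod_list (map (\<lambda>a. norm (x a)) w))"
  proof (rule sum_norm_le)
    fix w
    have "0 \<le> prod_list (map (\<lambda>a. norm (x a)) w)"
      by (simp flip: norm_prod_list)
    then show "norm (if S \<subseteq> set w then prod_list (map x w) * c w else 0) \<le> prod_list (map (\<lambda>a. norm (x a)) w)"
      using assms[of w] by (simp add: norm_mult norm_prod_list mult_left_le)
  qed
  then show ?thesis
    by (simp add: cluster_term_def norm_divide sum_words_prod divide_right_mono)
qed

lemma summable_pow_fact: "summable (\<lambda>k. (t::real) ^ k / fact k)"
  using summable_exp[of t] by (simp add: divide_inverse mult.commute)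

lemma summable_norm_cluster_term:
  assumes "\<And>w. norm (c w) \<le> 1"
  shows "summable (\<lambda>k. norm (cluster_term c x S R k))"
  by (rule summable_comparison_test[OF _ summable_pow_fact[of "\<Sum>a\<in>S\<union>R. norm (x a)"]])
     (simp add: norm_cluster_term_le assms)

text \<open>Deletion and contraction of the letter \<open>b\<close>, according to whether it occurs
  in the word. The inductions over sets of letters below rest on this identity.\<close>

lemma cluster_sum_insert:
  fixes c :: "'i list \<Rightarrow> 'a::{real_normed_field,banach}"
  assumes fin: "finite S" "finite R" and b: "b \<notin> S" "b \<notin> R" and c: "\<And>w. norm (c w) \<le> 1"
  shows "cluster_sum c x S (insert b R) = cluster_sum c x S R + cluster_sum c x (insert b S) R"
proof -
  have "cluster_term c x S (insert b R) k = cluster_term c x S R k + cluster_term c x (insert b S) R k" for k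
  proof -
    let ?t = "\<lambda>w. if S \<subseteq> set w then prod_list (map x w) * c w else 0"
    let ?W = "words (insert b (S \<union> R)) k"
    have "(\<Sum>w\<in>?W. ?t w) = (\<Sum>w\<in>?W. if b \<in> set w then 0 else ?t w) + (\<Sum>w\<in>?W. if b \<in> set w then ?t w else 0)"
      by (subst sum.distrib[symmetric]) (rule sum.cong, auto)
    also have "(\<Sum>w\<in>?W. if b \<in> set w then 0 else ?t w) = (\<Sum>w\<in>words (S \<union> R) k. ?t w)"
    proof (rule sum.mono_neutral_cong_right)
      show "finite ?W" using fin by (simp add: finite_words)
    qed (use b in \<open>auto simp: words_def\<close>)
    also have "(\<Sum>w\<in>?W. if b \<in> set w then ?t w else 0) =
        (\<Sum>w\<in>?W. if insert b S \<subseteq> set w then prod_list (map x w) * c w else 0)"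
      by (rule sum.cong) auto
    finally show ?thesis
      by (simp add: cluster_term_def add_divide_distrib)
  qed
  then have "cluster_term c x S (insert b R) = (\<lambda>k. cluster_term c x S R k + cluster_term c x (insert b S) R k)"
    by (rule ext)
  then show ?thesis
    unfolding cluster_sum_def
    by (simp add: suminf_add summable_norm_cancel summable_norm_cluster_term c)
qed

text \<open>The exponential generating function of words in which the letters of \<open>S\<close>
  are forced to occur and those of \<open>R\<close> are free: a factor exp z - 1 for each forced
  letter, exp z for each free one. It is the majorant in the next estimate.\<close>

lemma cluster_sum_const:
  fixes z :: real
  assumes fin: "finite S" "finite R" and disj: "S \<inter> R = {}"
  shows "cluster_sum (\<lambda>_. 1) (\<lambda>_. z) S R = (exp z - 1) ^ card S * exp (z * card R)"
  using fin disj
proof (induction S arbitrary: R rule: finite_induct)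
  case empty
  have "cluster_term (\<lambda>_. 1) (\<lambda>_. z) {} R k = inverse (fact k) * (z * card R) ^ k" for k
    unfolding cluster_term_def by (simp add: sum_words_prod[of "\<lambda>_. z", simplified] divide_inverse mult.commute)
  then show ?case
    by (simp add: cluster_sum_def exp_def)
next
  case (insert b S)
  have "cluster_sum (\<lambda>_. 1) (\<lambda>_. z) (insert b S) R =
      cluster_sum (\<lambda>_. 1) (\<lambda>_. z) S (insert b R) - cluster_sum (\<lambda>_. 1) (\<lambda>_. z) S R"
    using insert by (subst cluster_sum_insert) auto
  also have "\<dots> = (exp z - 1) ^ card S * (exp (z * card (insert b R)) - exp (z * card R))"
    using insert by (simp add: algebra_simps)
  also have "\<dots> = (exp z - 1) ^ card (insert b S) * exp (z * card R)"
    using insert by (simp add: algebra_simps exp_add)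
  finally show ?case .
qed

lemma norm_cluster_sum_le:
  fixes c :: "'i list \<Rightarrow> 'a::{real_normed_field,banach}"
  assumes fin: "finite S" and c: "\<And>w. norm (c w) \<le> 1" and x: "\<And>a. a \<in> S \<Longrightarrow> norm (x a) \<le> r"
  shows "norm (cluster_sum c x S {}) \<le> (exp r - 1) ^ card S"
\<comment> \<open>For empty \<open>S\<close> the hypothesis on \<open>x\<close> is void and
  \<open>r\<close> may be negative, so this case cannot go through the majorant.\<close>
proof (cases "S = {}")
  case True
  show ?thesis
    using True c[of "[]"] by (simp add: cluster_sum_empty)
next
  case False
  then have r: "0 \<le> r"
    using x norm_ge_zero order_trans by blast
  let ?g = "cluster_term (\<lambda>_. 1) (\<lambda>_. r) S {}"
  have g: "norm (cluster_term c x S {} k) \<le> ?g k" for k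
  proof -
    have "norm (\<Sum>w\<in>words S k. if S \<subseteq> set w then prod_list (map x w) * c w else 0)
      \<le> (\<Sum>w\<in>words S k. if S \<subseteq> set w then prod_list (map (\<lambda>_. r) w) * 1 else 0)"
    proof (rule sum_norm_le)
      fix w assume "w \<in> words S k"
      then have "prod_list (map (\<lambda>a. norm (x a)) w) \<le> prod_list (map (\<lambda>_. r) w)"
        unfolding words_def mem_Collect_eq
      proof (induction w arbitrary: k)
        case (Cons a w)
        then have "prod_list (map (\<lambda>a. norm (x a)) w) \<le> prod_list (map (\<lambda>_. r) w)"
          by auto
        with Cons.prems x[of a] r show ?case
          by (auto intro!: mult_mono simp flip: norm_prod_list)
      qed simp
      moreover have "norm (prod_list (map x w) * c w) \<le> norm (prod_list (map x w))"
        using c[of w] by (simp add: norm_mult mult_left_le)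
      ultimately show "norm (if S \<subseteq> set w then prod_list (map x w) * c w else 0)
         \<le> (if S \<subseteq> set w then prod_list (map (\<lambda>_. r) w) * 1 else 0)"
        by (simp add: norm_prod_list)
    qed
    then show ?thesis
      by (simp add: cluster_term_def norm_divide divide_right_mono)
  qed
  have sg: "summable ?g"
    by (rule summable_norm_cancel, rule summable_norm_cluster_term) simp
  have "norm (cluster_sum c x S {}) \<le> (\<Sum>k. norm (cluster_term c x S {} k))"
    unfolding cluster_sum_def by (rule summable_norm) (rule summable_norm_cluster_term[OF c])
  also have "\<dots> \<le> suminf ?g"
    by (rule suminf_le[OF g summable_norm_cluster_term[OF c] sg])
  also have "\<dots> = (exp r - 1) ^ card S"
    using cluster_sum_const[of S "{}" r] fin by (simp add: cluster_sum_def)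
  finally show ?thesis .
qed

text \<open>The shuffle count n choose i, divided by n!, splits as 1 / (i! (n - i)!), which turns
  the sum over words into a Cauchy product. Two functions \<open>c\<close> and \<open>c'\<close> are
  allowed because an inserted prefix belongs to the \<open>S\<close> factor only.\<close>

lemma cluster_sum_factor:
  fixes c :: "'i list \<Rightarrow> 'a::{real_normed_field,banach}"
  assumes fin: "finite S" "finite R" and disj: "S \<inter> R = {}"
    and c: "\<And>w. norm (c w) \<le> 1" and c': "\<And>w. norm (c' w) \<le> 1"
    and fac: "\<And>w. set w \<subseteq> S \<union> R \<Longrightarrow> c w = c (filter (\<lambda>z. z \<in> S) w) * c' (filter (\<lambda>z. z \<in> R) w)"
  shows "cluster_sum c x S R = cluster_sum c x S {} * cluster_sum c' x {} R"
proof -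
  define F where "F u = (if S \<subseteq> set u then prod_list (map x u) * c u else 0)" for u
  define G where "G v = prod_list (map x v) * c' v" for v
  have split: "prod_list (map x w) = prod_list (map x (filter (\<lambda>z. z \<in> S) w)) * prod_list (map x (filter (\<lambda>z. z \<in> R) w))"
    if "set w \<subseteq> S \<union> R" for w
    using that disj by (induction w) auto
  have "cluster_term c x S R n = (\<Sum>i\<le>n. cluster_term c x S {} i * cluster_term c' x {} R (n - i))" for n
  proof -
    have "(\<Sum>w\<in>words (S \<union> R) n. if S \<subseteq> set w then prod_list (map x w) * c w else 0) =
       (\<Sum>w\<in>words (S \<union> R) n. F (filter (\<lambda>z. z \<in> S) w) * G (filter (\<lambda>z. z \<in> R) w))"
    proof (rule sum.cong[OF refl])
      fix w assume w: "w \<in> words (S \<union> R) n"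
      have "S \<subseteq> set (filter (\<lambda>z. z \<in> S) w) \<longleftrightarrow> S \<subseteq> set w" by auto
      then show "(if S \<subseteq> set w then prod_list (map x w) * c w else 0) =
          F (filter (\<lambda>z. z \<in> S) w) * G (filter (\<lambda>z. z \<in> R) w)"
        using w split[of w] fac[of w] by (auto simp: F_def G_def words_def)
    qed
    also have "\<dots> = (\<Sum>i\<le>n. of_nat (n choose i) * ((\<Sum>u\<in>words S i. F u) * (\<Sum>v\<in>words R (n - i). G v)))"
      by (rule sum_words_shuffle[OF fin disj])
    finally have "cluster_term c x S R n =
        (\<Sum>i\<le>n. of_nat (n choose i) * ((\<Sum>u\<in>words S i. F u) * (\<Sum>v\<in>words R (n - i). G v)) / fact n)"
      by (simp add: cluster_term_def sum_divide_distrib)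
    also have "\<dots> = (\<Sum>i\<le>n. ((\<Sum>u\<in>words S i. F u) / fact i) * ((\<Sum>v\<in>words R (n - i). G v) / fact (n - i)))"
      by (rule sum.cong) (simp_all add: binomial_fact)
    finally show ?thesis
      by (simp add: cluster_term_def F_def G_def)
  qed
  then have "cluster_sum c x S R = (\<Sum>n. \<Sum>i\<le>n. cluster_term c x S {} i * cluster_term c' x {} R (n - i))"
    by (simp add: cluster_sum_def)
  also have "\<dots> = cluster_sum c x S {} * cluster_sum c' x {} R"
    unfolding cluster_sum_def
    by (rule Cauchy_product[symmetric]) (rule summable_norm_cluster_term[OF c] summable_norm_cluster_term[OF c'])+
  finally show ?thesis .
qed

text \<open>The properties of the normalized trace that the expansion uses. The bound
  \<open>c_le\<close> is for all words, so it passes to prefixed words and gives convergence without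
  side conditions. Since \<open>touch\<close> is reflexive on \<open>V\<close>,
  \<open>touch_deg\<close> counts the letter itself: \<open>d\<close> bounds the number of other
  letters touched.\<close>

locale word_trace =
  fixes c :: "'i list \<Rightarrow> complex" and touch :: "'i \<Rightarrow> 'i \<Rightarrow> bool" and V :: "'i set" and d :: nat
  assumes c_Nil: "c [] = 1"
    and c_le: "norm (c w) \<le> 1"
    and c_factor: "\<lbrakk>A \<subseteq> V; B \<subseteq> V; \<And>a b. a \<in> A \<Longrightarrow> b \<in> B \<Longrightarrow> \<not> touch a b; set w \<subseteq> A \<union> B\<rbrakk>
        \<Longrightarrow> c w = c (filter (\<lambda>z. z \<in> A) w) * c (filter (\<lambda>z. z \<in> B) w)"
    and finite_V: "finite V"
    and touch_refl: "a \<in> V \<Longrightarrow> touch a a"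
    and touch_deg: "a \<in> V \<Longrightarrow> card {b\<in>V. touch a b} \<le> Suc d"
begin

abbreviation Z :: "('i \<Rightarrow> complex) \<Rightarrow> 'i set \<Rightarrow> complex" where
  "Z x R \<equiv> cluster_sum c x {} R"

text \<open>The prefix is treated as part of the detached block: \<open>c_factor\<close> is applied
  to \<open>S \<union> set P\<close> against \<open>R\<close> and to the word \<open>P @ w\<close>.
  Reflexivity of \<open>touch\<close> makes the two sides disjoint.\<close>

lemma cluster_sum_detached:
  assumes "S \<subseteq> V" "R \<subseteq> V" "set P \<subseteq> V"
    and nt: "\<And>s b. s \<in> S \<union> set P \<Longrightarrow> b \<in> R \<Longrightarrow> \<not> touch s b"
  shows "cluster_sum (\<lambda>w. c (P @ w)) x S R = cluster_sum (\<lambda>w. c (P @ w)) x S {} * Z x R"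
proof (rule cluster_sum_factor)
  show "finite S" "finite R"
    using assms finite_V by (auto intro: finite_subset)
  show disj: "S \<inter> R = {}"
    using assms touch_refl by blast
  fix w assume w: "set w \<subseteq> S \<union> R"
  have disj': "set P \<inter> R = {}"
    using assms touch_refl by blast
  have 1: "filter (\<lambda>z. z \<in> S \<union> set P) (P @ w) = P @ filter (\<lambda>z. z \<in> S) w"
  proof -
    have "filter (\<lambda>z. z \<in> S \<union> set P) w = filter (\<lambda>z. z \<in> S) w"
      by (rule filter_cong) (use w disj' in auto)
    then show ?thesis by simp
  qed
  have 2: "filter (\<lambda>z. z \<in> R) (P @ w) = filter (\<lambda>z. z \<in> R) w"
    using disj' by (auto simp: filter_empty_conv)
  show "c (P @ w) = c (P @ filter (\<lambda>z. z \<in> S) w) * c (filter (\<lambda>z. z \<in> R) w)"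
    using c_factor[of "S \<union> set P" R "P @ w"] nt w assms unfolding 1 2 by auto
qed (auto intro: c_le)

text \<open>Induction on \<open>R\<close>. If \<open>b \<in> R\<close> touches \<open>S\<close>, then words over \<open>S \<union> R\<close> either avoid \<open>b\<close> or contain it, so
  \<open>b\<close> is deleted from \<open>R\<close> or moved to \<open>S\<close>; the factor \<open>\<tau>\<close> per touching letter pays for both alternatives. Once
  nothing in \<open>R\<close> touches \<open>S\<close>, the sum factorizes. The case \<open>S = {b}\<close> gives the ratio bound needed for deletions.
  No connected clusters have to be counted.\<close>
lemma cluster_bound:
  assumes x: "\<And>a. a \<in> V \<Longrightarrow> norm (x a) \<le> r"
    and y: "y = exp r - 1" "0 \<le> y" and \<tau>: "1 \<le> \<tau>" and \<delta>: "y * \<tau> ^ d \<le> \<delta>" "\<delta> < 1" "1 + \<delta> \<le> \<tau> * (1 - \<delta>)"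
    and R: "R \<subseteq> V"
  shows "Z x R \<noteq> 0 \<and> (\<forall>S P. S \<subseteq> V \<longrightarrow> set P \<subseteq> V \<longrightarrow> S \<inter> R = {} \<longrightarrow>
     norm (cluster_sum (\<lambda>w. c (P @ w)) x S R) \<le>
       y ^ card S * \<tau> ^ card {b\<in>R. \<exists>s\<in>S\<union>set P. touch s b} * norm (Z x R))"
proof -
  have "finite R"
    using R finite_V finite_subset by blast
  then show ?thesis
    using R
  proof (induction R rule: finite_psubset_induct)
    case (psubset R)
    have finR: "finite R" by fact
    have \<delta>0: "0 \<le> \<delta>"
      using \<delta>(1) y(2) \<tau> by (meson mult_nonneg_nonneg order_trans zero_le_one zero_le_power)
    \<comment> \<open>Restoring \<open>b\<close> changes the partition function by at most the
      fraction \<open>\<delta>\<close>: this is the weight of the words that contain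
      \<open>b\<close>. Zero-freeness of the full set then follows by deleting any one
      letter.\<close>
    have ratio: "(1 - \<delta>) * norm (Z x (R - {b})) \<le> norm (Z x R)" "Z x (R - {b}) \<noteq> 0" if b: "b \<in> R" for b
    proof -
      let ?R = "R - {b}"
      have sub: "?R \<subset> R" "?R \<subseteq> V" "{b} \<subseteq> V" using psubset.prems b by auto
      from psubset.IH[OF sub(1,2)] have IH': "\<And>S P. S \<subseteq> V \<Longrightarrow> set P \<subseteq> V \<Longrightarrow> S \<inter> ?R = {} \<Longrightarrow>
          norm (cluster_sum (\<lambda>w. c (P @ w)) x S ?R) \<le>
            y ^ card S * \<tau> ^ card {b'\<in>?R. \<exists>s\<in>S\<union>set P. touch s b'} * norm (Z x ?R)"
        and IH: "Z x ?R \<noteq> 0"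
        by blast+
      have IH: "Z x ?R \<noteq> 0" "norm (cluster_sum c x {b} ?R) \<le>
          y ^ 1 * \<tau> ^ card {b'\<in>?R. touch b b'} * norm (Z x ?R)"
        using IH IH'[OF sub(3), of "[]"] by simp_all
      have "card {b'\<in>?R. touch b b'} \<le> card ({b'\<in>V. touch b b'} - {b})"
        by (rule card_mono) (use psubset.prems finite_V in auto)
      also have "\<dots> \<le> d"
        using touch_deg[of b] touch_refl[of b] psubset.prems b finite_V
        by (subst card_Diff_singleton) auto
      finally have "y * \<tau> ^ card {b'\<in>?R. touch b b'} \<le> \<delta>"
        using \<tau> y(2) \<delta>(1) by (meson mult_left_mono order_trans power_increasing)
      then have "norm (cluster_sum c x {b} ?R) \<le> \<delta> * norm (Z x ?R)"
        using IH(2) by (smt (verit) mult_right_mono norm_ge_zero power_one_right)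
      moreover have "Z x R = Z x ?R + cluster_sum c x {b} ?R"
        using cluster_sum_insert[of "{}" ?R b c x] finR b c_le by (simp add: insert_absorb)
      then have "norm (Z x ?R) \<le> norm (Z x R) + norm (cluster_sum c x {b} ?R)"
        by (metis add_diff_cancel_right' norm_triangle_ineq4)
      ultimately show "(1 - \<delta>) * norm (Z x ?R) \<le> norm (Z x R)"
        by (simp add: algebra_simps)
      show "Z x ?R \<noteq> 0" by (rule IH)
    qed
    have Znz: "Z x R \<noteq> 0"
    proof (cases "R = {}")
      case True
      then show ?thesis
        using c_Nil by (simp add: cluster_sum_empty)
    next
      case False
      then obtain b where "b \<in> R" by blast
      from ratio[OF this] \<delta>(2) show ?thesis
        by (smt (verit) mult_pos_pos norm_zero zero_less_norm_iff)
    qed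
    have "norm (cluster_sum (\<lambda>w. c (P @ w)) x S R) \<le>
       y ^ card S * \<tau> ^ card {b\<in>R. \<exists>s\<in>S\<union>set P. touch s b} * norm (Z x R)"
      if S: "S \<subseteq> V" "set P \<subseteq> V" "S \<inter> R = {}" for S P
    proof -
      let ?c = "\<lambda>w. c (P @ w)" and ?N = "\<lambda>S R. {b\<in>R. \<exists>s\<in>S\<union>set P. touch s b}"
      have finS: "finite S" using S finite_V finite_subset by blast
      show ?thesis
      proof (cases "?N S R = {}")
        case True
        then have "cluster_sum ?c x S R = cluster_sum ?c x S {} * Z x R"
          using S psubset.prems by (intro cluster_sum_detached) auto
        moreover have "norm (cluster_sum ?c x S {}) \<le> y ^ card S"
          unfolding y using S x by (intro norm_cluster_sum_le finS c_le) auto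
        ultimately show ?thesis
          unfolding True by (simp add: norm_mult mult_right_mono)
      next
        case False
        then obtain b where b: "b \<in> ?N S R" by blast
        let ?R = "R - {b}"
        let ?p = "card (?N S ?R)"
        have bV: "b \<in> V" "b \<in> R" "b \<notin> S" using b psubset.prems S by auto
        have p: "card (?N S R) = Suc ?p"
        proof -
          have "?N S R = insert b (?N S ?R)" using b by auto
          then show ?thesis using finR by simp
        qed
        have IH: "norm (cluster_sum ?c x S' ?R) \<le> y ^ card S' * \<tau> ^ card (?N S' ?R) * norm (Z x ?R)"
          if "S' \<subseteq> V" "S' \<inter> ?R = {}" for S'
          using psubset.IH[of ?R] that psubset.prems b S by blast
        have 1: "norm (cluster_sum ?c x S ?R) \<le> y ^ card S * \<tau> ^ ?p * norm (Z x ?R)"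
          using S by (intro IH) auto
        \<comment> \<open>Moving \<open>b\<close> into \<open>S\<close> gains a factor
          \<open>y\<close> but lets at most \<open>d\<close> further letters touch;
          \<open>y * \<tau> ^ d \<le> \<delta>\<close> is the net price.\<close>
        have "card (?N (insert b S) ?R) \<le> card (?N S ?R \<union> ({b'\<in>V. touch b b'} - {b}))"
          by (rule card_mono) (use psubset.prems finite_V finR in auto)
        also have "\<dots> \<le> ?p + card ({b'\<in>V. touch b b'} - {b})"
          by (rule card_Un_le)
        also have "\<dots> \<le> ?p + d"
          using touch_deg[of b] touch_refl[of b] bV finite_V by (subst card_Diff_singleton) auto
        finally have q: "card (?N (insert b S) ?R) \<le> ?p + d" .
        have "norm (cluster_sum ?c x (insert b S) ?R) \<le>
            y ^ card (insert b S) * \<tau> ^ card (?N (insert b S) ?R) * norm (Z x ?R)"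
          using S bV by (intro IH) auto
        also have "\<dots> \<le> y ^ card (insert b S) * \<tau> ^ (?p + d) * norm (Z x ?R)"
          using q \<tau> y(2) by (intro mult_right_mono mult_left_mono power_increasing) auto
        also have "\<dots> = y ^ card S * \<tau> ^ ?p * (y * \<tau> ^ d) * norm (Z x ?R)"
          using finS bV by (simp add: power_add algebra_simps)
        also have "\<dots> \<le> y ^ card S * \<tau> ^ ?p * \<delta> * norm (Z x ?R)"
          using \<delta>(1) y(2) \<tau> by (intro mult_right_mono mult_left_mono) auto
        finally have 2: "norm (cluster_sum ?c x (insert b S) ?R) \<le> y ^ card S * \<tau> ^ ?p * \<delta> * norm (Z x ?R)" .
        have "cluster_sum ?c x S R = cluster_sum ?c x S ?R + cluster_sum ?c x (insert b S) ?R"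
          using cluster_sum_insert[of S ?R b ?c x] finR finS bV c_le by (simp add: insert_absorb)
        then have "norm (cluster_sum ?c x S R) \<le> norm (cluster_sum ?c x S ?R) + norm (cluster_sum ?c x (insert b S) ?R)"
          using norm_triangle_ineq by metis
        also have "\<dots> \<le> y ^ card S * \<tau> ^ ?p * (1 + \<delta>) * norm (Z x ?R)"
          using 1 2 by (simp add: algebra_simps)
        \<comment> \<open>The two alternatives together cost 1 + \<delta> relative to
          \<open>Z x ?R\<close>, and returning to \<open>Z x R\<close> costs 1 / (1 - \<delta>). The
          letter \<open>b\<close>, which touches in \<open>R\<close> and is absent from
          \<open>?R\<close>, supplies the one power of \<tau> that pays for this.\<close>
        also have "\<dots> \<le> y ^ card S * \<tau> ^ ?p * (\<tau> * (1 - \<delta>)) * norm (Z x ?R)"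
          using \<delta>(3) y(2) \<tau> by (intro mult_right_mono mult_left_mono) auto
        also have "\<dots> = y ^ card S * \<tau> ^ Suc ?p * ((1 - \<delta>) * norm (Z x ?R))"
          by simp
        also have "\<dots> \<le> y ^ card S * \<tau> ^ Suc ?p * norm (Z x R)"
          using ratio(1)[of b] bV y(2) \<tau> by (intro mult_left_mono) auto
        finally show ?thesis unfolding p .
      qed
    qed
    with Znz show ?case by blast
  qed
qed

lemma high_temperature_bound:
  assumes x: "\<And>a. a \<in> V \<Longrightarrow> norm (x a) \<le> 1 / (10 * (real d + 1))"
  shows "Z x V \<noteq> 0"
    and "a \<in> V \<Longrightarrow> norm (cluster_sum (\<lambda>w. c (a # w)) x {} V) \<le> exp 1 * norm (Z x V)"
proof -
  define D :: real where "D = real d + 1"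
  define r where "r = 1 / (10 * D)"
  define y where "y = exp r - 1"
  \<comment> \<open>With \<tau> = 1 + 1 / D the power \<tau> ^ D stays below e, and \<delta> = 1 /
    (2 D + 1) solves 1 + \<delta> = \<tau> (1 - \<delta>). The radius 1 / (10 D) gives y at most
    0.11 / D; then 0.11 times 2.72 is less than 1/3, while \<delta> is at least 1 / (3 D).\<close>
  define \<tau> where "\<tau> = 1 + 1 / D"
  define \<delta> where "\<delta> = 1 / (2 * D + 1)"
  have D: "D \<ge> 1" by (simp add: D_def)
  have r: "0 < r" "r \<le> 1 / 10" using D by (simp_all add: r_def field_simps)
  have tau: "1 \<le> \<tau>" using D by (simp add: \<tau>_def)
  have pow: "\<tau> ^ Suc d \<le> exp 1"
  proof -
    have "\<tau> \<le> exp (1 / D)"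
      unfolding \<tau>_def by (rule exp_ge_add_one_self)
    then have "\<tau> ^ Suc d \<le> exp (1 / D) ^ Suc d"
      using tau by (intro power_mono) auto
    also have "\<dots> = exp 1"
      using D by (simp only: exp_of_nat_mult[symmetric]) (simp add: D_def add.commute)
    finally show ?thesis .
  qed
  have y0: "0 \<le> y" using r by (simp add: y_def)
  have "y \<le> r + r\<^sup>2"
    using exp_bound[of r] r by (simp add: y_def)
  also have "r\<^sup>2 \<le> r * (1 / 10)"
    unfolding power2_eq_square using r by (intro mult_left_mono) auto
  finally have y: "y \<le> 11 / 100 / D" by (simp add: r_def)
  have "\<tau> ^ d \<le> \<tau> ^ Suc d"
    using tau by (intro power_increasing) auto
  then have "y * \<tau> ^ d \<le> y * exp 1"
    using pow y0 by (intro mult_left_mono) auto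
  also have "\<dots> \<le> (11 / 100 / D) * (272 / 100)"
    using y y0 e_less_272 D by (intro mult_mono) auto
  also have "\<dots> \<le> \<delta>"
    using D by (simp add: \<delta>_def field_simps)
  finally have y\<delta>: "y * \<tau> ^ d \<le> \<delta>" .
  have "\<delta> * (2 * D + 1) = 1" "\<tau> * D = D + 1"
    using D by (simp_all add: \<delta>_def \<tau>_def field_simps)
  then have e: "1 - \<delta> = 2 * (\<delta> * D)" and "\<tau> * D = D + 1"
    by (simp_all add: algebra_simps)
  have "\<tau> * (1 - \<delta>) = 2 * \<delta> * (\<tau> * D)"
    unfolding e by simp
  also have "\<dots> = 2 * (\<delta> * D) + 2 * \<delta>"
    unfolding \<open>\<tau> * D = D + 1\<close> by (simp add: algebra_simps)
  also have "\<dots> = 1 + \<delta>"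
    using e by linarith
  finally have \<delta>2: "1 + \<delta> \<le> \<tau> * (1 - \<delta>)"
    by simp
  have \<delta>1: "\<delta> < 1"
    using D by (simp add: \<delta>_def)
  note bound = cluster_bound[OF _ y_def y0 tau y\<delta> \<delta>1 \<delta>2 order_refl, of x]
  have x': "norm (x a) \<le> r" if "a \<in> V" for a
    using x[OF that] by (simp add: r_def D_def)
  show "Z x V \<noteq> 0"
    using bound x' by blast
  assume a: "a \<in> V"
  have "norm (cluster_sum (\<lambda>w. c ([a] @ w)) x {} V) \<le>
      y ^ card ({}::'i set) * \<tau> ^ card {b\<in>V. \<exists>s\<in>{}\<union>set [a]. touch s b} * norm (Z x V)"
    using conjunct2[OF bound[OF x'], rule_format, of "{}" "[a]"] a by simp
  also have "\<dots> = \<tau> ^ card {b\<in>V. touch a b} * norm (Z x V)"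
    by simp
  also have "\<dots> \<le> \<tau> ^ Suc d * norm (Z x V)"
    using touch_deg[OF a] tau by (intro mult_right_mono power_increasing) auto
  also have "\<dots> \<le> exp 1 * norm (Z x V)"
    using pow by (intro mult_right_mono) auto
  finally show "norm (cluster_sum (\<lambda>w. c (a # w)) x {} V) \<le> exp 1 * norm (Z x V)"
    by simp
qed

end

subsection \<open>Analyticity and stability of the expectations\<close>

lemma holomorphic_cluster_term:
  "(\<lambda>z. cluster_term c (\<lambda>a. u a + z * v a) S R k) holomorphic_on A"
proof -
  have "(\<lambda>z. prod_list (map (\<lambda>a. u a + z * v a) w)) holomorphic_on A" for w
    by (induction w) (auto intro!: holomorphic_intros)
  then have "(\<lambda>z. if S \<subseteq> set w then prod_list (map (\<lambda>a. u a + z * v a) w) * c w else 0) holomorphic_on A" for w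
    by (cases "S \<subseteq> set w") (simp_all add: holomorphic_on_mult)
  then show ?thesis
    unfolding cluster_term_def by (auto intro!: holomorphic_intros)
qed

text \<open>The partial sums are polynomials in z, and the crude termwise bound is a Weierstrass
  majorant on every disc of radius 1.\<close>

lemma holomorphic_cluster_sum:
  fixes c :: "'i list \<Rightarrow> complex"
  assumes "\<And>w. norm (c w) \<le> 1"
  shows "(\<lambda>z. cluster_sum c (\<lambda>a. u a + z * v a) S R) holomorphic_on UNIV"
proof (rule holomorphic_uniform_sequence[OF open_UNIV])
  show "(\<lambda>z. \<Sum>k<n. cluster_term c (\<lambda>a. u a + z * v a) S R k) holomorphic_on UNIV" for n
    by (intro holomorphic_intros holomorphic_cluster_term)
  fix z :: complex
  let ?M = "\<Sum>a\<in>S\<union>R. norm (u a) + (norm z + 1) * norm (v a)"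
  have "uniform_limit (cball z 1) (\<lambda>n z. \<Sum>k<n. cluster_term c (\<lambda>a. u a + z * v a) S R k)
      (\<lambda>z. \<Sum>k. cluster_term c (\<lambda>a. u a + z * v a) S R k) sequentially"
  proof (rule Weierstrass_m_test[OF _ summable_pow_fact[of ?M]])
    fix k z' assume "z' \<in> cball z 1"
    then have "norm z' \<le> norm z + 1"
      by (smt (verit) dist_norm mem_cball norm_minus_commute norm_triangle_ineq2)
    then have "norm (u a + z' * v a) \<le> norm (u a) + (norm z + 1) * norm (v a)" for a
      by (smt (verit) mult_right_mono norm_ge_zero norm_mult norm_triangle_ineq)
    then have "(\<Sum>a\<in>S\<union>R. norm (u a + z' * v a)) ^ k \<le> ?M ^ k"
      by (intro power_mono sum_mono sum_nonneg) auto
    then show "norm (cluster_term c (\<lambda>a. u a + z' * v a) S R k) \<le> ?M ^ k / fact k"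
      by (intro order_trans[OF norm_cluster_term_le[OF assms]] divide_right_mono) auto
  qed
  then show "\<exists>d>0. cball z d \<subseteq> UNIV \<and> uniform_limit (cball z d)
      (\<lambda>n z. \<Sum>k<n. cluster_term c (\<lambda>a. u a + z * v a) S R k)
      (\<lambda>z. cluster_sum c (\<lambda>a. u a + z * v a) S R) sequentially"
    unfolding cluster_sum_def by (intro exI[of _ 1]) auto
qed

text \<open>On a ray through the origin the k-th cluster term is homogeneous of degree k in z. So
  the expansion is a power series, and its derivative at 0 sees only the words of length
  one.\<close>

lemma cluster_sum_ray_deriv:
  fixes c :: "'i list \<Rightarrow> complex"
  assumes c: "\<And>w. norm (c w) \<le> 1"
  shows "((\<lambda>z. cluster_sum c (\<lambda>a. z * v a) {} R) has_field_derivative (\<Sum>a\<in>R. v a * c [a])) (at 0)"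
    and "cluster_sum c (\<lambda>a. 0) {} R = c []"
proof -
  have pl: "prod_list (map (\<lambda>a. z * v a) w) = z ^ length w * prod_list (map v w)" for z :: complex and w
    by (induction w) auto
  have t: "cluster_term c (\<lambda>a. z * v a) {} R k = cluster_term c v {} R k * z ^ k" for z k
    unfolding cluster_term_def
    by (simp add: words_def pl sum_distrib_left sum_distrib_right mult_ac)
  have ps: "cluster_sum c (\<lambda>a. z * v a) {} R = (\<Sum>k. cluster_term c v {} R k * z ^ k)" for z
    unfolding cluster_sum_def t ..
  have "summable (cluster_term c v {} R)"
    by (rule summable_norm_cancel, rule summable_norm_cluster_term, rule c)
  then have "summable (\<lambda>k. cluster_term c v {} R k * 1 ^ k)"
    by simp
  from termdiffs_strong[OF this, of 0]
  have "((\<lambda>z. \<Sum>k. cluster_term c v {} R k * z ^ k) has_field_derivative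
     (\<Sum>k. diffs (cluster_term c v {} R) k * 0 ^ k)) (at 0)"
    by simp
  also have "(\<Sum>k. diffs (cluster_term c v {} R) k * 0 ^ k) = cluster_term c v {} R 1"
    by (simp add: diffs_def)
  also have "\<dots> = (\<Sum>a\<in>R. v a * c [a])"
    by (simp add: cluster_term_def sum_words_Suc)
  finally show "((\<lambda>z. cluster_sum c (\<lambda>a. z * v a) {} R) has_field_derivative (\<Sum>a\<in>R. v a * c [a])) (at 0)"
    unfolding ps .
  have "cluster_sum c (\<lambda>a. 0) {} R = cluster_term c v {} R 0"
    using ps[of 0] powser_zero[of "cluster_term c v {} R"] by simp
  then show "cluster_sum c (\<lambda>a. 0) {} R = c []"
    by (simp add: cluster_term_def)
qed

text \<open>\<open>Schwarz3\<close> divides out one zero at a time; applied twice it writes G z as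
  z^2 times a holomorphic function, which the maximum modulus principle bounds on the disc by its
  size on the circle of radius \<rho>.\<close>

lemma double_zero_bound:
  assumes hol: "G holomorphic_on ball 0 R" and \<rho>: "0 < \<rho>" "\<rho> < R"
    and G: "G 0 = 0" "deriv G 0 = 0"
    and K: "\<And>z. norm z = \<rho> \<Longrightarrow> norm (G z) \<le> K" and z: "norm z \<le> \<rho>"
  shows "norm (G z) \<le> K * (norm z)\<^sup>2 / \<rho>\<^sup>2"
proof -
  obtain h where h: "h holomorphic_on ball 0 R" "\<And>z. norm z < R \<Longrightarrow> G z = z * h z" "deriv G 0 = h 0"
    using Schwarz3[OF hol G(1)] by metis
  have "h 0 = 0" using h(3) G by simp
  then obtain k where k: "k holomorphic_on ball 0 R" "\<And>z. norm z < R \<Longrightarrow> h z = z * k z"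
    using Schwarz3[OF h(1)] by metis
  have Gk: "G z = z\<^sup>2 * k z" if "norm z < R" for z
    using that h(2) k(2) by (simp add: power2_eq_square)
  have sub: "cball 0 \<rho> \<subseteq> ball 0 R" using \<rho> by auto
  have "norm (k z) \<le> K / \<rho>\<^sup>2"
  proof (rule maximum_modulus_frontier[of k "cball 0 \<rho>"])
    show "k holomorphic_on interior (cball 0 \<rho>)"
      using k(1) sub by (meson holomorphic_on_subset interior_subset order_trans)
    show "continuous_on (closure (cball 0 \<rho>)) k"
      using holomorphic_on_imp_continuous_on[OF holomorphic_on_subset[OF k(1) sub]] by simp
    fix z :: complex assume "z \<in> frontier (cball 0 \<rho>)"
    then have "norm z = \<rho>" using \<rho> by (simp add: dist_norm)
    then show "norm (k z) \<le> K / \<rho>\<^sup>2"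
      using K[of z] Gk[of z] \<rho> by (simp add: norm_mult norm_power field_simps)
  qed (use z in auto)
  then have "(norm z)\<^sup>2 * norm (k z) \<le> (norm z)\<^sup>2 * (K / \<rho>\<^sup>2)"
    by (intro mult_left_mono) auto
  then show ?thesis
    using Gk[of z] z \<rho> by (simp add: norm_mult norm_power mult_ac)
qed

text \<open>Tracelessness and orthonormality, reduced to words of length one and two. They make the
  derivative of \<open>mean\<close> at 0 the identity.\<close>

locale orthogonal_word_trace = word_trace c touch V d
  for c :: "'i list \<Rightarrow> complex" and touch V d +
  assumes c_single: "a \<in> V \<Longrightarrow> c [a] = 0"
    and c_pair: "\<lbrakk>a \<in> V; b \<in> V\<rbrakk> \<Longrightarrow> c [a, b] = (if a = b then 1 else 0)"
begin

text \<open>The expectation Tr (E_a rho) continued to complex parameters. It is meaningful on the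
  polydisc of radius \<open>rad\<close>, where the denominator has no zeros.\<close>

definition mean :: "('i \<Rightarrow> complex) \<Rightarrow> 'i \<Rightarrow> complex" where
  "mean x a = cluster_sum (\<lambda>w. c (a # w)) x {} V / Z x V"

definition rad :: real where "rad = 1 / (10 * (real d + 1))"

lemma mean_bound:
  assumes "\<And>b. b \<in> V \<Longrightarrow> norm (x b) \<le> rad" "a \<in> V"
  shows "norm (mean x a) \<le> exp 1"
  using high_temperature_bound(1)[of x] high_temperature_bound(2)[of x a] assms
  by (simp add: mean_def rad_def norm_divide divide_le_eq)

lemma holomorphic_mean:
  assumes "\<And>z b. z \<in> A \<Longrightarrow> b \<in> V \<Longrightarrow> norm (u b + z * v b) \<le> rad"
  shows "(\<lambda>z. mean (\<lambda>b. u b + z * v b) a) holomorphic_on A"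
  unfolding mean_def
proof (intro holomorphic_on_divide)
  show "(\<lambda>z. cluster_sum (\<lambda>w. c (a # w)) (\<lambda>b. u b + z * v b) {} V) holomorphic_on A"
    by (rule holomorphic_on_subset[OF holomorphic_cluster_sum]) (auto intro: c_le)
  show "(\<lambda>z. cluster_sum c (\<lambda>b. u b + z * v b) {} V) holomorphic_on A"
    by (rule holomorphic_on_subset[OF holomorphic_cluster_sum]) (auto intro: c_le)
  fix z assume "z \<in> A"
  then show "Z (\<lambda>b. u b + z * v b) V \<noteq> 0"
    using assms by (intro high_temperature_bound(1)) (simp add: rad_def)
qed

text \<open>On the ray through \<open>x\<close>, rescaled to supremum norm at most 1, the difference
  of \<open>mean\<close> and its linear part has a double zero at 0. On the circle of radius \<rho>
  it is bounded by e + 1/10, hence by 3; the point \<open>x\<close> itself is z = t.\<close>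

lemma mean_linearization:
  assumes x: "\<And>b. b \<in> V \<Longrightarrow> norm (x b) \<le> t" and t: "0 < t" "t \<le> \<rho>" "\<rho> < rad" and a: "a \<in> V"
  shows "norm (mean x a - x a) \<le> 3 * t\<^sup>2 / \<rho>\<^sup>2"
proof -
  define v where "v b = x b / of_real t" for b
  define G where "G z = mean (\<lambda>b. 0 + z * v b) a - z * v a" for z
  have v: "norm (v b) \<le> 1" if "b \<in> V" for b
    using x[OF that] t by (simp add: v_def norm_divide)
  have zv: "norm (z * v b) \<le> norm z" if "b \<in> V" for z b
    using v[OF that] by (simp add: norm_mult mult_left_le)
  have \<rho>: "0 < \<rho>" using t by simp
  have "rad \<le> 1 / 10" by (simp add: rad_def divide_simps)
  have hol: "G holomorphic_on ball 0 rad"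
    unfolding G_def
  proof (intro holomorphic_intros holomorphic_mean)
    fix z :: complex and b assume "z \<in> ball 0 rad" "b \<in> V"
    then show "norm (0 + z * v b) \<le> rad"
      using zv[of b z] by auto
  qed
  have der: "(G has_field_derivative 0) (at 0)"
  proof -
    have N: "((\<lambda>z. cluster_sum (\<lambda>w. c (a # w)) (\<lambda>b. z * v b) {} V) has_field_derivative (\<Sum>b\<in>V. v b * c [a, b])) (at 0)"
      by (rule cluster_sum_ray_deriv(1)) (rule c_le)
    have D: "((\<lambda>z. cluster_sum c (\<lambda>b. z * v b) {} V) has_field_derivative (\<Sum>b\<in>V. v b * c [b])) (at 0)"
      by (rule cluster_sum_ray_deriv(1)) (rule c_le)
    have v0: "cluster_sum (\<lambda>w. c (a # w)) (\<lambda>b. 0) {} V = 0" "cluster_sum c (\<lambda>b. 0) {} V = 1"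
      using cluster_sum_ray_deriv(2)[of "\<lambda>w. c (a # w)" V] cluster_sum_ray_deriv(2)[of c V]
        c_le c_single[OF a] c_Nil by simp_all
    have "(\<Sum>b\<in>V. v b * c [a, b]) = (\<Sum>b\<in>V. if a = b then v b else 0)"
      by (rule sum.cong) (use a c_pair in auto)
    also have "\<dots> = v a" using a finite_V by simp
    finally have S: "(\<Sum>b\<in>V. v b * c [a, b]) = v a" .
    \<comment> \<open>At 0 the numerator is 0 and the denominator is 1, so the quotient rule leaves
      the derivative \<open>v a\<close> of the numerator, which the subtracted linear term
      cancels.\<close>
    show ?thesis
      unfolding G_def mean_def
      by (rule derivative_eq_intros N D refl | simp add: v0)+ (simp add: v0 S)
  qed
  have "G 0 = 0"
    using cluster_sum_ray_deriv(2)[of "\<lambda>w. c (a # w)" V] c_le c_single[OF a]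
    by (simp add: G_def mean_def)
  have "norm (G (of_real t)) \<le> 3 * (norm (complex_of_real t))\<^sup>2 / \<rho>\<^sup>2"
  proof (rule double_zero_bound[OF hol \<rho> t(3) \<open>G 0 = 0\<close>])
    show "deriv G 0 = 0" using der by (rule DERIV_imp_deriv)
    show "norm (complex_of_real t) \<le> \<rho>" using t by simp
    fix z :: complex assume z: "norm z = \<rho>"
    have "norm (G z) \<le> norm (mean (\<lambda>b. 0 + z * v b) a) + norm (z * v a)"
      unfolding G_def by (rule norm_triangle_ineq4)
    also have "\<dots> \<le> exp 1 + 1 / 10"
    proof (rule add_mono)
      have "norm (0 + z * v b) \<le> rad" if "b \<in> V" for b
        using zv[OF that, of z] z t by simp
      then show "norm (mean (\<lambda>b. 0 + z * v b) a) \<le> exp 1"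
        by (rule mean_bound[OF _ a])
      show "norm (z * v a) \<le> 1 / 10"
        using zv[OF a, of z] z t \<open>rad \<le> 1 / 10\<close> by simp
    qed
    also have "\<dots> \<le> 3" using e_less_272 by simp
    finally show "norm (G z) \<le> 3" .
  qed
  moreover have "G (of_real t) = mean x a - x a"
    using t by (simp add: G_def v_def)
  ultimately show ?thesis by simp
qed

text \<open>A Cauchy estimate along the one-parameter family through \<open>x\<close> and \<open>x'\<close>, so that the supremum norm on the
  parameters costs no factor depending on the number of terms.\<close>
lemma mean_remainder_Lipschitz:
  assumes x: "\<And>b. b \<in> V \<Longrightarrow> norm (x b) \<le> \<beta>" and x': "\<And>b. b \<in> V \<Longrightarrow> norm (x' b) \<le> \<beta>"
    and s: "\<And>b. b \<in> V \<Longrightarrow> norm (x' b - x b) \<le> s" "0 < s" "s \<le> 2 * \<beta>"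
    and \<beta>: "0 < \<beta>" "4 * \<beta> \<le> \<rho>" "\<rho> < rad" and a: "a \<in> V"
  shows "norm ((mean x' a - x' a) - (mean x a - x a)) \<le> 48 * \<beta> / \<rho>\<^sup>2 * s"
proof -
  define v where "v b = (x' b - x b) / of_real s" for b
  define F where "F z = mean (\<lambda>b. x b + z * v b) a - (x a + z * v a)" for z
  \<comment> \<open>For |z| \<le> 3 \<beta> the parameters stay within 4 \<beta>, hence this bound.
    The point \<open>x'\<close> sits at z = s \<le> 2 \<beta>, and every point of the disc of radius
    2 \<beta> has a disc of radius \<beta> left for the Cauchy estimate; the slope is B /
    \<beta>.\<close>
  define B where "B = 3 * (4 * \<beta>)\<^sup>2 / \<rho>\<^sup>2"
  have v: "norm (v b) \<le> 1" if "b \<in> V" for b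
    using s that by (simp add: v_def norm_divide)
  have xv: "norm (x b + z * v b) \<le> 4 * \<beta>" if "b \<in> V" "norm z \<le> 3 * \<beta>" for z b
  proof -
    have "norm (z * v b) \<le> norm z"
      using v[OF that(1)] by (simp add: norm_mult mult_left_le)
    then show ?thesis
      using x[OF that(1)] that(2) norm_triangle_ineq[of "x b" "z * v b"] by linarith
  qed
  have bound: "norm (F z) \<le> B" if "norm z \<le> 3 * \<beta>" for z
    unfolding F_def B_def using \<beta> xv that a
    by (intro mean_linearization) auto
  have hol: "F holomorphic_on cball 0 (3 * \<beta>)"
    unfolding F_def
  proof (intro holomorphic_intros holomorphic_mean)
    fix z :: complex and b assume "z \<in> cball 0 (3 * \<beta>)" "b \<in> V"
    then show "norm (x b + z * v b) \<le> rad"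
      using xv[of b z] \<beta> by auto
  qed
  have "norm (F (of_real s) - F 0) \<le> B / \<beta> * norm (of_real s - 0 :: complex)"
  proof (rule field_differentiable_bound[of "cball 0 (2 * \<beta>)" F "deriv F"])
    fix z :: complex assume z: "z \<in> cball 0 (2 * \<beta>)"
    have "F holomorphic_on ball 0 (3 * \<beta>)"
      using hol holomorphic_on_subset ball_subset_cball by blast
    moreover have "z \<in> ball 0 (3 * \<beta>)" using z \<beta> by auto
    ultimately show "(F has_field_derivative deriv F z) (at z within cball 0 (2 * \<beta>))"
      by (metis has_field_derivative_at_within holomorphic_derivI open_ball)
    have sub: "cball z \<beta> \<subseteq> cball 0 (3 * \<beta>)"
      using z by (auto simp: dist_norm) (smt (verit) norm_minus_commute norm_triangle_ineq2)
    have "norm ((deriv ^^ 1) F z) \<le> fact 1 * B / \<beta> ^ 1"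
    proof (rule Cauchy_inequality)
      show "F holomorphic_on ball z \<beta>"
        using hol sub ball_subset_cball holomorphic_on_subset by (meson order_trans)
      show "continuous_on (cball z \<beta>) F"
        using hol sub holomorphic_on_imp_continuous_on holomorphic_on_subset by blast
      fix y assume "norm (z - y) = \<beta>"
      then have "y \<in> cball 0 (3 * \<beta>)"
        using sub by (auto simp: dist_norm)
      then show "norm (F y) \<le> B" using bound by simp
    qed (rule \<beta>)
    then show "norm (deriv F z) \<le> B / \<beta>" by simp
  qed (use s \<beta> in auto)
  moreover have "B / \<beta> = 48 * \<beta> / \<rho>\<^sup>2"
    using \<beta> by (simp add: B_def power2_eq_square)
  moreover have "F (of_real s) = mean x' a - x' a" "F 0 = mean x a - x a"
    using s by (simp_all add: F_def v_def)
  ultimately show ?thesis using s by simp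
qed

text \<open>The largest coordinate difference s is attained at some \<open>b\<close>. There it is at
  most the change s / 2 of the remainder plus the change \<theta> of the expectation, so s \<le> 2
  \<theta>, and this covers all coordinates at once.\<close>

theorem mean_inverse_Lipschitz:
  assumes x: "\<And>b. b \<in> V \<Longrightarrow> norm (x b) \<le> \<beta>" and x': "\<And>b. b \<in> V \<Longrightarrow> norm (x' b) \<le> \<beta>"
    and \<beta>: "0 < \<beta>" "20000 * (real d + 1)\<^sup>2 * \<beta> \<le> 1"
    and \<theta>: "\<And>a. a \<in> V \<Longrightarrow> norm (mean x' a - mean x a) \<le> \<theta>" and a: "a \<in> V"
  shows "norm (x' a - x a) \<le> 2 * \<theta>"
proof -
  define s where "s = Max ((\<lambda>b. norm (x' b - x b)) ` V)"
  have s: "norm (x' b - x b) \<le> s" if "b \<in> V" for b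
    unfolding s_def using that finite_V by (intro Max_ge) auto
  have "s \<in> (\<lambda>b. norm (x' b - x b)) ` V"
    unfolding s_def using a finite_V by (intro Max_in) auto
  then obtain b where b: "b \<in> V" "s = norm (x' b - x b)" by blast
  have "s \<le> 2 * \<theta>"
  proof (cases "s = 0")
    case True
    have "0 \<le> \<theta>" using \<theta>[OF a] norm_ge_zero order_trans by blast
    with True show ?thesis by simp
  next
    case False
    \<comment> \<open>Slightly less than \<open>rad\<close>, because the remainder estimate needs a
      closed disc strictly inside the polydisc. The Lipschitz constant becomes 48 times 121 = 5808
      times (d + 1)^2 \<beta>, which the hypothesis with 20000 brings below 1/2.\<close>
    define \<rho> where "\<rho> = 1 / (11 * (real d + 1))"
    have "(real d + 1) * 1 \<le> (real d + 1) * (real d + 1)"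
      by (intro mult_left_mono) auto
    then have "(real d + 1) * \<beta> \<le> (real d + 1)\<^sup>2 * \<beta>"
      using \<beta> by (intro mult_right_mono) (auto simp: power2_eq_square)
    then have "4 * \<beta> \<le> \<rho>"
      using \<beta> by (simp add: \<rho>_def field_simps)
    moreover have "\<rho> < rad"
      by (simp add: \<rho>_def rad_def field_simps)
    moreover have "s \<le> 2 * \<beta>"
      using b x[OF b(1)] x'[OF b(1)] norm_triangle_ineq4[of "x' b" "x b"] by linarith
    moreover have "0 < s" using False b by simp
    ultimately have "norm ((mean x' b - x' b) - (mean x b - x b)) \<le> 48 * \<beta> / \<rho>\<^sup>2 * s"
      using x x' s \<beta> b by (intro mean_remainder_Lipschitz) auto
    also have "\<dots> \<le> 1 / 2 * s"
    proof (rule mult_right_mono)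
      have "48 * \<beta> / \<rho>\<^sup>2 = 5808 * (real d + 1)\<^sup>2 * \<beta>"
        by (simp add: \<rho>_def power2_eq_square field_simps)
      then show "48 * \<beta> / \<rho>\<^sup>2 \<le> 1 / 2" using \<beta> by simp
    qed (use \<open>0 < s\<close> in auto)
    finally have "norm ((mean x' b - x' b) - (mean x b - x b)) \<le> s / 2" by simp
    moreover have "norm (x' b - x b) \<le> norm ((mean x' b - x' b) - (mean x b - x b)) + norm (mean x' b - mean x b)"
      by (smt (verit, ccfv_threshold) add_diff_cancel_left' diff_add_cancel diff_diff_eq2 diff_right_commute norm_minus_commute norm_triangle_ineq4)
    ultimately show ?thesis using \<theta>[OF b(1)] b by simp
  qed
  then show ?thesis using s[OF a] by simp
qed

end

subsection \<open>Kronecker products and Pauli words\<close>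

lemma sum_div_mod:
  "(\<Sum>i<m * n. f (i div n) (i mod n)) = (\<Sum>a<m. \<Sum>b<(n::nat). f a b)"
proof -
  have "(\<Sum>i<m * n. f (i div n) (i mod n)) = (\<Sum>(a,b)\<in>{..<m} \<times> {..<n}. f a b)"
  proof (rule sum.reindex_bij_witness[where i = "\<lambda>(a,b). a * n + b" and j = "\<lambda>i. (i div n, i mod n)"])
    fix i assume "i \<in> {..<m * n}"
    then have "i < m * n" "0 < n" by (auto intro: gr0I)
    then show "(i div n, i mod n) \<in> {..<m} \<times> {..<n}"
      by (simp add: less_mult_imp_div_less)
  next
    fix ab assume "ab \<in> {..<m} \<times> {..<n}"
    then obtain a b where ab: "ab = (a, b)" "a < m" "b < n" by auto
    have "a * n + b < Suc a * n" using ab by simp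
    also have "\<dots> \<le> m * n" using ab by (intro mult_right_mono) auto
    finally show "(case ab of (a, b) \<Rightarrow> a * n + b) \<in> {..<m * n}" using ab by simp
  qed auto
  then show ?thesis by (simp add: sum.cartesian_product)
qed

lemma index_mult_sum:
  assumes "A \<in> carrier_mat m n" "B \<in> carrier_mat n l" "i < m" "j < l"
  shows "(A * B) $$ (i, j) = (\<Sum>k<n. A $$ (i, k) * B $$ (k, j))"
  using assms by (auto simp: scalar_prod_def lessThan_atLeast0 intro!: sum.cong)

lemma kron_carrier [intro]:
  "A \<in> carrier_mat m k \<Longrightarrow> B \<in> carrier_mat n l \<Longrightarrow> kron A B \<in> carrier_mat (m * n) (k * l)"
  by (auto simp: kron_def)

lemma kron_index:
  assumes "A \<in> carrier_mat d d" "B \<in> carrier_mat e e" "i < d * e" "j < d * e"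
  shows "kron A B $$ (i, j) = A $$ (i div e, j div e) * B $$ (i mod e, j mod e)"
  using assms by (simp add: kron_def)

lemma kron_mult:
  assumes A: "A \<in> carrier_mat d d" and B: "B \<in> carrier_mat e e" and C: "C \<in> carrier_mat d d" and D: "D \<in> carrier_mat e e"
  shows "kron A B * kron C D = kron (A * C) (B * D)"
proof (rule eq_matI)
  have AB: "kron A B \<in> carrier_mat (d * e) (d * e)" and CD: "kron C D \<in> carrier_mat (d * e) (d * e)"
    and AC: "A * C \<in> carrier_mat d d" and BD: "B * D \<in> carrier_mat e e"
    using assms by auto
  fix i j assume "i < dim_row (kron (A * C) (B * D))" "j < dim_col (kron (A * C) (B * D))"
  then have ij: "i < d * e" "j < d * e"
    using assms by (auto simp: kron_def)
  then have e: "0 < e" by (auto intro: gr0I)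
  have lt: "i div e < d" "i mod e < e" "j div e < d" "j mod e < e"
    using ij e by (simp_all add: less_mult_imp_div_less)
  have "(kron A B * kron C D) $$ (i, j) = (\<Sum>l<d * e. kron A B $$ (i, l) * kron C D $$ (l, j))"
    by (rule index_mult_sum[OF AB CD ij])
  also have "\<dots> = (\<Sum>l<d * e. (A $$ (i div e, l div e) * C $$ (l div e, j div e)) *
       (B $$ (i mod e, l mod e) * D $$ (l mod e, j mod e)))"
    by (rule sum.cong) (simp_all add: kron_index[OF A B] kron_index[OF C D] ij)
  also have "\<dots> = (\<Sum>a<d. \<Sum>b<e. (A $$ (i div e, a) * C $$ (a, j div e)) * (B $$ (i mod e, b) * D $$ (b, j mod e)))"
    by (rule sum_div_mod)
  also have "\<dots> = (A * C) $$ (i div e, j div e) * (B * D) $$ (i mod e, j mod e)"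
    by (simp only: sum_product index_mult_sum[OF A C lt(1,3)] index_mult_sum[OF B D lt(2,4)])
  also have "\<dots> = kron (A * C) (B * D) $$ (i, j)"
    by (rule kron_index[OF AC BD ij, symmetric])
  finally show "(kron A B * kron C D) $$ (i, j) = kron (A * C) (B * D) $$ (i, j)" .
qed (use assms in \<open>auto simp: kron_def\<close>)

lemma mtrace_kron:
  assumes "A \<in> carrier_mat d d" "B \<in> carrier_mat e e"
  shows "mtrace (kron A B) = mtrace A * mtrace B"
proof -
  have "mtrace (kron A B) = (\<Sum>i<d * e. A $$ (i div e, i div e) * B $$ (i mod e, i mod e))"
    using assms by (auto simp: mtrace_def kron_def intro!: sum.cong)
  also have "\<dots> = mtrace A * mtrace B"
    using assms by (subst sum_div_mod) (simp add: mtrace_def sum_product)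
  finally show ?thesis .
qed

lemma kron_one: "kron (1\<^sub>m d) (1\<^sub>m e) = 1\<^sub>m (d * e)"
proof (rule eq_matI)
  fix i j assume ij: "i < dim_row (1\<^sub>m (d * e) :: complex mat)" "j < dim_col (1\<^sub>m (d * e) :: complex mat)"
  then have "0 < e" by (auto intro: gr0I)
  then have lt: "i div e < d" "i mod e < e" "j div e < d" "j mod e < e"
    using ij by (simp_all add: less_mult_imp_div_less)
  have "i = j \<longleftrightarrow> i div e = j div e \<and> i mod e = j mod e"
    by (metis div_mult_mod_eq)
  then show "kron (1\<^sub>m d) (1\<^sub>m e) $$ (i, j) = (1\<^sub>m (d * e) :: complex mat) $$ (i, j)"
    using ij lt by (simp add: kron_def)
qed (simp_all add: kron_def)

definition kron_list :: "complex mat list \<Rightarrow> complex mat" where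
  "kron_list As = foldr kron As (1\<^sub>m 1)"

lemma kron_list_simps [simp]:
  "kron_list [] = 1\<^sub>m 1" "kron_list (A # As) = kron A (kron_list As)"
  by (simp_all add: kron_list_def)

lemma kron_list_carrier:
  "\<forall>A\<in>set As. A \<in> carrier_mat d d \<Longrightarrow> kron_list As \<in> carrier_mat (d ^ length As) (d ^ length As)"
  by (induction As) auto

lemma kron_list_mult:
  assumes "\<And>z. z \<in> set zs \<Longrightarrow> f z \<in> carrier_mat d d" "\<And>z. z \<in> set zs \<Longrightarrow> g z \<in> carrier_mat d d"
  shows "kron_list (map f zs) * kron_list (map g zs) = kron_list (map (\<lambda>z. f z * g z) zs)"
  using assms
proof (induction zs)
  case (Cons z zs)
  have "kron_list (map f zs) \<in> carrier_mat (d ^ length zs) (d ^ length zs)"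
    "kron_list (map g zs) \<in> carrier_mat (d ^ length zs) (d ^ length zs)"
    using Cons.prems kron_list_carrier[of "map f zs" d] kron_list_carrier[of "map g zs" d] by auto
  with Cons show ?case by (simp add: kron_mult[where d = d and e = "d ^ length zs"])
qed simp

lemma mtrace_kron_list:
  assumes "\<And>z. z \<in> set zs \<Longrightarrow> f z \<in> carrier_mat d d"
  shows "mtrace (kron_list (map f zs)) = (\<Prod>z\<leftarrow>zs. mtrace (f z))"
  using assms
proof (induction zs)
  case Nil
  show ?case by (simp add: mtrace_def)
next
  case (Cons z zs)
  have "kron_list (map f zs) \<in> carrier_mat (d ^ length zs) (d ^ length zs)"
    using Cons.prems kron_list_carrier[of "map f zs" d] by auto
  with Cons show ?case by (simp add: mtrace_kron[where d = d and e = "d ^ length zs"])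
qed

lemma kron_list_one: "kron_list (map (\<lambda>z. 1\<^sub>m d) zs) = 1\<^sub>m (d ^ length zs)"
  by (induction zs) (simp_all add: kron_one)

lemma tensor_pow_eq: "tensor_pow A (length zs) = kron_list (map (\<lambda>_. A) zs)"
  by (induction zs) simp_all

lemma pauli_string_eq: "pauli_string p = kron_list (map pauli p)"
  unfolding pauli_string_def kron_list_def by (induction p) auto

text \<open>Multilinearity: a tensor product of sums is the sum over all choices of one summand per
  factor. The factors are qubits, with eigenvalue signs as \<open>s\<close>, in one application, and
  copies of the state, with \<open>s\<close> equal to 1, in the other.\<close>

lemma sum_words_kron_list:
  assumes fin: "finite B" and Q: "\<And>x b. x \<in> set xs \<Longrightarrow> b \<in> B \<Longrightarrow> Q x b \<in> carrier_mat d d"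
    and ij: "i < d ^ length xs" "j < d ^ length xs"
  shows "(\<Sum>bs\<in>words B (length xs). (\<Prod>(x,b)\<leftarrow>zip xs bs. s x b) * kron_list (map (\<lambda>(x,b). Q x b) (zip xs bs)) $$ (i, j)) =
    kron_list (map (\<lambda>x. Matrix.mat d d (\<lambda>ij. \<Sum>b\<in>B. s x b * Q x b $$ ij)) xs) $$ (i, j)"
  using Q ij
proof (induction xs arbitrary: i j)
  case (Cons x xs)
  let ?e = "d ^ length xs"
  let ?S = "\<lambda>x. Matrix.mat d d (\<lambda>ij. \<Sum>b\<in>B. s x b * Q x b $$ ij)"
  have "0 < ?e" using Cons.prems by (auto intro!: gr0I)
  then have lt: "i div ?e < d" "i mod ?e < ?e" "j div ?e < d" "j mod ?e < ?e"
    using Cons.prems by (simp_all add: less_mult_imp_div_less)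
  have k: "kron_list (map (\<lambda>(x,b). Q x b) (zip (x # xs) (b # bs))) $$ (i, j) =
      Q x b $$ (i div ?e, j div ?e) * kron_list (map (\<lambda>(x,b). Q x b) (zip xs bs)) $$ (i mod ?e, j mod ?e)"
    if "b \<in> B" "bs \<in> words B (length xs)" for b bs
  proof -
    have "\<forall>A\<in>set (map (\<lambda>(x,b). Q x b) (zip xs bs)). A \<in> carrier_mat d d"
    proof
      fix A assume "A \<in> set (map (\<lambda>(x,b). Q x b) (zip xs bs))"
      then obtain x' b' where "(x', b') \<in> set (zip xs bs)" and A: "A = Q x' b'" by auto
      then have "x' \<in> set xs" "b' \<in> set bs"
        by (blast dest: set_zip_leftD set_zip_rightD)+
      then show "A \<in> carrier_mat d d"
        using Cons.prems(1)[of x' b'] that A by (auto simp: words_def)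
    qed
    from kron_list_carrier[OF this] that
    have "kron_list (map (\<lambda>(x,b). Q x b) (zip xs bs)) \<in> carrier_mat ?e ?e"
      by (simp add: words_def)
    then show ?thesis
      using kron_index[of "Q x b" d _ ?e i j] Cons.prems that by simp
  qed
  have S: "kron_list (map ?S xs) \<in> carrier_mat ?e ?e"
    using kron_list_carrier[of "map ?S xs" d] by auto
  have "(\<Sum>bs\<in>words B (length (x # xs)). (\<Prod>(x,b)\<leftarrow>zip (x # xs) bs. s x b) * kron_list (map (\<lambda>(x,b). Q x b) (zip (x # xs) bs)) $$ (i, j)) =
     (\<Sum>b\<in>B. \<Sum>bs\<in>words B (length xs). (s x b * Q x b $$ (i div ?e, j div ?e)) *
        ((\<Prod>(x,b)\<leftarrow>zip xs bs. s x b) * kron_list (map (\<lambda>(x,b). Q x b) (zip xs bs)) $$ (i mod ?e, j mod ?e)))"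
    unfolding list.size(4) add_Suc_right add_0_right sum_words_Suc
  proof (intro sum.cong refl)
    fix b bs assume "b \<in> B" "bs \<in> words B (length xs)"
    then show "(\<Prod>(x,b)\<leftarrow>zip (x # xs) (b # bs). s x b) * kron_list (map (\<lambda>(x,b). Q x b) (zip (x # xs) (b # bs))) $$ (i, j) =
      (s x b * Q x b $$ (i div ?e, j div ?e)) *
        ((\<Prod>(x,b)\<leftarrow>zip xs bs. s x b) * kron_list (map (\<lambda>(x,b). Q x b) (zip xs bs)) $$ (i mod ?e, j mod ?e))"
      by (subst k) (simp_all only: zip_Cons_Cons list.map prod_list.Cons split_conv mult_ac)
  qed
  also have "\<dots> = (\<Sum>b\<in>B. s x b * Q x b $$ (i div ?e, j div ?e)) *
      (\<Sum>bs\<in>words B (length xs). (\<Prod>(x,b)\<leftarrow>zip xs bs. s x b) * kron_list (map (\<lambda>(x,b). Q x b) (zip xs bs)) $$ (i mod ?e, j mod ?e))"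
    by (rule sum_product[symmetric])
  also have "\<dots> = (\<Sum>b\<in>B. s x b * Q x b $$ (i div ?e, j div ?e)) * kron_list (map ?S xs) $$ (i mod ?e, j mod ?e)"
    using Cons.prems lt by (subst Cons.IH) auto
  also have "\<dots> = kron_list (map ?S (x # xs)) $$ (i, j)"
    using kron_index[of "?S x" d _ ?e i j, OF _ S] Cons.prems lt by simp
  finally show ?case .
qed simp

section \<open>Pauli strings and normalized traces of their products\<close>

lemma pauli_carrier [simp]: "pauli k \<in> carrier_mat 2 2"
  by (auto simp: pauli_def mat_of_rows_list_def)

lemma pauli_string_carrier: "pauli_string p \<in> carrier_mat (2 ^ length p) (2 ^ length p)"
  unfolding pauli_string_eq using kron_list_carrier[of "map pauli p" 2] by simp

lemma pauli_0: "pauli 0 = 1\<^sub>m 2"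
  by (simp add: pauli_def)

definition word_mat :: "('i \<Rightarrow> complex mat) \<Rightarrow> nat \<Rightarrow> 'i list \<Rightarrow> complex mat" where
  "word_mat E d w = foldr (\<lambda>a A. E a * A) w (1\<^sub>m d)"

lemma word_mat_simps [simp]:
  "word_mat E d [] = 1\<^sub>m d" "word_mat E d (a # w) = E a * word_mat E d w"
  by (simp_all add: word_mat_def)

lemma word_mat_carrier:
  "\<lbrakk>\<And>a. a \<in> set w \<Longrightarrow> E a \<in> carrier_mat d d\<rbrakk> \<Longrightarrow> word_mat E d w \<in> carrier_mat d d"
  by (induction w) (auto intro!: mult_carrier_mat[of _ d d])

lemma word_mat_append:
  assumes "\<And>a. a \<in> set u \<union> set w \<Longrightarrow> E a \<in> carrier_mat d d"
  shows "word_mat E d (u @ w) = word_mat E d u * word_mat E d w"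
  using assms
proof (induction u)
  case Nil
  then show ?case using word_mat_carrier[of w E d] by simp
next
  case (Cons a u)
  have "word_mat E d u \<in> carrier_mat d d" "word_mat E d w \<in> carrier_mat d d" "E a \<in> carrier_mat d d"
    using Cons.prems by (auto intro!: word_mat_carrier)
  with Cons show ?case 
    by (simp add: assoc_mult_mat[of "E a" d d "word_mat E d u" d "word_mat E d w" d])
qed

lemma word_mat_pauli_string:
  assumes "\<And>a. a \<in> set w \<Longrightarrow> length (E a) = N"
  shows "word_mat (\<lambda>a. pauli_string (E a)) (2 ^ N) w =
    kron_list (map (\<lambda>i. word_mat (\<lambda>a. pauli (E a ! i)) 2 w) [0..<N])"
  using assms
proof (induction w)
  case Nil
  then show ?case using kron_list_one[of 2 "[0..<N]"] by simp
next
  case (Cons a w)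
  have nth: "map (\<lambda>i. E a ! i) [0..<N] = E a"
    using Cons.prems[of a] map_nth[of "E a"] by simp
  have "kron_list (map (\<lambda>i. pauli (E a ! i)) [0..<N]) = kron_list (map pauli (map (\<lambda>i. E a ! i) [0..<N]))"
    by (simp add: comp_def)
  then have "pauli_string (E a) = kron_list (map (\<lambda>i. pauli (E a ! i)) [0..<N])"
    unfolding nth pauli_string_eq ..
  then show ?case
    using Cons by (simp add: kron_list_mult[where d = 2] word_mat_carrier)
qed

text \<open>The trace of the product along \<open>w\<close> divided by 2^N, written as a product
  over qubits: factorization can then be checked on each qubit separately. Since
  \<open>pauli\<close> is total, the norm bound holds for arbitrary words.\<close>

definition word_tr :: "nat \<Rightarrow> (nat \<Rightarrow> nat list) \<Rightarrow> nat list \<Rightarrow> complex" where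
  "word_tr N E w = (\<Prod>i\<leftarrow>[0..<N]. mtrace (word_mat (\<lambda>a. pauli (E a ! i)) 2 w) / 2)"

lemma mtrace_word_mat_pauli_string:
  assumes "\<And>a. a \<in> set w \<Longrightarrow> length (E a) = N"
  shows "mtrace (word_mat (\<lambda>a. pauli_string (E a)) (2 ^ N) w) = 2 ^ N * word_tr N E w"
proof -
  have halves: "prod_list (map f js) = 2 ^ length js * prod_list (map (\<lambda>i. f i / 2) js)"
    for f :: "nat \<Rightarrow> complex" and js
    by (induction js) simp_all
  have "mtrace (word_mat (\<lambda>a. pauli_string (E a)) (2 ^ N) w) =
      (\<Prod>i\<leftarrow>[0..<N]. mtrace (word_mat (\<lambda>a. pauli (E a ! i)) 2 w))"
    by (subst word_mat_pauli_string[OF assms]) (auto intro!: mtrace_kron_list[where d = 2] word_mat_carrier)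
  also have "\<dots> = 2 ^ N * word_tr N E w"
    unfolding word_tr_def by (subst halves) simp
  finally show ?thesis .
qed

lemma sum_lessThan_2: "(\<Sum>i<2. f i) = f 0 + f (Suc 0)"
  by (simp add: numeral_2_eq_2)

lemma pauli_index:
  "pauli k $$ (0, 0) = (if k = 1 \<or> k = 2 then 0 else 1)"
  "pauli k $$ (0, Suc 0) = (if k = 1 then 1 else if k = 2 then -\<i> else 0)"
  "pauli k $$ (Suc 0, 0) = (if k = 1 then 1 else if k = 2 then \<i> else 0)"
  "pauli k $$ (Suc 0, Suc 0) = (if k = 1 \<or> k = 2 then 0 else if k = 3 then -1 else 1)"
  by (simp_all add: pauli_def mat_of_rows_list_def)

text \<open>The maximal absolute row sum is submultiplicative, and it is 1 for each Pauli matrix. So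
  every diagonal entry of a product has modulus at most 1, and a 2 by 2 trace has modulus at most
  2.\<close>

lemma norm_word_tr_le: "norm (word_tr N E w) \<le> 1"
proof -
  have row: "(\<Sum>s<2. norm (word_mat (\<lambda>a. pauli (E a ! i)) 2 w $$ (r, s))) \<le> 1" if "r < 2" for r i
    using that
  proof (induction w arbitrary: r)
    case Nil
    then show ?case by (auto simp: sum_lessThan_2 less_2_cases_iff)
  next
    case (Cons a w)
    let ?X = "word_mat (\<lambda>a. pauli (E a ! i)) 2 w"
    have X: "?X \<in> carrier_mat 2 2" by (auto intro: word_mat_carrier)
    have p: "(\<Sum>l<2. norm (pauli k $$ (r, l))) \<le> 1" for k
      using Cons.prems by (auto simp: sum_lessThan_2 pauli_index less_2_cases_iff)
    have "(\<Sum>s<2. norm ((pauli (E a ! i) * ?X) $$ (r, s))) \<le>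
        (\<Sum>s<2. \<Sum>l<2. norm (pauli (E a ! i) $$ (r, l)) * norm (?X $$ (l, s)))"
      by (intro sum_mono)
        (auto simp: index_mult_sum[OF pauli_carrier X Cons.prems] norm_mult intro!: sum_norm_le)
    also have "\<dots> = (\<Sum>l<2. norm (pauli (E a ! i) $$ (r, l)) * (\<Sum>s<2. norm (?X $$ (l, s))))"
      by (subst sum.swap) (simp add: sum_distrib_left)
    also have "\<dots> \<le> (\<Sum>l<2. norm (pauli (E a ! i) $$ (r, l)) * 1)"
      using Cons.IH by (intro sum_mono mult_left_mono) auto
    also have "\<dots> \<le> 1" using p[of "E a ! i"] by simp
    finally show ?case by simp
  qed
  have "norm (mtrace (word_mat (\<lambda>a. pauli (E a ! i)) 2 w) / 2) \<le> 1" for i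
  proof -
    let ?X = "word_mat (\<lambda>a. pauli (E a ! i)) 2 w"
    have X: "?X \<in> carrier_mat 2 2" by (auto intro: word_mat_carrier)
    have "norm (?X $$ (r, r)) \<le> 1" if "r < 2" for r
      using row[OF that, of i] member_le_sum[of r "{..<2}" "\<lambda>s. norm (?X $$ (r, s))"] that by auto
    from this[of 0] this[of 1] have "norm (?X $$ (0, 0) + ?X $$ (1, 1)) \<le> 2"
      using norm_triangle_ineq[of "?X $$ (0, 0)" "?X $$ (1, 1)"] by simp
    moreover have "mtrace ?X = ?X $$ (0, 0) + ?X $$ (1, 1)"
      using X by (simp add: mtrace_def sum_lessThan_2)
    ultimately show ?thesis by (simp add: norm_divide)
  qed
  note le1 = this
  have "norm (prod_list (map (\<lambda>i. mtrace (word_mat (\<lambda>a. pauli (E a ! i)) 2 w) / 2) js)) \<le> 1" for js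
  proof (induction js)
    case (Cons i js)
    then show ?case
      by (simp only: list.map prod_list.Cons norm_mult) (intro mult_le_one norm_ge_zero le1)
  qed simp
  then show ?thesis by (simp add: word_tr_def)
qed

lemma word_mat_filter:
  assumes "\<And>a. a \<in> set w \<Longrightarrow> \<not> P a \<Longrightarrow> E a = 1\<^sub>m d" "\<And>a. a \<in> set w \<Longrightarrow> E a \<in> carrier_mat d d"
  shows "word_mat E d w = word_mat E d (filter P w)"
  using assms
proof (induction w)
  case (Cons a w)
  have "word_mat E d w \<in> carrier_mat d d" using Cons.prems by (auto intro!: word_mat_carrier)
  with Cons show ?case by auto
qed simp

text \<open>At most one of the groups \<open>A\<close> and \<open>B\<close> acts on a given qubit.
  Deleting the letters of the other group changes nothing there, and the word formed by those
  letters has normalized trace 1 on that qubit.\<close>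

lemma word_tr_factor:
  assumes len: "\<And>a. a \<in> A \<union> B \<Longrightarrow> length (E a) = N"
    and disj: "\<And>a b. a \<in> A \<Longrightarrow> b \<in> B \<Longrightarrow> pauli_support (E a) \<inter> pauli_support (E b) = {}"
    and w: "set w \<subseteq> A \<union> B"
  shows "word_tr N E w = word_tr N E (filter (\<lambda>z. z \<in> A) w) * word_tr N E (filter (\<lambda>z. z \<in> B) w)"
proof -
  define t where "t i w = mtrace (word_mat (\<lambda>a. pauli (E a ! i)) 2 w) / 2" for i w
  have one: "t i w' = 1" if "\<And>a. a \<in> set w' \<Longrightarrow> E a ! i = 0" for i w'
  proof -
    have "word_mat (\<lambda>a. pauli (E a ! i)) 2 w' = word_mat (\<lambda>a. pauli (E a ! i)) 2 (filter (\<lambda>_. False) w')"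
      by (rule word_mat_filter) (use that in \<open>auto simp: pauli_0\<close>)
    then show ?thesis by (simp add: t_def mtrace_def)
  qed
  have red: "t i w = t i (filter (\<lambda>z. z \<in> S) w)" if "\<And>a. a \<in> set w \<Longrightarrow> a \<notin> S \<Longrightarrow> E a ! i = 0" for i S
  proof -
    have "word_mat (\<lambda>a. pauli (E a ! i)) 2 w = word_mat (\<lambda>a. pauli (E a ! i)) 2 (filter (\<lambda>z. z \<in> S) w)"
      by (rule word_mat_filter) (use that in \<open>auto simp: pauli_0\<close>)
    then show ?thesis by (simp add: t_def)
  qed
  have t: "t i w = t i (filter (\<lambda>z. z \<in> A) w) * t i (filter (\<lambda>z. z \<in> B) w)" if i: "i < N" for i
  proof (cases "\<forall>a\<in>A. E a ! i = 0")
    case True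
    then have "t i (filter (\<lambda>z. z \<in> A) w) = 1" by (intro one) auto
    moreover have "t i w = t i (filter (\<lambda>z. z \<in> B) w)" using True w by (intro red) auto
    ultimately show ?thesis by simp
  next
    case False
    then obtain a where a: "a \<in> A" "i \<in> pauli_support (E a)"
      using i len by (auto simp: pauli_support_def)
    have B: "E b ! i = 0" if "b \<in> B" for b
      using disj[OF a(1) that] a(2) i len[of b] that by (auto simp: pauli_support_def)
    then have "t i (filter (\<lambda>z. z \<in> B) w) = 1" by (intro one) auto
    moreover have "t i w = t i (filter (\<lambda>z. z \<in> A) w)" using B w by (intro red) auto
    ultimately show ?thesis by simp
  qed
  have "set js \<subseteq> {..<N} \<Longrightarrow> prod_list (map (\<lambda>i. t i w) js) =
      prod_list (map (\<lambda>i. t i (filter (\<lambda>z. z \<in> A) w)) js) * prod_list (map (\<lambda>i. t i (filter (\<lambda>z. z \<in> B) w)) js)" for js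
    by (induction js) (simp_all add: t mult_ac)
  moreover have "set [0..<N] \<subseteq> {..<N}" by auto
  ultimately have "prod_list (map (\<lambda>i. t i w) [0..<N]) =
      prod_list (map (\<lambda>i. t i (filter (\<lambda>z. z \<in> A) w)) [0..<N]) *
      prod_list (map (\<lambda>i. t i (filter (\<lambda>z. z \<in> B) w)) [0..<N])"
    by blast
  then show ?thesis by (simp only: word_tr_def t_def)
qed

subsection \<open>Hermitian matrices and the matrix exponential\<close>

definition herm :: "nat \<Rightarrow> complex mat \<Rightarrow> bool" where
  "herm d A \<longleftrightarrow> A \<in> carrier_mat d d \<and> (\<forall>i<d. \<forall>j<d. A $$ (i, j) = cnj (A $$ (j, i)))"

lemma hermD: "herm d A \<Longrightarrow> i < d \<Longrightarrow> j < d \<Longrightarrow> A $$ (i, j) = cnj (A $$ (j, i))"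
  unfolding herm_def by blast

lemma herm_carrier: "herm d A \<Longrightarrow> A \<in> carrier_mat d d"
  unfolding herm_def by blast

lemma herm_one: "herm d (1\<^sub>m d)"
  unfolding herm_def by auto

lemma herm_mult_index:
  assumes "herm d A" "herm d B" "i < d" "j < d"
  shows "(A * B) $$ (i, j) = cnj ((B * A) $$ (j, i))"
proof -
  have "(A * B) $$ (i, j) = (\<Sum>k<d. A $$ (i, k) * B $$ (k, j))"
    by (rule index_mult_sum) (use assms in \<open>auto dest: herm_carrier\<close>)
  also have "\<dots> = (\<Sum>k<d. cnj (B $$ (j, k) * A $$ (k, i)))"
  proof (rule sum.cong[OF refl])
    fix k assume "k \<in> {..<d}"
    then have "A $$ (i, k) = cnj (A $$ (k, i))" "B $$ (k, j) = cnj (B $$ (j, k))"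
      using hermD[OF assms(1), of i k] hermD[OF assms(2), of k j] assms(3,4) by blast+
    then show "A $$ (i, k) * B $$ (k, j) = cnj (B $$ (j, k) * A $$ (k, i))"
      by (metis complex_cnj_mult mult.commute)
  qed
  also have "\<dots> = cnj ((B * A) $$ (j, i))"
    by (subst index_mult_sum[of B d d A d]) (use assms in \<open>auto dest: herm_carrier\<close>)
  finally show ?thesis .
qed

text \<open>The quadratic form of K K at v is the squared norm of K v. A Hermitian idempotent is its
  own square, so projections are covered.\<close>

lemma psd_square:
  assumes "herm d K"
  shows "psd d (K * K)"
  unfolding psd_def
proof (intro conjI allI impI)
  have K: "K \<in> carrier_mat d d" using assms by (rule herm_carrier)
  then show "K * K \<in> carrier_mat d d" by simp
  show "(K * K) $$ (i, j) = cnj ((K * K) $$ (j, i))" if "i < d" "j < d" for i j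
    by (rule herm_mult_index[OF assms assms that])
  fix v :: "complex Matrix.vec"
  define w where "w k = (\<Sum>j<d. K $$ (k, j) * vec_index v j)" for k
  have "(\<Sum>i<d. \<Sum>j<d. cnj (vec_index v i) * (K * K) $$ (i, j) * vec_index v j) =
      (\<Sum>i<d. \<Sum>j<d. \<Sum>k<d. cnj (K $$ (k, i) * vec_index v i) * (K $$ (k, j) * vec_index v j))"
  proof (intro sum.cong refl)
    fix i j assume ij: "i \<in> {..<d}" "j \<in> {..<d}"
    have "(K * K) $$ (i, j) = (\<Sum>k<d. K $$ (i, k) * K $$ (k, j))"
      by (rule index_mult_sum[OF K K]) (use ij in auto)
    also have "\<dots> = (\<Sum>k<d. cnj (K $$ (k, i)) * K $$ (k, j))"
    proof (rule sum.cong[OF refl])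
      fix k assume "k \<in> {..<d}"
      then have "K $$ (i, k) = cnj (K $$ (k, i))"
        using hermD[OF assms, of i k] ij by blast
      then show "K $$ (i, k) * K $$ (k, j) = cnj (K $$ (k, i)) * K $$ (k, j)"
        by (rule arg_cong)
    qed
    finally show "cnj (vec_index v i) * (K * K) $$ (i, j) * vec_index v j =
        (\<Sum>k<d. cnj (K $$ (k, i) * vec_index v i) * (K $$ (k, j) * vec_index v j))"
      by (simp add: sum_distrib_left sum_distrib_right mult_ac)
  qed
  also have "\<dots> = (\<Sum>i<d. \<Sum>k<d. \<Sum>j<d. cnj (K $$ (k, i) * vec_index v i) * (K $$ (k, j) * vec_index v j))"
    by (intro sum.cong refl sum.swap)
  also have "\<dots> = (\<Sum>k<d. \<Sum>i<d. \<Sum>j<d. cnj (K $$ (k, i) * vec_index v i) * (K $$ (k, j) * vec_index v j))"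
    by (rule sum.swap)
  also have "\<dots> = (\<Sum>k<d. cnj (w k) * w k)"
    unfolding w_def cnj_sum sum_product ..
  also have "\<dots> = of_real (\<Sum>k<d. (norm (w k))\<^sup>2)"
    by (simp add: complex_norm_square mult.commute del: of_real_power)
  finally show "let q = \<Sum>i<d. \<Sum>j<d. cnj (vec_index v i) * (K * K) $$ (i, j) * vec_index v j in Im q = 0 \<and> 0 \<le> Re q"
    by (simp add: Let_def sum_nonneg)
qed

lemma psd_sum:
  assumes fin: "finite I" and G: "\<And>x. x \<in> I \<Longrightarrow> psd d (G x)"
  shows "psd d (Matrix.mat d d (\<lambda>ij. \<Sum>x\<in>I. G x $$ ij))"
  unfolding psd_def
proof (intro conjI allI impI)
  fix i j assume ij: "i < d" "j < d"
  show "Matrix.mat d d (\<lambda>ij. \<Sum>x\<in>I. G x $$ ij) $$ (i, j) = cnj (Matrix.mat d d (\<lambda>ij. \<Sum>x\<in>I. G x $$ ij) $$ (j, i))"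
  proof -
    have "(\<Sum>x\<in>I. G x $$ (i, j)) = (\<Sum>x\<in>I. cnj (G x $$ (j, i)))"
    proof (rule sum.cong[OF refl])
      fix x assume "x \<in> I"
      then show "G x $$ (i, j) = cnj (G x $$ (j, i))"
        using G[of x] ij unfolding psd_def by blast
    qed
    then show ?thesis using ij by simp
  qed
next
  fix v :: "complex Matrix.vec" assume v: "v \<in> carrier_vec d"
  let ?q = "\<lambda>A. \<Sum>i<d. \<Sum>j<d. cnj (vec_index v i) * A $$ (i, j) * vec_index v j"
  have "?q (Matrix.mat d d (\<lambda>ij. \<Sum>x\<in>I. G x $$ ij)) =
      (\<Sum>i<d. \<Sum>j<d. \<Sum>x\<in>I. cnj (vec_index v i) * G x $$ (i, j) * vec_index v j)"
    by (intro sum.cong refl) (simp add: sum_distrib_left sum_distrib_right)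
  also have "\<dots> = (\<Sum>i<d. \<Sum>x\<in>I. \<Sum>j<d. cnj (vec_index v i) * G x $$ (i, j) * vec_index v j)"
    by (intro sum.cong refl sum.swap)
  also have "\<dots> = (\<Sum>x\<in>I. ?q (G x))"
    by (rule sum.swap)
  finally have q: "?q (Matrix.mat d d (\<lambda>ij. \<Sum>x\<in>I. G x $$ ij)) = (\<Sum>x\<in>I. ?q (G x))" .
  define q where "q x = ?q (G x)" for x
  have "Im (q x) = 0 \<and> 0 \<le> Re (q x)" if "x \<in> I" for x
    using G[OF that] v unfolding psd_def Let_def q_def by blast
  then have "Im (\<Sum>x\<in>I. q x) = 0 \<and> 0 \<le> Re (\<Sum>x\<in>I. q x)"
    by (simp add: sum_nonneg)
  then show "let q = ?q (Matrix.mat d d (\<lambda>ij. \<Sum>x\<in>I. G x $$ ij)) in Im q = 0 \<and> 0 \<le> Re q"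
    unfolding q Let_def q_def .
qed simp

lemma mtrace_mult:
  assumes "A \<in> carrier_mat d e" "B \<in> carrier_mat e d"
  shows "mtrace (A * B) = (\<Sum>i<d. \<Sum>j<e. A $$ (i, j) * B $$ (j, i))"
proof -
  have "mtrace (A * B) = (\<Sum>i<d. (A * B) $$ (i, i))"
    using assms by (simp add: mtrace_def)
  also have "\<dots> = (\<Sum>i<d. \<Sum>j<e. A $$ (i, j) * B $$ (j, i))"
    by (rule sum.cong[OF refl], rule index_mult_sum[OF assms]) auto
  finally show ?thesis .
qed

lemma mtrace_mult_commute:
  assumes "A \<in> carrier_mat d d" "B \<in> carrier_mat d d"
  shows "mtrace (A * B) = mtrace (B * A)"
  unfolding mtrace_mult[OF assms] mtrace_mult[OF assms(2,1)]
  by (subst sum.swap) (simp add: mult.commute)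

text \<open>By idempotence and cyclicity this is the trace of Q K K Q, the sum of the squared moduli
  of the entries of Q K. With K K an exponential it gives nonnegative outcome weights.\<close>

lemma mtrace_projection_square:
  assumes Q: "herm d Q" "Q * Q = Q" and K: "herm d K"
  shows "\<exists>t\<ge>0. mtrace (Q * (K * K)) = complex_of_real t"
proof -
  have Qc: "Q \<in> carrier_mat d d" and Kc: "K \<in> carrier_mat d d"
    using Q K by (auto dest: herm_carrier)
  have c: "Q * K \<in> carrier_mat d d" "K * Q \<in> carrier_mat d d" "K * K \<in> carrier_mat d d"
    using Qc Kc by auto
  have "mtrace (Q * (K * K)) = mtrace (Q * (Q * (K * K)))"
    using assoc_mult_mat[OF Qc Qc c(3)] Q(2) by simp
  also have "\<dots> = mtrace ((Q * (K * K)) * Q)"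
    using Qc c by (intro mtrace_mult_commute[of _ d]) auto
  also have "(Q * (K * K)) * Q = (Q * K) * (K * Q)"
    using assoc_mult_mat[OF Qc Kc Kc] assoc_mult_mat[OF c(1) Kc Qc] by simp
  also have "mtrace ((Q * K) * (K * Q)) = (\<Sum>i<d. \<Sum>j<d. (Q * K) $$ (i, j) * (K * Q) $$ (j, i))"
    by (rule mtrace_mult[OF c(1,2)])
  also have "\<dots> = (\<Sum>i<d. \<Sum>j<d. of_real ((norm ((Q * K) $$ (i, j)))\<^sup>2))"
  proof (intro sum.cong refl)
    fix i j assume "i \<in> {..<d}" "j \<in> {..<d}"
    then show "(Q * K) $$ (i, j) * (K * Q) $$ (j, i) = of_real ((norm ((Q * K) $$ (i, j)))\<^sup>2)"
      by (subst herm_mult_index[OF K Q(1)]) (auto simp: complex_norm_square simp del: of_real_power)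
  qed
  also have "\<dots> = complex_of_real (\<Sum>i<d. \<Sum>j<d. (norm ((Q * K) $$ (i, j)))\<^sup>2)"
    by simp
  finally show ?thesis
    by (intro exI[of _ "\<Sum>i<d. \<Sum>j<d. (norm ((Q * K) $$ (i, j)))\<^sup>2"]) (auto intro!: sum_nonneg)
qed

lemma herm_kron:
  assumes A: "herm d A" and B: "herm e B"
  shows "herm (d * e) (kron A B)"
  unfolding herm_def
proof (intro conjI allI impI)
  have Ac: "A \<in> carrier_mat d d" and Bc: "B \<in> carrier_mat e e"
    using A B by (auto dest: herm_carrier)
  then show "kron A B \<in> carrier_mat (d * e) (d * e)" by auto
  fix i j assume ij: "i < d * e" "j < d * e"
  then have "0 < e" by (auto intro: gr0I)
  then have "i div e < d" "i mod e < e" "j div e < d" "j mod e < e"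
    using ij by (simp_all add: less_mult_imp_div_less)
  then have "A $$ (i div e, j div e) * B $$ (i mod e, j mod e) =
      cnj (A $$ (j div e, i div e)) * cnj (B $$ (j mod e, i mod e))"
    using hermD[OF A, of "i div e" "j div e"] hermD[OF B, of "i mod e" "j mod e"] by metis
  then show "kron A B $$ (i, j) = cnj (kron A B $$ (j, i))"
    by (simp add: kron_index[OF Ac Bc] ij)
qed

lemma herm_kron_list:
  "\<forall>A\<in>set As. herm d A \<Longrightarrow> herm (d ^ length As) (kron_list As)"
  by (induction As) (simp_all add: herm_one herm_kron)

section \<open>Matrix powers and the exponential series\<close>

lemma pow_mat_add:
  fixes A :: "complex mat"
  assumes "A \<in> carrier_mat d d"
  shows "A ^\<^sub>m (m + k) = A ^\<^sub>m m * A ^\<^sub>m k"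
proof (induction k)
  case 0
  show ?case using assms by simp
next
  case (Suc k)
  have "A ^\<^sub>m m \<in> carrier_mat d d" "A ^\<^sub>m k \<in> carrier_mat d d" using assms by auto
  then show ?case using Suc assms by (simp add: assoc_mult_mat[of _ d d _ d _ d])
qed

lemma pow_mat_Suc_left:
  fixes A :: "complex mat"
  assumes "A \<in> carrier_mat d d"
  shows "A ^\<^sub>m Suc k = A * A ^\<^sub>m k"
  using pow_mat_add[OF assms, of 1 k] assms by simp

lemma smult_pow_mat:
  fixes A :: "complex mat"
  assumes A: "A \<in> carrier_mat d d"
  shows "(c \<cdot>\<^sub>m A) ^\<^sub>m k = c ^ k \<cdot>\<^sub>m (A ^\<^sub>m k)"
proof (induction k)
  case 0
  show ?case using A by (intro eq_matI) auto
next
  case (Suc k)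
  have "A ^\<^sub>m k \<in> carrier_mat d d" using A by auto
  then show ?case
    using A Suc by (intro eq_matI) (auto simp: index_mult_sum[of _ d d _ d] sum_distrib_left mult_ac)
qed

lemma herm_pow:
  assumes "herm d A"
  shows "herm d (A ^\<^sub>m k)"
proof (induction k)
  case 0
  show ?case using herm_carrier[OF assms] by (simp add: herm_one)
next
  case (Suc k)
  have A: "A \<in> carrier_mat d d" by (rule herm_carrier[OF assms])
  have "A ^\<^sub>m k * A = A * A ^\<^sub>m k"
    using pow_mat_Suc_left[OF A, of k] by simp
  then have "(A ^\<^sub>m Suc k) $$ (i, j) = cnj ((A ^\<^sub>m Suc k) $$ (j, i))" if "i < d" "j < d" for i j
    using herm_mult_index[OF Suc assms that] by simp
  moreover have "A ^\<^sub>m Suc k \<in> carrier_mat d d" using A by auto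
  ultimately show ?case unfolding herm_def by blast
qed

lemma norm_pow_mat_le:
  fixes A :: "complex mat"
  assumes A: "A \<in> carrier_mat d d" and b: "\<And>i j. i < d \<Longrightarrow> j < d \<Longrightarrow> norm (A $$ (i, j)) \<le> b"
    and ij: "i < d" "j < d"
  shows "norm ((A ^\<^sub>m k) $$ (i, j)) \<le> (real d * b) ^ k"
  using ij
proof (induction k arbitrary: i j)
  case 0
  then show ?case using A by auto
next
  case (Suc k)
  have b0: "0 \<le> b" using b[OF Suc.prems] norm_ge_zero order_trans by blast
  have Ak: "A ^\<^sub>m k \<in> carrier_mat d d" using A by auto
  have "norm ((A ^\<^sub>m Suc k) $$ (i, j)) \<le> (\<Sum>l<d. norm ((A ^\<^sub>m k) $$ (i, l)) * norm (A $$ (l, j)))"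
    using index_mult_sum[OF Ak A Suc.prems] by (auto simp: norm_mult intro!: sum_norm_le)
  also have "\<dots> \<le> (\<Sum>l<d. (real d * b) ^ k * b)"
    by (intro sum_mono mult_mono Suc.IH b) (use Suc.prems b0 in auto)
  also have "\<dots> = (real d * b) ^ Suc k"
    by simp
  finally show ?case .
qed

lemma summable_norm_mexp:
  fixes A :: "complex mat"
  assumes A: "A \<in> carrier_mat d d" and ij: "i < d" "j < d"
  shows "summable (\<lambda>k. norm ((A ^\<^sub>m k) $$ (i, j) / fact k))"
proof -
  define b where "b = (\<Sum>i<d. \<Sum>j<d. norm (A $$ (i, j)))"
  have b: "norm (A $$ (i, j)) \<le> b" if "i < d" "j < d" for i j
  proof -
    have "norm (A $$ (i, j)) \<le> (\<Sum>j<d. norm (A $$ (i, j)))"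
      by (rule member_le_sum[of j "{..<d}" "\<lambda>j. norm (A $$ (i, j))"]) (use that in auto)
    also have "\<dots> \<le> b"
      unfolding b_def
      by (rule member_le_sum[of i "{..<d}" "\<lambda>i. \<Sum>j<d. norm (A $$ (i, j))"]) (use that in \<open>auto intro: sum_nonneg\<close>)
    finally show ?thesis .
  qed
  show ?thesis
  proof (rule summable_comparison_test[OF _ summable_pow_fact[of "real d * b"]], intro exI allI impI)
    fix k
    show "norm (norm ((A ^\<^sub>m k) $$ (i, j) / fact k)) \<le> (real d * b) ^ k / fact k"
      using norm_pow_mat_le[OF A b ij, of k] by (simp add: norm_divide divide_right_mono)
  qed
qed

lemma mexp_carrier: "A \<in> carrier_mat d d \<Longrightarrow> mexp A \<in> carrier_mat d d"
  by (auto simp: mexp_def)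

lemma mexp_index:
  "A \<in> carrier_mat d d \<Longrightarrow> i < d \<Longrightarrow> j < d \<Longrightarrow> mexp A $$ (i, j) = (\<Sum>k. (A ^\<^sub>m k) $$ (i, j) / fact k)"
  by (simp add: mexp_def)

lemma herm_mexp:
  assumes "herm d A"
  shows "herm d (mexp A)"
  unfolding herm_def
proof (intro conjI allI impI)
  have A: "A \<in> carrier_mat d d" by (rule herm_carrier[OF assms])
  then show "mexp A \<in> carrier_mat d d" by (rule mexp_carrier)
  fix i j assume ij: "i < d" "j < d"
  have "(A ^\<^sub>m k) $$ (i, j) / fact k = cnj ((A ^\<^sub>m k) $$ (j, i) / fact k)" for k
    by (subst hermD[OF herm_pow[OF assms] ij]) simp
  then have "mexp A $$ (i, j) = (\<Sum>k. cnj ((A ^\<^sub>m k) $$ (j, i) / fact k))"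
    using mexp_index[OF A ij] by simp
  also have "\<dots> = cnj (\<Sum>k. (A ^\<^sub>m k) $$ (j, i) / fact k)"
    by (rule bounded_linear.suminf[OF bounded_linear_cnj, symmetric])
      (rule summable_norm_cancel[OF summable_norm_mexp[OF A ij(2,1)]])
  finally show "mexp A $$ (i, j) = cnj (mexp A $$ (j, i))"
    using mexp_index[OF A ij(2,1)] by simp
qed

text \<open>This exhibits the exponential of a Hermitian matrix as the square of a Hermitian one.
  The Cauchy product of the two series produces the row sum 2^n of binomial coefficients, which
  cancels the powers of 1/2.\<close>

lemma mexp_half_square:
  assumes A: "A \<in> carrier_mat d d"
  shows "mexp ((1/2) \<cdot>\<^sub>m A) * mexp ((1/2) \<cdot>\<^sub>m A) = mexp A"
proof (rule eq_matI)
  let ?H = "(1/2 :: complex) \<cdot>\<^sub>m A"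
  have H: "?H \<in> carrier_mat d d" using A by auto
  fix i j assume "i < dim_row (mexp A)" "j < dim_col (mexp A)"
  then have ij: "i < d" "j < d" using A by (auto simp: mexp_def)
  define a where "a i j k = (?H ^\<^sub>m k) $$ (i, j) / fact k" for i j k
  have sa: "summable (\<lambda>k. norm (a i j k))" if "i < d" "j < d" for i j
    unfolding a_def by (rule summable_norm_mexp[OF H that])
  have conv: "(\<Sum>l<d. \<Sum>k\<le>n. a i l k * a l j (n - k)) = (A ^\<^sub>m n) $$ (i, j) / fact n" for n
  proof -
    have "(\<Sum>l<d. a i l k * a l j (n - k)) = of_nat (n choose k) * ((?H ^\<^sub>m n) $$ (i, j) / fact n)" if "k \<le> n" for k
    proof -
      have "(\<Sum>l<d. a i l k * a l j (n - k)) = (?H ^\<^sub>m k * ?H ^\<^sub>m (n - k)) $$ (i, j) / (fact k * fact (n - k))"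
        using H by (subst index_mult_sum[OF _ _ ij, of _ d]) (auto simp: a_def sum_divide_distrib)
      also have "?H ^\<^sub>m k * ?H ^\<^sub>m (n - k) = ?H ^\<^sub>m n"
        using pow_mat_add[OF H, of k "n - k"] that by simp
      finally show ?thesis using that by (simp add: binomial_fact)
    qed
    then have "(\<Sum>k\<le>n. \<Sum>l<d. a i l k * a l j (n - k)) = (\<Sum>k\<le>n. of_nat (n choose k)) * ((?H ^\<^sub>m n) $$ (i, j) / fact n)"
      unfolding sum_distrib_right by (intro sum.cong) auto
    also have "(\<Sum>k\<le>n. of_nat (n choose k)) = (2 ^ n :: complex)"
      using choose_row_sum[of n] by (metis of_nat_numeral of_nat_power of_nat_sum)
    also have "?H ^\<^sub>m n = (1/2) ^ n \<cdot>\<^sub>m (A ^\<^sub>m n)"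
      by (rule smult_pow_mat[OF A])
    finally show ?thesis
      using A ij by (subst sum.swap) (simp add: power_divide)
  qed
  have "(mexp ?H * mexp ?H) $$ (i, j) = (\<Sum>l<d. (\<Sum>k. a i l k) * (\<Sum>k. a l j k))"
    using index_mult_sum[OF mexp_carrier[OF H] mexp_carrier[OF H] ij] ij
    by (simp add: mexp_index[OF H] a_def)
  also have "\<dots> = (\<Sum>l<d. \<Sum>n. \<Sum>k\<le>n. a i l k * a l j (n - k))"
    by (intro sum.cong refl Cauchy_product sa) (use ij in auto)
  also have "\<dots> = (\<Sum>n. \<Sum>l<d. \<Sum>k\<le>n. a i l k * a l j (n - k))"
    by (rule suminf_sum[symmetric], rule summable_Cauchy_product) (use ij in \<open>auto intro: sa\<close>)
  also have "\<dots> = mexp A $$ (i, j)"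
    unfolding conv using mexp_index[OF A ij] by simp
  finally show "(mexp ?H * mexp ?H) $$ (i, j) = mexp A $$ (i, j)" .
qed (use A in \<open>auto simp: mexp_def\<close>)

lemma mtrace_mult_mexp:
  assumes P: "P \<in> carrier_mat d d" and A: "A \<in> carrier_mat d d"
  shows "mtrace (P * mexp A) = (\<Sum>k. mtrace (P * A ^\<^sub>m k) / fact k)"
proof -
  have s: "summable (\<lambda>k. P $$ (i, j) * ((A ^\<^sub>m k) $$ (j, i) / fact k))" if "i < d" "j < d" for i j
    by (intro summable_mult summable_norm_cancel[OF summable_norm_mexp[OF A]] that)
  have "mtrace (P * mexp A) = (\<Sum>i<d. \<Sum>j<d. P $$ (i, j) * (\<Sum>k. (A ^\<^sub>m k) $$ (j, i) / fact k))"
    by (simp add: mtrace_mult[OF P mexp_carrier[OF A]] mexp_index[OF A])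
  also have "\<dots> = (\<Sum>i<d. \<Sum>j<d. \<Sum>k. P $$ (i, j) * ((A ^\<^sub>m k) $$ (j, i) / fact k))"
    by (intro sum.cong refl suminf_mult[symmetric] summable_norm_cancel[OF summable_norm_mexp[OF A]]) auto
  also have "\<dots> = (\<Sum>i<d. \<Sum>k. \<Sum>j<d. P $$ (i, j) * ((A ^\<^sub>m k) $$ (j, i) / fact k))"
    by (intro sum.cong refl suminf_sum[symmetric] s) auto
  also have "\<dots> = (\<Sum>k. \<Sum>i<d. \<Sum>j<d. P $$ (i, j) * ((A ^\<^sub>m k) $$ (j, i) / fact k))"
    by (intro suminf_sum[symmetric] summable_sum s) auto
  also have "\<dots> = (\<Sum>k. mtrace (P * A ^\<^sub>m k) / fact k)"
  proof (intro suminf_cong)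
    fix k
    have "A ^\<^sub>m k \<in> carrier_mat d d" using A by auto
    from mtrace_mult[OF P this]
    show "(\<Sum>i<d. \<Sum>j<d. P $$ (i, j) * ((A ^\<^sub>m k) $$ (j, i) / fact k)) = mtrace (P * A ^\<^sub>m k) / fact k"
      by (simp add: sum_divide_distrib)
  qed
  finally show ?thesis .
qed

subsection \<open>The Gibbs state as a cluster sum\<close>

lemma pow_mat_words:
  assumes E: "\<And>a. a \<in> V \<Longrightarrow> E a \<in> carrier_mat d d" and A: "A \<in> carrier_mat d d"
    and A_eq: "\<And>i j. i < d \<Longrightarrow> j < d \<Longrightarrow> A $$ (i, j) = (\<Sum>a\<in>V. x a * E a $$ (i, j))"
    and ij: "i < d" "j < d"
  shows "(A ^\<^sub>m k) $$ (i, j) = (\<Sum>w\<in>words V k. prod_list (map x w) * word_mat E d w $$ (i, j))"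
  using ij
proof (induction k arbitrary: i j)
  case 0
  then show ?case using A by simp
next
  case (Suc k)
  have Ak: "A ^\<^sub>m k \<in> carrier_mat d d" using A by auto
  have "(A ^\<^sub>m Suc k) $$ (i, j) = (\<Sum>l<d. A $$ (i, l) * (A ^\<^sub>m k) $$ (l, j))"
    unfolding pow_mat_Suc_left[OF A] by (rule index_mult_sum[OF A Ak Suc.prems])
  also have "\<dots> = (\<Sum>l<d. \<Sum>a\<in>V. \<Sum>w\<in>words V k. x a * E a $$ (i, l) * (prod_list (map x w) * word_mat E d w $$ (l, j)))"
    by (intro sum.cong refl) (simp add: A_eq Suc sum_product)
  also have "\<dots> = (\<Sum>a\<in>V. \<Sum>l<d. \<Sum>w\<in>words V k. x a * E a $$ (i, l) * (prod_list (map x w) * word_mat E d w $$ (l, j)))"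
    by (rule sum.swap)
  also have "\<dots> = (\<Sum>a\<in>V. \<Sum>w\<in>words V k. \<Sum>l<d. x a * E a $$ (i, l) * (prod_list (map x w) * word_mat E d w $$ (l, j)))"
    by (intro sum.cong refl sum.swap)
  also have "\<dots> = (\<Sum>a\<in>V. \<Sum>w\<in>words V k. prod_list (map x (a # w)) * word_mat E d (a # w) $$ (i, j))"
  proof (intro sum.cong refl)
    fix a w assume aw: "a \<in> V" "w \<in> words V k"
    then have "word_mat E d w \<in> carrier_mat d d"
      by (intro word_mat_carrier E) (auto simp: words_def)
    then have "word_mat E d (a # w) $$ (i, j) = (\<Sum>l<d. E a $$ (i, l) * word_mat E d w $$ (l, j))"
      using index_mult_sum[OF E[OF aw(1)] _ Suc.prems] by simp
    then show "(\<Sum>l<d. x a * E a $$ (i, l) * (prod_list (map x w) * word_mat E d w $$ (l, j))) =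
        prod_list (map x (a # w)) * word_mat E d (a # w) $$ (i, j)"
      by (simp add: sum_distrib_left mult_ac)
  qed
  also have "\<dots> = (\<Sum>w\<in>words V (Suc k). prod_list (map x w) * word_mat E d w $$ (i, j))"
    by (rule sum_words_Suc[symmetric])
  finally show ?case .
qed

lemma mtrace_word_mat_mexp:
  assumes E: "\<And>a. a \<in> V \<Longrightarrow> E a \<in> carrier_mat d d" and A: "A \<in> carrier_mat d d"
    and A_eq: "\<And>i j. i < d \<Longrightarrow> j < d \<Longrightarrow> A $$ (i, j) = (\<Sum>a\<in>V. x a * E a $$ (i, j))"
    and u: "set u \<subseteq> V"
  shows "mtrace (word_mat E d u * mexp A) =
    (\<Sum>k. (\<Sum>w\<in>words V k. prod_list (map x w) * mtrace (word_mat E d (u @ w))) / fact k)"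
proof -
  let ?P = "word_mat E d u"
  have P: "?P \<in> carrier_mat d d" using u E by (intro word_mat_carrier) auto
  have "mtrace (?P * A ^\<^sub>m k) = (\<Sum>w\<in>words V k. prod_list (map x w) * mtrace (word_mat E d (u @ w)))" for k
  proof -
    have Ak: "A ^\<^sub>m k \<in> carrier_mat d d" using A by auto
    let ?t = "\<lambda>w i j. prod_list (map x w) * (?P $$ (i, j) * word_mat E d w $$ (j, i))"
    have "mtrace (?P * A ^\<^sub>m k) = (\<Sum>i<d. \<Sum>j<d. \<Sum>w\<in>words V k. ?t w i j)"
      unfolding mtrace_mult[OF P Ak]
      by (intro sum.cong refl) (simp add: pow_mat_words[OF E A A_eq] sum_distrib_left mult_ac)
    also have "\<dots> = (\<Sum>i<d. \<Sum>w\<in>words V k. \<Sum>j<d. ?t w i j)"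
      by (intro sum.cong refl sum.swap)
    also have "\<dots> = (\<Sum>w\<in>words V k. \<Sum>i<d. \<Sum>j<d. ?t w i j)"
      by (rule sum.swap)
    also have "\<dots> = (\<Sum>w\<in>words V k. prod_list (map x w) * mtrace (word_mat E d (u @ w)))"
    proof (intro sum.cong refl)
      fix w assume w: "w \<in> words V k"
      then have W: "word_mat E d w \<in> carrier_mat d d"
        by (intro word_mat_carrier E) (auto simp: words_def)
      have "word_mat E d (u @ w) = ?P * word_mat E d w"
        using u w by (intro word_mat_append E) (auto simp: words_def)
      then show "(\<Sum>i<d. \<Sum>j<d. ?t w i j) = prod_list (map x w) * mtrace (word_mat E d (u @ w))"
        by (simp add: mtrace_mult[OF P W] sum_distrib_left)
    qed
    finally show ?thesis .
  qed
  then show ?thesis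
    using mtrace_mult_mexp[OF P A] by simp
qed

text \<open>The bridge from matrices to the abstract expansion: \<open>u = []\<close> gives the
  partition function and \<open>u = [a]\<close> the unnormalized expectation of the term
  \<open>a\<close>. The common factor 2^N cancels in their quotient.\<close>

lemma mtrace_pauli_word_mexp:
  assumes len: "\<And>a. a < M \<Longrightarrow> length (E a) = N" and u: "set u \<subseteq> {..<M}"
  shows "mtrace (word_mat (\<lambda>a. pauli_string (E a)) (2 ^ N) u * mexp (complex_of_real (-\<beta>) \<cdot>\<^sub>m hamiltonian N M E lam)) =
    2 ^ N * cluster_sum (\<lambda>w. word_tr N E (u @ w)) (\<lambda>a. of_real (-\<beta> * lam a)) {} {..<M}"
proof -
  let ?x = "\<lambda>a. complex_of_real (-\<beta> * lam a)" and ?A = "complex_of_real (-\<beta>) \<cdot>\<^sub>m hamiltonian N M E lam"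
  have "mtrace (word_mat (\<lambda>a. pauli_string (E a)) (2 ^ N) u * mexp ?A) =
     (\<Sum>k. (\<Sum>w\<in>words {..<M} k. prod_list (map ?x w) * mtrace (word_mat (\<lambda>a. pauli_string (E a)) (2 ^ N) (u @ w))) / fact k)"
  proof (rule mtrace_word_mat_mexp[OF _ _ _ u])
    show "pauli_string (E a) \<in> carrier_mat (2 ^ N) (2 ^ N)" if "a \<in> {..<M}" for a
      using pauli_string_carrier[of "E a"] len that by simp
    show "?A \<in> carrier_mat (2 ^ N) (2 ^ N)"
      by (simp add: hamiltonian_def)
    show "?A $$ (i, j) = (\<Sum>a<M. ?x a * pauli_string (E a) $$ (i, j))" if "i < 2 ^ N" "j < 2 ^ N" for i j
      using that by (simp add: hamiltonian_def sum_distrib_left sum_negf mult_ac)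
  qed
  also have "\<dots> = (\<Sum>k. 2 ^ N * cluster_term (\<lambda>w. word_tr N E (u @ w)) ?x {} {..<M} k)"
  proof (rule suminf_cong)
    fix k
    have "prod_list (map ?x w) * mtrace (word_mat (\<lambda>a. pauli_string (E a)) (2 ^ N) (u @ w)) =
        2 ^ N * (prod_list (map ?x w) * word_tr N E (u @ w))" if "w \<in> words {..<M} k" for w
      using mtrace_word_mat_pauli_string[of "u @ w" E N] that u len by (auto simp: words_def)
    then have "(\<Sum>w\<in>words {..<M} k. prod_list (map ?x w) * mtrace (word_mat (\<lambda>a. pauli_string (E a)) (2 ^ N) (u @ w))) =
        2 ^ N * (\<Sum>w\<in>words {..<M} k. prod_list (map ?x w) * word_tr N E (u @ w))"
      by (subst sum_distrib_left) (rule sum.cong[OF refl])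
    then show "(\<Sum>w\<in>words {..<M} k. prod_list (map ?x w) * mtrace (word_mat (\<lambda>a. pauli_string (E a)) (2 ^ N) (u @ w))) / fact k =
        2 ^ N * cluster_term (\<lambda>w. word_tr N E (u @ w)) ?x {} {..<M} k"
      by (simp only:) (simp add: cluster_term_def)
  qed
  also have "\<dots> = 2 ^ N * cluster_sum (\<lambda>w. word_tr N E (u @ w)) ?x {} {..<M}"
    unfolding cluster_sum_def
    by (rule suminf_mult, rule summable_norm_cancel, rule summable_norm_cluster_term, rule norm_word_tr_le)
  finally show ?thesis .
qed

text \<open>\<open>dual_degree\<close> leaves out the vertex itself, whereas a term with nonempty
  support meets itself; hence the successor.\<close>

lemma card_touch_le:
  assumes "a < M" "pauli_support (E a) \<noteq> {}"
  shows "card {b\<in>{..<M}. pauli_support (E a) \<inter> pauli_support (E b) \<noteq> {}} \<le> Suc (dual_degree M E)"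
proof -
  let ?N = "\<lambda>a. {b. b < M \<and> b \<noteq> a \<and> pauli_support (E a) \<inter> pauli_support (E b) \<noteq> {}}"
  have "{b\<in>{..<M}. pauli_support (E a) \<inter> pauli_support (E b) \<noteq> {}} = insert a (?N a)"
    using assms by auto
  moreover have "card (?N a) \<le> dual_degree M E"
    unfolding dual_degree_def using assms by (intro Max_ge) auto
  ultimately show ?thesis by (simp add: card_insert_if)
qed

lemma orthogonal_word_trace_pauli:
  assumes len: "\<And>a. a < M \<Longrightarrow> length (E a) = N"
    and supp: "\<And>a. a < M \<Longrightarrow> pauli_support (E a) \<noteq> {}"
    and traceless: "\<And>a. a < M \<Longrightarrow> mtrace (pauli_string (E a)) = 0"
    and orth: "\<And>a b. a < M \<Longrightarrow> b < M \<Longrightarrow> mtrace (pauli_string (E a) * pauli_string (E b)) = (if a = b then 2 ^ N else 0)"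
  shows "orthogonal_word_trace (word_tr N E) (\<lambda>a b. pauli_support (E a) \<inter> pauli_support (E b) \<noteq> {}) {..<M} (dual_degree M E)"
proof
  show "word_tr N E [] = 1"
    using mtrace_word_mat_pauli_string[of "[]" E N] by (simp add: mtrace_def)
  show "norm (word_tr N E w) \<le> 1" for w
    by (rule norm_word_tr_le)
  show "word_tr N E w = word_tr N E (filter (\<lambda>z. z \<in> A) w) * word_tr N E (filter (\<lambda>z. z \<in> B) w)"
    if "A \<subseteq> {..<M}" "B \<subseteq> {..<M}" "\<And>a b. a \<in> A \<Longrightarrow> b \<in> B \<Longrightarrow> \<not> pauli_support (E a) \<inter> pauli_support (E b) \<noteq> {}"
      "set w \<subseteq> A \<union> B" for A B w
    using that by (intro word_tr_factor len) auto
  show "card {b\<in>{..<M}. pauli_support (E a) \<inter> pauli_support (E b) \<noteq> {}} \<le> Suc (dual_degree M E)"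
    if "a \<in> {..<M}" for a
    using that supp by (intro card_touch_le) auto
  have car: "pauli_string (E a) \<in> carrier_mat (2 ^ N) (2 ^ N)" if "a < M" for a
    using pauli_string_carrier[of "E a"] len that by simp
  show "word_tr N E [a] = 0" if "a \<in> {..<M}" for a
    using mtrace_word_mat_pauli_string[of "[a]" E N] that len traceless[of a] car[of a] by simp
  show "word_tr N E [a, b] = (if a = b then 1 else 0)" if "a \<in> {..<M}" "b \<in> {..<M}" for a b
  proof -
    have "\<And>c. c \<in> set [a, b] \<Longrightarrow> length (E c) = N" using that len by auto
    from mtrace_word_mat_pauli_string[of "[a, b]" E N, OF this] show ?thesis
      using that orth[of a b] car[of a] car[of b] by (auto split: if_splits)
  qed
qed (use supp in auto)

subsection \<open>Concentration and colouring\<close>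

lemma exp_le_quadratic:
  fixes u :: real
  assumes "\<bar>u\<bar> \<le> 1"
  shows "exp u \<le> 1 + u + u\<^sup>2"
proof (cases "0 \<le> u")
  case True
  then show ?thesis using assms by (intro exp_bound) auto
next
  case False
  define v where "v = - u"
  have v: "0 \<le> v" using False by (simp add: v_def)
  \<comment> \<open>For u = - v the claim says that (1 - v + v^2) exp v is at least 1; the quadratic
    Taylor polynomial in place of exp v already achieves this.\<close>
  have "1 \<le> (1 - v + v\<^sup>2) * (1 + v + v\<^sup>2 / 2)"
  proof -
    have "(1 - v + v\<^sup>2) * (1 + v + v\<^sup>2 / 2) = 1 + v\<^sup>2 / 2 + v ^ 3 / 2 + v ^ 4 / 2"
      by (simp add: field_simps power2_eq_square power3_eq_cube power4_eq_xxxx)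
    then show ?thesis using v by simp
  qed
  also have "\<dots> \<le> (1 - v + v\<^sup>2) * exp v"
  proof (rule mult_left_mono)
    show "1 + v + v\<^sup>2 / 2 \<le> exp v" by (rule exp_lower_Taylor_quadratic[OF v])
    have "v \<le> 1" using assms by (simp add: v_def)
    then show "0 \<le> 1 - v + v\<^sup>2" by (simp add: add_nonneg_nonneg)
  qed
  finally have "1 / exp v \<le> 1 - v + v\<^sup>2" by (simp add: field_simps)
  then show ?thesis by (simp add: v_def exp_minus field_simps)
qed

text \<open>Words now serve as sequences of outcomes, one letter for each copy, and this identity is
  independence of the copies. It yields both the total probability and the moment generating
  function.\<close>

lemma sum_words_prod_zip:
  fixes g :: "'c \<Rightarrow> 'b \<Rightarrow> 'a::comm_semiring_1"
  shows "(\<Sum>bs\<in>words B (length cs). \<Prod>(c,b)\<leftarrow>zip cs bs. g c b) = (\<Prod>c\<leftarrow>cs. \<Sum>b\<in>B. g c b)"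
  by (induction cs) (simp_all add: sum_words_Suc sum_distrib_right flip: sum_distrib_left)

text \<open>The list \<open>cs\<close> holds the measurement setting of each copy, and
  \<open>pr c\<close> is the outcome distribution in setting \<open>c\<close>. Only the
  \<open>m\<close> copies in setting \<open>c0\<close> enter the deviation; the exponential Markov
  inequality is applied with a cost of at most exp (t^2) for each of them.\<close>

lemma Chernoff_words:
  fixes pr :: "'c \<Rightarrow> 'b \<Rightarrow> real" and cs :: "'c list"
  assumes fin: "finite B" and pr: "\<And>c b. c \<in> set cs \<Longrightarrow> b \<in> B \<Longrightarrow> 0 \<le> pr c b"
    and pr1: "\<And>c. c \<in> set cs \<Longrightarrow> (\<Sum>b\<in>B. pr c b) = 1"
    and Y: "\<And>b. b \<in> B \<Longrightarrow> \<bar>Y b\<bar> \<le> 1" and c0: "c0 \<in> set cs" and f: "f = (\<Sum>b\<in>B. pr c0 b * Y b)"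
    and \<eta>: "0 \<le> \<eta>" "\<eta> \<le> 1" and m: "m = count_list cs c0"
  shows "(\<Sum>bs\<in>{bs\<in>words B (length cs). m * \<eta> < (\<Sum>(c,b)\<leftarrow>zip cs bs. if c = c0 then Y b - f else 0)}.
      \<Prod>(c,b)\<leftarrow>zip cs bs. pr c b) \<le> exp (- (m * \<eta>\<^sup>2 / 4))"
proof -
  \<comment> \<open>Minimizes the exponent m t^2 - t m \<eta>. With \<eta> \<le> 1 it also keeps |t
    (Y b - f)| \<le> 1, as \<open>exp_le_quadratic\<close> requires.\<close>
  define t where "t = \<eta> / 2"
  let ?S = "\<lambda>bs. \<Sum>(c,b)\<leftarrow>zip cs bs. if c = c0 then Y b - f else 0"
  let ?P = "\<lambda>bs. \<Prod>(c,b)\<leftarrow>zip cs bs. pr c b"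
  let ?g = "\<lambda>c b. pr c b * exp (t * (if c = c0 then Y b - f else 0))"
  have P0: "0 \<le> ?P bs" if bs: "bs \<in> words B (length cs)" for bs
  proof -
    have "0 \<le> pr c b" if z: "(c, b) \<in> set (zip cs bs)" for c b
    proof (rule pr)
      show "c \<in> set cs" using z by (rule set_zip_leftD)
      have "b \<in> set bs" using z by (rule set_zip_rightD)
      then show "b \<in> B" using bs by (auto simp: words_def)
    qed
    then show ?thesis
      by (intro prod_list_nonneg) auto
  qed
  have gP: "?P bs * exp (t * ?S bs) = (\<Prod>(c,b)\<leftarrow>zip cs bs. ?g c b)" for bs
  proof -
    have "prod_list (map (\<lambda>(c,b). pr c b) zs) * exp (t * sum_list (map (\<lambda>(c,b). if c = c0 then Y b - f else 0) zs)) =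
        prod_list (map (\<lambda>(c,b). ?g c b) zs)" for zs :: "('c \<times> 'b) list"
      by (induction zs) (auto simp: distrib_left exp_add)
    then show ?thesis .
  qed
  have f1: "\<bar>f\<bar> \<le> 1"
  proof -
    have "\<bar>f\<bar> \<le> (\<Sum>b\<in>B. \<bar>pr c0 b * Y b\<bar>)" unfolding f by (rule sum_abs)
    also have "\<dots> \<le> (\<Sum>b\<in>B. pr c0 b)"
      using pr[OF c0] Y by (intro sum_mono) (auto simp: abs_mult mult_left_le)
    finally show ?thesis using pr1[OF c0] by simp
  qed
  have mgf: "(\<Sum>b\<in>B. ?g c0 b) \<le> exp (t\<^sup>2)"
  proof -
    have "(\<Sum>b\<in>B. ?g c0 b) \<le> (\<Sum>b\<in>B. pr c0 b * (1 + t * (Y b - f) + (t * (Y b - f))\<^sup>2))"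
    proof (intro sum_mono)
      fix b assume b: "b \<in> B"
      have "\<bar>t * (Y b - f)\<bar> \<le> (1/2) * 2"
        unfolding abs_mult using \<eta> Y[OF b] f1 by (intro mult_mono) (auto simp: t_def)
      then have "exp (t * (Y b - f)) \<le> 1 + t * (Y b - f) + (t * (Y b - f))\<^sup>2"
        by (intro exp_le_quadratic) auto
      then show "?g c0 b \<le> pr c0 b * (1 + t * (Y b - f) + (t * (Y b - f))\<^sup>2)"
        using pr[OF c0 b] by (auto intro: mult_left_mono)
    qed
    also have "\<dots> = (\<Sum>b\<in>B. pr c0 b) + t * ((\<Sum>b\<in>B. pr c0 b * Y b) - f * (\<Sum>b\<in>B. pr c0 b)) +
        t\<^sup>2 * ((\<Sum>b\<in>B. pr c0 b * (Y b)\<^sup>2) - 2 * f * (\<Sum>b\<in>B. pr c0 b * Y b) + f\<^sup>2 * (\<Sum>b\<in>B. pr c0 b))"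
      unfolding sum_distrib_left sum.distrib[symmetric] sum_subtractf[symmetric]
      by (intro sum.cong refl) (simp add: algebra_simps power2_eq_square)
    also have "\<dots> = 1 + t\<^sup>2 * ((\<Sum>b\<in>B. pr c0 b * (Y b)\<^sup>2) - f\<^sup>2)"
      unfolding pr1[OF c0] f[symmetric] by (simp add: power2_eq_square)
    also have "\<dots> \<le> 1 + t\<^sup>2 * 1"
    proof (intro add_left_mono mult_left_mono)
      have "(\<Sum>b\<in>B. pr c0 b * (Y b)\<^sup>2) \<le> (\<Sum>b\<in>B. pr c0 b)"
        using pr[OF c0] Y by (intro sum_mono mult_left_le) (auto simp: abs_square_le_1)
      then show "(\<Sum>b\<in>B. pr c0 b * (Y b)\<^sup>2) - f\<^sup>2 \<le> 1"
        using pr1[OF c0] zero_le_power2[of f] by linarith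
    qed simp
    also have "\<dots> \<le> exp (t\<^sup>2)" using exp_ge_add_one_self[of "t\<^sup>2"] by simp
    finally show ?thesis .
  qed
  have "(\<Sum>bs\<in>{bs\<in>words B (length cs). m * \<eta> < ?S bs}. ?P bs) \<le>
      (\<Sum>bs\<in>words B (length cs). ?P bs * exp (t * ?S bs) * exp (- (t * (m * \<eta>))))"
  proof (rule order_trans[OF sum_mono sum_mono2])
    fix bs assume bs: "bs \<in> {bs\<in>words B (length cs). m * \<eta> < ?S bs}"
    have "1 \<le> exp (t * (?S bs - m * \<eta>))"
      using bs \<eta> by (auto simp: t_def)
    also have "\<dots> = exp (t * ?S bs) * exp (- (t * (m * \<eta>)))"
      by (simp add: right_diff_distrib exp_diff exp_minus field_simps)
    finally show "?P bs \<le> ?P bs * exp (t * ?S bs) * exp (- (t * (m * \<eta>)))"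
      using mult_left_mono[OF _ P0, of 1] bs by (simp add: mult.assoc)
  qed (use P0 fin in \<open>auto simp: finite_words\<close>)
  also have "\<dots> = (\<Prod>c\<leftarrow>cs. \<Sum>b\<in>B. ?g c b) * exp (- (t * (m * \<eta>)))"
    unfolding gP sum_distrib_right[symmetric] sum_words_prod_zip ..
  also have "\<dots> \<le> exp (t\<^sup>2) ^ m * exp (- (t * (m * \<eta>)))"
  proof (rule mult_right_mono)
    \<comment> \<open>A copy in another setting contributes its total mass 1, so only the
      occurrences of \<open>c0\<close> cost a factor.\<close>
    have "set cs' \<subseteq> set cs \<Longrightarrow> (\<Prod>c\<leftarrow>cs'. \<Sum>b\<in>B. ?g c b) \<le> exp (t\<^sup>2) ^ count_list cs' c0 \<and> 0 \<le> (\<Prod>c\<leftarrow>cs'. \<Sum>b\<in>B. ?g c b)" for cs'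
    proof (induction cs')
      case (Cons c cs')
      have g0: "0 \<le> (\<Sum>b\<in>B. ?g c b)"
        using Cons.prems pr by (intro sum_nonneg) auto
      show ?case
      proof (cases "c = c0")
        case True
        then show ?thesis
          using Cons g0 mgf by (auto simp del: exp_le_cancel_iff intro!: mult_mono mult_nonneg_nonneg)
      next
        case False
        then show ?thesis using Cons pr1[of c] by simp
      qed
    qed simp
    then show "(\<Prod>c\<leftarrow>cs. \<Sum>b\<in>B. ?g c b) \<le> exp (t\<^sup>2) ^ m"
      unfolding m by blast
  qed simp
  also have "\<dots> = exp (- (m * \<eta>\<^sup>2 / 4))"
    by (simp add: t_def power2_eq_square field_simps flip: exp_of_nat_mult exp_add)
  finally show ?thesis .
qed

text \<open>Vertices are coloured in numerical order. The earlier neighbours of a vertex occupy at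
  most \<open>d\<close> of the d + 1 colours in \<open>{..d}\<close>.\<close>

lemma greedy_colouring:
  fixes adj :: "nat \<Rightarrow> nat \<Rightarrow> bool"
  assumes deg: "\<And>a. a < M \<Longrightarrow> card {b. b < M \<and> b \<noteq> a \<and> adj a b} \<le> d"
    and sym: "\<And>a b. adj a b \<Longrightarrow> adj b a"
  shows "\<exists>col. (\<forall>a<M. col a \<le> d) \<and> (\<forall>a<M. \<forall>b<M. a \<noteq> b \<longrightarrow> adj a b \<longrightarrow> col a \<noteq> (col b :: nat))"
proof -
  have "k \<le> M \<Longrightarrow> \<exists>col. (\<forall>a<k. col a \<le> d) \<and> (\<forall>a<k. \<forall>b<k. a \<noteq> b \<longrightarrow> adj a b \<longrightarrow> col a \<noteq> (col b :: nat))" for k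
  proof (induction k)
    case (Suc k)
    then obtain col where col: "\<forall>a<k. col a \<le> d" "\<forall>a<k. \<forall>b<k. a \<noteq> b \<longrightarrow> adj a b \<longrightarrow> col a \<noteq> (col b :: nat)"
      by auto
    let ?U = "col ` {b. b < k \<and> adj k b}"
    have "card ?U \<le> card {b. b < k \<and> adj k b}" by (rule card_image_le) simp
    also have "\<dots> \<le> card {b. b < M \<and> b \<noteq> k \<and> adj k b}"
      using Suc.prems by (intro card_mono) auto
    also have "\<dots> \<le> d" using Suc.prems by (intro deg) auto
    finally have "card ?U < card {..d}" by simp
    then have "\<not> {..d} \<subseteq> ?U"
      using card_mono[of ?U "{..d}"] by auto
    then obtain c where c: "c \<le> d" "c \<notin> ?U" by auto
    show ?case
      by (rule exI[of _ "col(k := c)"]) (use col c sym in \<open>auto simp: less_Suc_eq\<close>)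
  qed simp
  then show ?thesis by blast
qed

subsection \<open>Pauli basis measurements\<close>

definition pauli_proj :: "nat \<Rightarrow> bool \<Rightarrow> complex mat" where
  "pauli_proj k s = Matrix.mat 2 2 (\<lambda>ij. (1\<^sub>m 2 $$ ij + (if s then 1 else -1) * pauli k $$ ij) / 2)"

lemma pauli_proj_carrier [simp]: "pauli_proj k s \<in> carrier_mat 2 2"
  by (simp add: pauli_proj_def)

lemma pauli_proj_index:
  "i < 2 \<Longrightarrow> j < 2 \<Longrightarrow> pauli_proj k s $$ (i, j) =
    ((if i = j then 1 else 0) + (if s then 1 else -1) * pauli k $$ (i, j)) / 2"
  by (simp add: pauli_proj_def)

lemma herm_pauli_proj: "herm 2 (pauli_proj k s)"
proof -
  have "pauli_proj k s $$ (i, j) = cnj (pauli_proj k s $$ (j, i))" if "i < 2" "j < 2" for i j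
  proof -
    have "i = 0 \<or> i = Suc 0" "j = 0 \<or> j = Suc 0"
      using that by auto
    then show ?thesis
      by (elim disjE; simp add: pauli_proj_index pauli_index)
  qed
  then show ?thesis unfolding herm_def using pauli_proj_carrier by blast
qed

lemma pauli_proj_square:
  assumes "k \<in> {1, 2, 3}"
  shows "pauli_proj k s * pauli_proj k s = pauli_proj k s"
proof (rule eq_matI)
  fix i j assume "i < dim_row (pauli_proj k s)" "j < dim_col (pauli_proj k s)"
  then have ij: "i < 2" "j < 2" by (simp_all add: pauli_proj_def)
  have "(pauli_proj k s * pauli_proj k s) $$ (i, j) =
      pauli_proj k s $$ (i, 0) * pauli_proj k s $$ (0, j) + pauli_proj k s $$ (i, Suc 0) * pauli_proj k s $$ (Suc 0, j)"
    using index_mult_sum[OF pauli_proj_carrier pauli_proj_carrier ij] by (simp add: sum_lessThan_2)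
  also have "\<dots> = pauli_proj k s $$ (i, j)"
  proof -
    have "i = 0 \<or> i = Suc 0" "j = 0 \<or> j = Suc 0" "k = 1 \<or> k = 2 \<or> k = 3"
      using ij assms by auto
    then show ?thesis
      by (elim disjE; cases s; simp add: pauli_proj_index pauli_index)
  qed
  finally show "(pauli_proj k s * pauli_proj k s) $$ (i, j) = pauli_proj k s $$ (i, j)" .
qed (simp_all add: pauli_proj_def)

text \<open>The eigenprojections of the Pauli matrices number \<open>p i\<close>; the bit \<open>True\<close> stands for the eigenvalue 1.\<close>
definition basis_proj :: "nat \<Rightarrow> (nat \<Rightarrow> nat) \<Rightarrow> bool list \<Rightarrow> complex mat" where
  "basis_proj N p b = kron_list (map (\<lambda>(i,s). pauli_proj (p i) s) (zip [0..<N] b))"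

text \<open>The eigenvalue of the Pauli string \<open>e\<close> on the joint eigenspace labelled by
  \<open>b\<close>; a qubit outside the support contributes 1 whatever its bit.\<close>

definition eig :: "nat list \<Rightarrow> bool list \<Rightarrow> real" where
  "eig e b = (\<Prod>(i,s)\<leftarrow>zip [0..<length e] b. if e ! i = 0 \<or> s then 1 else -1)"

lemma abs_eig: "\<bar>eig e b\<bar> = 1"
proof -
  have "\<bar>prod_list (map (\<lambda>(i,s). if e ! i = 0 \<or> s then 1 else -1 :: real) zs)\<bar> = 1" for zs
    by (induction zs) (auto simp: abs_mult)
  then show ?thesis by (simp add: eig_def)
qed

lemma herm_basis_proj: "length b = N \<Longrightarrow> herm (2 ^ N) (basis_proj N p b)"
  unfolding basis_proj_def
  using herm_kron_list[of "map (\<lambda>(i,s). pauli_proj (p i) s) (zip [0..<N] b)" 2]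
  by (auto simp: herm_pauli_proj split_beta)

lemma basis_proj_square:
  assumes "\<And>i. i < N \<Longrightarrow> p i \<in> {1, 2, 3}"
  shows "basis_proj N p b * basis_proj N p b = basis_proj N p b"
proof -
  have "pauli_proj (p i) s * pauli_proj (p i) s = pauli_proj (p i) s" if "(i, s) \<in> set (zip [0..<N] b)" for i s
    using set_zip_leftD[OF that] assms[of i] by (intro pauli_proj_square) auto
  then show ?thesis
    unfolding basis_proj_def
    by (subst kron_list_mult[where d = 2]) (auto intro!: arg_cong[of _ _ kron_list])
qed

text \<open>The spectral decomposition of \<open>e\<close> in the product basis \<open>p\<close>,
  obtained qubit by qubit from the difference or the sum of two eigenprojections. The basis is the
  same for all strings that agree with \<open>p\<close> on their support, so one measurement reveals
  the eigenvalues of all of them.\<close>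

lemma sum_eig_basis_proj:
  assumes e: "length e = N" "\<And>i. i < N \<Longrightarrow> e ! i = 0 \<or> e ! i = p i" and p: "\<And>i. i < N \<Longrightarrow> p i \<in> {1, 2, 3}"
    and ij: "i < 2 ^ N" "j < 2 ^ N"
  shows "(\<Sum>b\<in>words UNIV N. complex_of_real (eig e b) * basis_proj N p b $$ (i, j)) = pauli_string e $$ (i, j)"
proof -
  let ?s = "\<lambda>i s. if e ! i = 0 \<or> s then 1 else -1 :: complex"
  have s: "complex_of_real (eig e b) = (\<Prod>(i,s)\<leftarrow>zip [0..<N] b. ?s i s)" for b
  proof -
    have "complex_of_real (prod_list (map (\<lambda>(i,s). if e ! i = 0 \<or> s then 1 else -1) zs)) =
        prod_list (map (\<lambda>(i,s). ?s i s) zs)" for zs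
      by (induction zs) (simp_all add: split_beta)
    then show ?thesis by (simp add: eig_def e)
  qed
  have q: "Matrix.mat 2 2 (\<lambda>ij. \<Sum>s\<in>UNIV. ?s i s * pauli_proj (p i) s $$ ij) = pauli (e ! i)" if i: "i < N" for i
  proof (rule eq_matI)
    fix r c assume "r < dim_row (pauli (e ! i))" "c < dim_col (pauli (e ! i))"
    then have rc: "r < 2" "c < 2" by (simp_all add: carrier_matD[OF pauli_carrier])
    then show "Matrix.mat 2 2 (\<lambda>ij. \<Sum>s\<in>UNIV. ?s i s * pauli_proj (p i) s $$ ij) $$ (r, c) = pauli (e ! i) $$ (r, c)"
      using e(2)[OF i] p[OF i] by (auto simp: UNIV_bool pauli_proj_def pauli_0 field_simps)
  qed (simp_all add: carrier_matD[OF pauli_carrier])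
  have nth: "map (\<lambda>i. e ! i) [0..<N] = e"
    using e(1) map_nth[of e] by simp
  have "(\<Sum>b\<in>words UNIV N. complex_of_real (eig e b) * basis_proj N p b $$ (i, j)) =
      kron_list (map (\<lambda>i. Matrix.mat 2 2 (\<lambda>ij. \<Sum>s\<in>UNIV. ?s i s * pauli_proj (p i) s $$ ij)) [0..<N]) $$ (i, j)"
    unfolding s basis_proj_def
    using sum_words_kron_list[of "UNIV :: bool set" "[0..<N]" "\<lambda>i s. pauli_proj (p i) s" 2 i j ?s] ij by simp
  also have "map (\<lambda>i. Matrix.mat 2 2 (\<lambda>ij. \<Sum>s\<in>UNIV. ?s i s * pauli_proj (p i) s $$ ij)) [0..<N] =
      map (\<lambda>i. pauli (e ! i)) [0..<N]"
    by (rule map_cong[OF refl], rule q) simp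
  also have "map (\<lambda>i. pauli (e ! i)) [0..<N] = map pauli (map (\<lambda>i. e ! i) [0..<N])"
    by (simp add: comp_def)
  finally show ?thesis
    unfolding nth pauli_string_eq .
qed

text \<open>The identity is the Pauli string with empty support, whose eigenvalues are all
  1.\<close>

lemma sum_basis_proj:
  assumes p: "\<And>i. i < N \<Longrightarrow> p i \<in> {1, 2, 3}" and ij: "i < 2 ^ N" "j < 2 ^ N"
  shows "(\<Sum>b\<in>words UNIV N. basis_proj N p b $$ (i, j)) = 1\<^sub>m (2 ^ N) $$ (i, j)"
proof -
  have eig: "eig (replicate N 0) b = 1" for b
  proof -
    have "set zs \<subseteq> set (zip [0..<N] b) \<Longrightarrow>
        prod_list (map (\<lambda>(i,s). if replicate N 0 ! i = (0::nat) \<or> s then 1 else -1 :: real) zs) = 1" for zs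
      by (induction zs) (auto dest: set_zip_leftD)
    then show ?thesis by (simp add: eig_def)
  qed
  have "pauli_string (replicate N 0) = kron_list (map (\<lambda>_. 1\<^sub>m 2) [0..<N])"
    unfolding pauli_string_eq by (simp add: pauli_0 map_replicate_const)
  then have "pauli_string (replicate N 0) = 1\<^sub>m (2 ^ N)"
    using kron_list_one[of 2 "[0..<N]"] by simp
  then show ?thesis
    using sum_eig_basis_proj[OF _ _ p ij, of "replicate N 0"] by (simp add: eig)
qed

text \<open>Each copy is measured separately in its own setting, and \<open>dec\<close> is classical
  post-processing: the effect of \<open>x\<close> collects the product projections of all outcome
  sequences decoded to \<open>x\<close>. The second claim turns quantum probabilities of decoded
  values into sums of product weights over outcome sequences.\<close>

lemma product_measurement:
  fixes Q :: "'c \<Rightarrow> 'b \<Rightarrow> complex mat" and dec :: "'b list \<Rightarrow> 'x"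
  assumes fin: "finite B"
    and herm: "\<And>c b. c \<in> set cs \<Longrightarrow> b \<in> B \<Longrightarrow> herm d (Q c b)"
    and idem: "\<And>c b. c \<in> set cs \<Longrightarrow> b \<in> B \<Longrightarrow> Q c b * Q c b = Q c b"
    and total: "\<And>c i j. c \<in> set cs \<Longrightarrow> i < d \<Longrightarrow> j < d \<Longrightarrow> (\<Sum>b\<in>B. Q c b $$ (i, j)) = 1\<^sub>m d $$ (i, j)"
  defines "\<Omega> \<equiv> words B (length cs)"
  defines "F \<equiv> \<lambda>x. Matrix.mat (d ^ length cs) (d ^ length cs)
    (\<lambda>ij. \<Sum>bs\<in>{bs\<in>\<Omega>. dec bs = x}. kron_list (map (\<lambda>(c,b). Q c b) (zip cs bs)) $$ ij)"
  shows "povm (d ^ length cs) (dec ` \<Omega>) F"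
    and "\<lbrakk>\<rho> \<in> carrier_mat d d; \<And>c b. c \<in> set cs \<Longrightarrow> b \<in> B \<Longrightarrow> mtrace (Q c b * \<rho>) = of_real (pr c b)\<rbrakk> \<Longrightarrow>
      (\<Sum>x\<in>{x\<in>dec ` \<Omega>. good x}. outcome_prob (F x) (tensor_pow \<rho> (length cs))) =
      (\<Sum>bs\<in>{bs\<in>\<Omega>. good (dec bs)}. \<Prod>(c,b)\<leftarrow>zip cs bs. pr c b)"
proof -
  let ?n = "length cs" and ?K = "\<lambda>bs. kron_list (map (\<lambda>(c,b). Q c b) (zip cs bs))"
  have fin\<Omega>: "finite \<Omega>" unfolding \<Omega>_def by (rule finite_words[OF fin])
  have zip: "c \<in> set cs" "b \<in> B" if "bs \<in> \<Omega>" "(c, b) \<in> set (zip cs bs)" for bs c b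
    using that set_zip_leftD[OF that(2)] set_zip_rightD[OF that(2)] by (auto simp: \<Omega>_def words_def)
  have Qc: "Q c b \<in> carrier_mat d d" if "c \<in> set cs" "b \<in> B" for c b
    using herm_carrier[OF herm[OF that]] .
  have Qz: "(case z of (c, b) \<Rightarrow> Q c b) \<in> carrier_mat d d" if "bs \<in> \<Omega>" "z \<in> set (zip cs bs)" for bs z
    using that zip[OF that(1)] Qc by (cases z) auto
  have Kherm: "herm (d ^ ?n) (?K bs)" if "bs \<in> \<Omega>" for bs
  proof -
    have "\<forall>A\<in>set (map (\<lambda>(c,b). Q c b) (zip cs bs)). herm d A"
      using herm zip[OF that] by auto
    from herm_kron_list[OF this] show ?thesis
      using that by (simp add: \<Omega>_def words_def)
  qed
  have Kidem: "?K bs * ?K bs = ?K bs" if "bs \<in> \<Omega>" for bs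
  proof -
    have "?K bs * ?K bs = kron_list (map (\<lambda>z. (case z of (c, b) \<Rightarrow> Q c b) * (case z of (c, b) \<Rightarrow> Q c b)) (zip cs bs))"
      by (rule kron_list_mult[where d = d]) (use Qz[OF that] in auto)
    also have "map (\<lambda>z. (case z of (c, b) \<Rightarrow> Q c b) * (case z of (c, b) \<Rightarrow> Q c b)) (zip cs bs) = map (\<lambda>(c,b). Q c b) (zip cs bs)"
      by (rule map_cong[OF refl]) (use idem zip[OF that] in auto)
    finally show ?thesis .
  qed
  have Ktotal: "(\<Sum>bs\<in>\<Omega>. ?K bs $$ (i, j)) = 1\<^sub>m (d ^ ?n) $$ (i, j)" if ij: "i < d ^ ?n" "j < d ^ ?n" for i j
  proof -
    have one: "prod_list (map (\<lambda>(c,b). 1 :: complex) zs) = 1" for zs :: "('c \<times> 'b) list"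
      by (induction zs) auto
    have "(\<Sum>bs\<in>\<Omega>. ?K bs $$ (i, j)) =
        kron_list (map (\<lambda>c. Matrix.mat d d (\<lambda>ij. \<Sum>b\<in>B. 1 * Q c b $$ ij)) cs) $$ (i, j)"
      unfolding \<Omega>_def
      using sum_words_kron_list[OF fin _ ij, of Q "\<lambda>_ _. 1"] Qc by (simp add: one)
    also have "map (\<lambda>c. Matrix.mat d d (\<lambda>ij. \<Sum>b\<in>B. 1 * Q c b $$ ij)) cs = map (\<lambda>c. 1\<^sub>m d) cs"
      by (rule map_cong[OF refl], rule eq_matI) (use total in auto)
    finally show ?thesis by (simp only: kron_list_one)
  qed
  show "povm (d ^ ?n) (dec ` \<Omega>) F"
    unfolding povm_def
  proof (intro conjI ballI allI impI)
    show "finite (dec ` \<Omega>)" using fin\<Omega> by simp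
    show "psd (d ^ ?n) (F x)" for x
      unfolding F_def
    proof (rule psd_sum)
      fix bs assume "bs \<in> {bs\<in>\<Omega>. dec bs = x}"
      then show "psd (d ^ ?n) (?K bs)"
        using psd_square[OF Kherm, of bs] Kidem[of bs] by simp
    qed (use fin\<Omega> in auto)
    fix i j assume ij: "i < d ^ ?n" "j < d ^ ?n"
    have "(\<Sum>x\<in>dec ` \<Omega>. F x $$ (i, j)) = (\<Sum>x\<in>dec ` \<Omega>. \<Sum>bs\<in>{bs\<in>\<Omega>. dec bs = x}. ?K bs $$ (i, j))"
      using ij by (simp add: F_def)
    also have "\<dots> = (\<Sum>bs\<in>\<Omega>. ?K bs $$ (i, j))"
      by (rule sum.image_gen[OF fin\<Omega>, symmetric])
    finally show "(\<Sum>x\<in>dec ` \<Omega>. F x $$ (i, j)) = 1\<^sub>m (d ^ ?n) $$ (i, j)"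
      using Ktotal[OF ij] by simp
  qed
  assume \<rho>: "\<rho> \<in> carrier_mat d d"
    and tr: "\<And>c b. c \<in> set cs \<Longrightarrow> b \<in> B \<Longrightarrow> mtrace (Q c b * \<rho>) = of_real (pr c b)"
  let ?P = "\<lambda>bs. \<Prod>(c,b)\<leftarrow>zip cs bs. pr c b"
  have T: "tensor_pow \<rho> ?n \<in> carrier_mat (d ^ ?n) (d ^ ?n)"
    unfolding tensor_pow_eq using kron_list_carrier[of "map (\<lambda>_. \<rho>) cs" d] \<rho> by simp
  have Ktr: "mtrace (?K bs * tensor_pow \<rho> ?n) = of_real (?P bs)" if "bs \<in> \<Omega>" for bs
  proof -
    have len: "length (zip cs bs) = ?n" using that by (simp add: \<Omega>_def words_def)
    have "?K bs * tensor_pow \<rho> ?n = kron_list (map (\<lambda>z. (case z of (c, b) \<Rightarrow> Q c b) * \<rho>) (zip cs bs))"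
      unfolding tensor_pow_eq[of \<rho> "zip cs bs", unfolded len]
      by (rule kron_list_mult[where d = d]) (use Qz[OF that] \<rho> in auto)
    also have "mtrace \<dots> = (\<Prod>z\<leftarrow>zip cs bs. mtrace ((case z of (c, b) \<Rightarrow> Q c b) * \<rho>))"
      by (rule mtrace_kron_list[where d = d], rule mult_carrier_mat[of _ d d], erule Qz[OF that], rule \<rho>)
    also have "\<dots> = (\<Prod>z\<leftarrow>zip cs bs. of_real (case z of (c, b) \<Rightarrow> pr c b))"
      by (rule arg_cong[of _ _ prod_list], rule map_cong[OF refl]) (use tr zip[OF that] in auto)
    also have "\<dots> = of_real (?P bs)"
    proof -
      have "prod_list (map (\<lambda>z. complex_of_real (case z of (c, b) \<Rightarrow> pr c b)) zs) =
          of_real (prod_list (map (\<lambda>(c,b). pr c b) zs))" for zs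
        by (induction zs) auto
      then show ?thesis .
    qed
    finally show ?thesis .
  qed
  have "outcome_prob (F x) (tensor_pow \<rho> ?n) = (\<Sum>bs\<in>{bs\<in>\<Omega>. dec bs = x}. ?P bs)" for x
  proof -
    let ?D = "d ^ ?n" and ?S = "{bs\<in>\<Omega>. dec bs = x}"
    have "F x \<in> carrier_mat ?D ?D" by (simp add: F_def)
    from mtrace_mult[OF this T]
    have "mtrace (F x * tensor_pow \<rho> ?n) = (\<Sum>i<?D. \<Sum>j<?D. \<Sum>bs\<in>?S. ?K bs $$ (i, j) * tensor_pow \<rho> ?n $$ (j, i))"
      by (simp add: F_def sum_distrib_right)
    also have "\<dots> = (\<Sum>i<?D. \<Sum>bs\<in>?S. \<Sum>j<?D. ?K bs $$ (i, j) * tensor_pow \<rho> ?n $$ (j, i))"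
      by (intro sum.cong refl sum.swap)
    also have "\<dots> = (\<Sum>bs\<in>?S. \<Sum>i<?D. \<Sum>j<?D. ?K bs $$ (i, j) * tensor_pow \<rho> ?n $$ (j, i))"
      by (rule sum.swap)
    also have "\<dots> = (\<Sum>bs\<in>?S. of_real (?P bs))"
      by (rule sum.cong[OF refl]) (use mtrace_mult[OF herm_carrier[OF Kherm] T] Ktr in auto)
    finally show ?thesis by (simp add: outcome_prob_def)
  qed
  then have "(\<Sum>x\<in>{x\<in>dec ` \<Omega>. good x}. outcome_prob (F x) (tensor_pow \<rho> ?n)) =
      (\<Sum>x\<in>{x\<in>dec ` \<Omega>. good x}. \<Sum>bs\<in>{bs\<in>\<Omega>. dec bs = x}. ?P bs)"
    by simp
  also have "\<dots> = (\<Sum>x\<in>dec ` {bs\<in>\<Omega>. good (dec bs)}. \<Sum>bs\<in>{bs\<in>{bs\<in>\<Omega>. good (dec bs)}. dec bs = x}. ?P bs)"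
    by (intro sum.cong) auto
  also have "\<dots> = (\<Sum>bs\<in>{bs\<in>\<Omega>. good (dec bs)}. ?P bs)"
    using fin\<Omega> by (intro sum.image_gen[symmetric]) auto
  finally show "(\<Sum>x\<in>{x\<in>dec ` \<Omega>. good x}. outcome_prob (F x) (tensor_pow \<rho> ?n)) =
      (\<Sum>bs\<in>{bs\<in>\<Omega>. good (dec bs)}. ?P bs)" .
qed

subsection \<open>The learning procedure\<close>

lemma mtrace_mult_smult:
  assumes "P \<in> carrier_mat d d" "A \<in> carrier_mat d d"
  shows "mtrace (P * (c \<cdot>\<^sub>m A)) = c * mtrace (P * A)"
proof -
  have "c \<cdot>\<^sub>m A \<in> carrier_mat d d" using assms by simp
  then show ?thesis
    using assms by (simp add: mtrace_mult[of _ d d] sum_distrib_left mult_ac)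
qed

lemma herm_pauli: "herm 2 (pauli k)"
proof -
  have "pauli k $$ (i, j) = cnj (pauli k $$ (j, i))" if "i < 2" "j < 2" for i j
  proof -
    have "i = 0 \<or> i = Suc 0" "j = 0 \<or> j = Suc 0"
      using that by auto
    then show ?thesis
      by (elim disjE; simp add: pauli_index)
  qed
  then show ?thesis unfolding herm_def using pauli_carrier by blast
qed

lemma herm_pauli_string: "herm (2 ^ length p) (pauli_string p)"
  unfolding pauli_string_eq using herm_kron_list[of "map pauli p" 2] by (simp add: herm_pauli)

lemma hamiltonian_carrier: "hamiltonian N M E lam \<in> carrier_mat (2 ^ N) (2 ^ N)"
  by (simp add: hamiltonian_def)

lemma herm_smult_hamiltonian:
  assumes "\<And>a. a < M \<Longrightarrow> length (E a) = N"
  shows "herm (2 ^ N) (complex_of_real r \<cdot>\<^sub>m hamiltonian N M E lam)"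
  unfolding herm_def
proof (intro conjI allI impI)
  show "complex_of_real r \<cdot>\<^sub>m hamiltonian N M E lam \<in> carrier_mat (2 ^ N) (2 ^ N)"
    using hamiltonian_carrier by simp
  fix i j :: nat assume ij: "i < 2 ^ N" "j < 2 ^ N"
  have "(\<Sum>a<M. complex_of_real (lam a) * pauli_string (E a) $$ (i, j)) =
      (\<Sum>a<M. cnj (complex_of_real (lam a) * pauli_string (E a) $$ (j, i)))"
  proof (rule sum.cong[OF refl])
    fix a assume "a \<in> {..<M}"
    then have "herm (2 ^ N) (pauli_string (E a))"
      using herm_pauli_string[of "E a"] assms[of a] by simp
    then have "pauli_string (E a) $$ (i, j) = cnj (pauli_string (E a) $$ (j, i))"
      using ij by (rule hermD)
    then show "complex_of_real (lam a) * pauli_string (E a) $$ (i, j) =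
        cnj (complex_of_real (lam a) * pauli_string (E a) $$ (j, i))"
      by (metis complex_cnj_complex_of_real complex_cnj_mult)
  qed
  then show "(complex_of_real r \<cdot>\<^sub>m hamiltonian N M E lam) $$ (i, j) =
      cnj ((complex_of_real r \<cdot>\<^sub>m hamiltonian N M E lam) $$ (j, i))"
    using ij by (simp add: hamiltonian_def cnj_sum)
qed

lemma gibbs_carrier: "gibbs \<beta> (hamiltonian N M E lam) \<in> carrier_mat (2 ^ N) (2 ^ N)"
proof -
  have "complex_of_real (-\<beta>) \<cdot>\<^sub>m hamiltonian N M E lam \<in> carrier_mat (2 ^ N) (2 ^ N)"
    using hamiltonian_carrier by simp
  from mexp_carrier[OF this] show ?thesis by (simp add: gibbs_def)
qed

lemma mtrace_projection_gibbs:
  assumes len: "\<And>a. a < M \<Longrightarrow> length (E a) = N" and Q: "herm (2 ^ N) Q" "Q * Q = Q"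
  shows "\<exists>t\<ge>0. mtrace (Q * gibbs \<beta> (hamiltonian N M E lam)) = complex_of_real t"
proof -
  let ?A = "complex_of_real (-\<beta>) \<cdot>\<^sub>m hamiltonian N M E lam"
  let ?B = "complex_of_real (-\<beta> / 2) \<cdot>\<^sub>m hamiltonian N M E lam"
  have A: "?A \<in> carrier_mat (2 ^ N) (2 ^ N)" using hamiltonian_carrier by simp
  have "(1/2) \<cdot>\<^sub>m ?A = ?B"
    by (rule eq_matI) auto
  then have sq: "mexp ?A = mexp ?B * mexp ?B"
    using mexp_half_square[OF A] by simp
  have K: "herm (2 ^ N) (mexp ?B)"
    by (rule herm_mexp, rule herm_smult_hamiltonian, rule len)
  obtain t where t: "t \<ge> 0" "mtrace (Q * mexp ?A) = complex_of_real t"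
    using mtrace_projection_square[OF Q K] unfolding sq by blast
  have one: "1\<^sub>m (2 ^ N) * 1\<^sub>m (2 ^ N) = (1\<^sub>m (2 ^ N) :: complex mat)" by simp
  have "1\<^sub>m (2 ^ N) * mexp ?A = mexp ?A"
    using mexp_carrier[OF A] by simp
  \<comment> \<open>The case Q = 1 shows that the partition function is real and nonnegative. At
    this point it may be 0, and then the quotient below is 0 by convention.\<close>
  then obtain z where z: "z \<ge> 0" "mtrace (mexp ?A) = complex_of_real z"
    using mtrace_projection_square[OF herm_one one K] unfolding sq[symmetric] by metis
  have "mtrace (Q * gibbs \<beta> (hamiltonian N M E lam)) = 1 / mtrace (mexp ?A) * mtrace (Q * mexp ?A)"
    unfolding gibbs_def by (rule mtrace_mult_smult[OF herm_carrier[OF Q(1)] mexp_carrier[OF A]])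
  also have "\<dots> = complex_of_real (t / z)"
    using t z by simp
  finally show ?thesis using t z by (intro exI[of _ "t / z"]) auto
qed

lemma mtrace_pauli_gibbs:
  assumes len: "\<And>a. a < M \<Longrightarrow> length (E a) = N" and a: "a < M"
  shows "mtrace (pauli_string (E a) * gibbs \<beta> (hamiltonian N M E lam)) =
    cluster_sum (\<lambda>w. word_tr N E (a # w)) (\<lambda>a. of_real (-\<beta> * lam a)) {} {..<M} /
    cluster_sum (word_tr N E) (\<lambda>a. of_real (-\<beta> * lam a)) {} {..<M}"
proof -
  let ?A = "complex_of_real (-\<beta>) \<cdot>\<^sub>m hamiltonian N M E lam"
  have A: "?A \<in> carrier_mat (2 ^ N) (2 ^ N)" using hamiltonian_carrier by simp
  have P: "pauli_string (E a) \<in> carrier_mat (2 ^ N) (2 ^ N)"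
    using pauli_string_carrier[of "E a"] len[OF a] by simp
  have Z: "mtrace (mexp ?A) = 2 ^ N * cluster_sum (word_tr N E) (\<lambda>a. of_real (-\<beta> * lam a)) {} {..<M}"
    using mtrace_pauli_word_mexp[of M E N "[]" \<beta> lam, OF len] mexp_carrier[OF A] by simp
  have N: "mtrace (pauli_string (E a) * mexp ?A) =
      2 ^ N * cluster_sum (\<lambda>w. word_tr N E (a # w)) (\<lambda>a. of_real (-\<beta> * lam a)) {} {..<M}"
    using mtrace_pauli_word_mexp[of M E N "[a]" \<beta> lam, OF len] P a by simp
  have "mtrace (pauli_string (E a) * gibbs \<beta> (hamiltonian N M E lam)) =
      1 / mtrace (mexp ?A) * mtrace (pauli_string (E a) * mexp ?A)"
    unfolding gibbs_def by (rule mtrace_mult_smult[OF P mexp_carrier[OF A]])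
  then show ?thesis unfolding Z N by simp
qed

lemma sum_mtrace_mult:
  assumes Q: "\<And>b. b \<in> B \<Longrightarrow> Q b \<in> carrier_mat d d" and P: "P \<in> carrier_mat d d" and \<rho>: "\<rho> \<in> carrier_mat d d"
    and sum: "\<And>i j. i < d \<Longrightarrow> j < d \<Longrightarrow> (\<Sum>b\<in>B. s b * Q b $$ (i, j)) = P $$ (i, j)"
  shows "(\<Sum>b\<in>B. s b * mtrace (Q b * \<rho>)) = mtrace (P * \<rho>)"
proof -
  have "(\<Sum>b\<in>B. s b * mtrace (Q b * \<rho>)) = (\<Sum>b\<in>B. \<Sum>i<d. \<Sum>j<d. (s b * Q b $$ (i, j)) * \<rho> $$ (j, i))"
    by (rule sum.cong[OF refl]) (simp add: mtrace_mult[OF Q \<rho>] sum_distrib_left mult_ac)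
  also have "\<dots> = (\<Sum>i<d. \<Sum>b\<in>B. \<Sum>j<d. (s b * Q b $$ (i, j)) * \<rho> $$ (j, i))"
    by (rule sum.swap)
  also have "\<dots> = (\<Sum>i<d. \<Sum>j<d. \<Sum>b\<in>B. (s b * Q b $$ (i, j)) * \<rho> $$ (j, i))"
    by (intro sum.cong refl sum.swap)
  also have "\<dots> = (\<Sum>i<d. \<Sum>j<d. P $$ (i, j) * \<rho> $$ (j, i))"
    by (intro sum.cong refl) (simp add: sum flip: sum_distrib_right)
  also have "\<dots> = mtrace (P * \<rho>)"
    by (rule mtrace_mult[OF P \<rho>, symmetric])
  finally show ?thesis .
qed

lemma Chernoff_words_abs:
  fixes pr :: "'c \<Rightarrow> 'b \<Rightarrow> real" and cs :: "'c list"
  assumes fin: "finite B" and pr: "\<And>c b. c \<in> set cs \<Longrightarrow> b \<in> B \<Longrightarrow> 0 \<le> pr c b"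
    and pr1: "\<And>c. c \<in> set cs \<Longrightarrow> (\<Sum>b\<in>B. pr c b) = 1"
    and Y: "\<And>b. b \<in> B \<Longrightarrow> \<bar>Y b\<bar> \<le> 1" and c0: "c0 \<in> set cs" and f: "f = (\<Sum>b\<in>B. pr c0 b * Y b)"
    and \<eta>: "0 \<le> \<eta>" "\<eta> \<le> 1" and m: "m = count_list cs c0"
  shows "(\<Sum>bs\<in>{bs\<in>words B (length cs). m * \<eta> < \<bar>\<Sum>(c,b)\<leftarrow>zip cs bs. if c = c0 then Y b - f else 0\<bar>}.
      \<Prod>(c,b)\<leftarrow>zip cs bs. pr c b) \<le> 2 * exp (- (m * \<eta>\<^sup>2 / 4))"
proof -
  let ?S = "\<lambda>bs. \<Sum>(c,b)\<leftarrow>zip cs bs. if c = c0 then Y b - f else 0"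
  let ?P = "\<lambda>bs. \<Prod>(c,b)\<leftarrow>zip cs bs. pr c b"
  let ?U = "{bs\<in>words B (length cs). m * \<eta> < ?S bs}" and ?L = "{bs\<in>words B (length cs). m * \<eta> < - ?S bs}"
  have neg: "(\<Sum>(c,b)\<leftarrow>zs. if c = c0 then - Y b - - f else 0) = - (\<Sum>(c,b)\<leftarrow>zs. if c = c0 then Y b - f else 0)"
    for zs :: "('c \<times> 'b) list"
    by (induction zs) auto
  have U: "(\<Sum>bs\<in>?U. ?P bs) \<le> exp (- (m * \<eta>\<^sup>2 / 4))"
    by (rule Chernoff_words[where B = B and pr = pr and cs = cs and Y = Y, OF fin pr pr1 Y c0 f \<eta> m])
  have "(\<Sum>bs\<in>{bs\<in>words B (length cs). m * \<eta> < (\<Sum>(c,b)\<leftarrow>zip cs bs. if c = c0 then - Y b - - f else 0)}. ?P bs)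
      \<le> exp (- (m * \<eta>\<^sup>2 / 4))"
    by (rule Chernoff_words[where B = B and pr = pr and cs = cs and Y = "\<lambda>b. - Y b", OF fin pr pr1 _ c0 _ \<eta> m])
      (use Y f in \<open>auto simp: sum_negf\<close>)
  then have L: "(\<Sum>bs\<in>?L. ?P bs) \<le> exp (- (m * \<eta>\<^sup>2 / 4))"
    unfolding neg .
  have "{bs\<in>words B (length cs). m * \<eta> < \<bar>?S bs\<bar>} = ?U \<union> ?L" by auto
  moreover have "?U \<inter> ?L = {}"
  proof -
    have "0 \<le> m * \<eta>" using \<eta> by simp
    then show ?thesis by auto
  qed
  moreover have "finite ?U" "finite ?L" using finite_words[OF fin] by auto
  ultimately show ?thesis
    using U L by (simp add: sum.union_disjoint)
qed

lemma union_bound: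
  fixes P :: "'a \<Rightarrow> real"
  assumes fin: "finite \<Omega>" and P: "\<And>w. w \<in> \<Omega> \<Longrightarrow> 0 \<le> P w" and P1: "(\<Sum>w\<in>\<Omega>. P w) = 1"
    and bad: "\<And>w. w \<in> \<Omega> \<Longrightarrow> \<not> G w \<Longrightarrow> \<exists>a<M. U a w" and q: "\<And>a. a < M \<Longrightarrow> (\<Sum>w\<in>{w\<in>\<Omega>. U a w}. P w) \<le> q"
  shows "1 - real M * q \<le> (\<Sum>w\<in>{w\<in>\<Omega>. G w}. P w)"
proof -
  have "1 = (\<Sum>w\<in>\<Omega>. P w)" using P1 by simp
  also have "\<dots> \<le> (\<Sum>w\<in>\<Omega>. (if G w then P w else 0) + (\<Sum>a<M. if U a w then P w else 0))"
  proof (rule sum_mono)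
    fix w assume w: "w \<in> \<Omega>"
    have pos: "0 \<le> (\<Sum>a<M. if U a w then P w else 0)"
      using P[OF w] by (intro sum_nonneg) auto
    show "P w \<le> (if G w then P w else 0) + (\<Sum>a<M. if U a w then P w else 0)"
    proof (cases "G w")
      case True
      then show ?thesis using pos by simp
    next
      case False
      then obtain a where a: "a < M" "U a w" using bad[OF w] by blast
      have "P w = (if U a w then P w else 0)" using a by simp
      also have "\<dots> \<le> (\<Sum>a<M. if U a w then P w else 0)"
        by (rule member_le_sum[of a "{..<M}" "\<lambda>a. if U a w then P w else 0"]) (use a P[OF w] in auto)
      finally show ?thesis using False by simp
    qed
  qed
  also have "\<dots> = (\<Sum>w\<in>{w\<in>\<Omega>. G w}. P w) + (\<Sum>a<M. \<Sum>w\<in>{w\<in>\<Omega>. U a w}. P w)"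
    unfolding sum.distrib sum.inter_filter[OF fin] by (subst (2) sum.swap) simp
  also have "(\<Sum>a<M. \<Sum>w\<in>{w\<in>\<Omega>. U a w}. P w) \<le> (\<Sum>a<M. q)"
    by (rule sum_mono) (use q in auto)
  finally show ?thesis by simp
qed

text \<open>For a fixed colour at most one term acts on a given qubit, so the measurement basis of
  that qubit can be dictated by this term without conflict.\<close>

lemma colour_class_basis:
  assumes word: "\<And>a. a < M \<Longrightarrow> pauli_word N (E a)"
    and colour: "\<And>a b. \<lbrakk>a < M; b < M; a \<noteq> b; pauli_support (E a) \<inter> pauli_support (E b) \<noteq> {}\<rbrakk> \<Longrightarrow> colour a \<noteq> colour b"
  shows "\<exists>p. (\<forall>c. \<forall>i<N. p c i \<in> {1, 2, 3}) \<and> (\<forall>a<M. \<forall>i<N. E a ! i = 0 \<or> E a ! i = p (colour a) i)"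
proof -
  define R where "R c i a \<longleftrightarrow> a < M \<and> colour a = c \<and> E a ! i \<noteq> 0" for c i a
  \<comment> \<open>A qubit on which no term of the colour acts is measured in the Z basis; any of
    the three nontrivial Pauli matrices would do.\<close>
  define p where "p c i = (if \<exists>a. R c i a then E (SOME a. R c i a) ! i else 3)" for c i
  have "p c i \<in> {1, 2, 3}" if i: "i < N" for c i
  proof (cases "\<exists>a. R c i a")
    case True
    define b where "b = (SOME a. R c i a)"
    have "R c i b" unfolding b_def using True by (rule someI_ex)
    then have b: "b < M" "E b ! i \<noteq> 0" by (simp_all add: R_def)
    have "E b ! i \<in> set (E b)"
      using word[OF b(1)] i by (intro nth_mem) (simp add: pauli_word_def)
    then have "E b ! i < 4" using word[OF b(1)] by (simp add: pauli_word_def)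
    with b(2) have "E b ! i \<in> {1, 2, 3}" by auto
    moreover have "p c i = E b ! i" using True by (simp add: p_def b_def)
    ultimately show ?thesis by simp
  qed (simp add: p_def)
  moreover have "E a ! i = 0 \<or> E a ! i = p (colour a) i" if a: "a < M" and i: "i < N" for a i
  proof (rule disjCI)
    assume ne: "E a ! i \<noteq> p (colour a) i"
    show "E a ! i = 0"
    proof (rule ccontr)
      assume n0: "E a ! i \<noteq> 0"
      then have ex: "\<exists>b. R (colour a) i b" using a by (auto simp: R_def)
      define b where "b = (SOME b. R (colour a) i b)"
      have b: "R (colour a) i b" unfolding b_def using ex by (rule someI_ex)
      have "p (colour a) i = E b ! i" using ex by (simp add: p_def b_def)
      then have "b \<noteq> a" using ne by auto
      moreover have "i \<in> pauli_support (E a) \<inter> pauli_support (E b)"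
        using a b i n0 word by (auto simp: pauli_support_def R_def pauli_word_def)
      ultimately show False using colour[of a b] a b by (auto simp: R_def)
    qed
  qed
  ultimately show ?thesis by blast
qed

lemma count_list_concat_replicate:
  "count_list (concat (replicate m xs)) c = m * count_list xs c"
  by (induction m) simp_all

lemma count_list_upt: "count_list [0..<n] c = (if c < n then 1 else 0)"
  by (induction n) auto

text \<open>The deviation is affine in its centre. So two centres compatible with the same data are
  close to each other, whatever the data are.\<close>

lemma sum_list_zip_diff:
  assumes "length bs = length cs"
  shows "(\<Sum>(c,b)\<leftarrow>zip cs bs. if c = c0 then Y b - y' else 0) - (\<Sum>(c,b)\<leftarrow>zip cs bs. if c = c0 then Y b - y else 0) =
    real (count_list cs c0) * (y - y' :: real)"
  using assms[symmetric]
  by (induction cs bs rule: list_induct2) (simp_all add: algebra_simps)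

lemma exp_6_ge: "200 \<le> exp (6::real)"
proof -
  have "(5/2 :: real) \<le> exp 1"
    using exp_lower_Taylor_quadratic[of 1] by simp
  then have "(5/2 :: real) ^ 6 \<le> exp 1 ^ 6"
    by (intro power_mono) auto
  also have "exp 1 ^ 6 = exp (6 :: real)"
    by (simp flip: exp_of_nat_mult)
  finally show ?thesis by (simp add: power_divide)
qed

text \<open>With L = ln (M / \<delta>) and q = (\<beta> \<epsilon>)^2, the choice m \<ge> 128 L / q
  makes the exponent at least 2 L, and 2 M (\<delta> / M)^2 \<le> \<delta> because \<delta> / M
  \<le> 1/2. Rounding up costs at most 1, which is absorbed by 2 L / q since L \<ge> 1/2 and q \<le>
  1; hence 130.\<close>

lemma sample_size:
  fixes \<beta> \<epsilon> \<delta> :: real and M :: nat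
  assumes M: "M \<ge> 1" and \<beta>: "0 < \<beta>" "\<beta> \<le> 1" and \<epsilon>: "0 < \<epsilon>" "\<epsilon> \<le> 1" and \<delta>: "0 < \<delta>" "\<delta> \<le> 1 / 2"
  obtains m :: nat where "m > 0" "real m \<le> 130 / (\<beta>\<^sup>2 * \<epsilon>\<^sup>2) * ln (real M / \<delta>)"
    "real M * (2 * exp (- (real m * (\<beta> * \<epsilon> / 4)\<^sup>2 / 4))) \<le> \<delta>"
proof
  define q where "q = \<beta>\<^sup>2 * \<epsilon>\<^sup>2"
  define L where "L = ln (real M / \<delta>)"
  define m where "m = nat \<lceil>128 * L / q\<rceil>"
  have q: "0 < q" "q \<le> 1"
    using \<beta> \<epsilon> by (auto simp: q_def power_le_one mult_le_one)
  have r: "2 \<le> real M / \<delta>"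
  proof -
    have "2 * \<delta> \<le> 1" using \<delta> by simp
    also have "1 \<le> real M" using M by simp
    finally show ?thesis using \<delta> by (simp add: field_simps)
  qed
  then have "ln 2 \<le> L" unfolding L_def by simp
  then have L: "1 / 2 \<le> L" using ln2_ge_two_thirds by linarith
  have m: "128 * L / q \<le> real m" "real m \<le> 128 * L / q + 1"
    using L q by (auto simp: m_def)
  have "0 < 128 * L / q" using L q by simp
  then show "m > 0" using m(1) by linarith
  have "1 \<le> 2 * L / q"
    using L q by (simp add: field_simps)
  then have "real m \<le> 128 * L / q + 2 * L / q" using m(2) by linarith
  then show "real m \<le> 130 / (\<beta>\<^sup>2 * \<epsilon>\<^sup>2) * ln (real M / \<delta>)"
    unfolding q_def[symmetric] L_def[symmetric] by (simp add: field_simps)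
  have "128 * L \<le> real m * q" using m(1) q by (simp add: field_simps)
  then have "2 * L \<le> real m * (\<beta> * \<epsilon> / 4)\<^sup>2 / 4"
    by (simp add: q_def power_mult_distrib power_divide)
  moreover have expL: "exp (- L) = \<delta> / real M"
    using \<delta> M by (simp add: L_def exp_minus)
  ultimately have "exp (- (real m * (\<beta> * \<epsilon> / 4)\<^sup>2 / 4)) \<le> exp (- L + - L)"
    by simp
  also have "\<dots> = (\<delta> / real M) * (\<delta> / real M)"
    unfolding exp_add expL ..
  also have "\<dots> \<le> (\<delta> / real M) * (1 / 2)"
  proof (rule mult_left_mono)
    show "\<delta> / real M \<le> 1 / 2" using r \<delta> M by (simp add: field_simps)
  qed (use \<delta> in auto)
  finally have "real M * (2 * exp (- (real m * (\<beta> * \<epsilon> / 4)\<^sup>2 / 4))) \<le> real M * (2 * ((\<delta> / real M) * (1 / 2)))"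
    by (intro mult_left_mono) auto
  then show "real M * (2 * exp (- (real m * (\<beta> * \<epsilon> / 4)\<^sup>2 / 4))) \<le> \<delta>"
    using M by simp
qed

text \<open>The measurement and the decoder are fixed before the unknown \<open>lam\<close> is
  quantified; only the outcome distribution depends on it. The proof splits into a deterministic
  statement about data compatible with two candidates and a tail bound for the true one.\<close>

lemma Gibbs_state_learning:
  fixes N M :: nat and E :: "nat \<Rightarrow> nat list" and \<beta> \<epsilon> \<delta> :: real
  assumes M: "M \<ge> 1"
    and word: "\<And>a. a < M \<Longrightarrow> pauli_word N (E a)"
    and supp: "\<And>a. a < M \<Longrightarrow> pauli_support (E a) \<noteq> {}"
    and traceless: "\<And>a. a < M \<Longrightarrow> mtrace (pauli_string (E a)) = 0"
    and orth: "\<And>a b. a < M \<Longrightarrow> b < M \<Longrightarrow> mtrace (pauli_string (E a) * pauli_string (E b)) = (if a = b then 2 ^ N else 0)"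
    and \<beta>: "0 < \<beta>" "20000 * (real (dual_degree M E) + 1)\<^sup>2 * \<beta> \<le> 1"
    and \<epsilon>: "0 < \<epsilon>" "\<epsilon> \<le> 1" and \<delta>: "0 < \<delta>" "\<delta> \<le> 1 / 2"
  shows "\<exists>(n::nat) (X::(nat \<Rightarrow> real) set) F.
     real n \<le> 130 * (real (dual_degree M E) + 1) / (\<beta>^2 * \<epsilon>^2) * ln (real M / \<delta>) \<and>
     povm (2 ^ (N * n)) X F \<and> (\<forall>x\<in>X. \<forall>a<M. \<bar>x a\<bar> \<le> 1) \<and>
     (\<forall>lam. (\<forall>a<M. \<bar>lam a\<bar> \<le> 1) \<longrightarrow>
        (\<Sum>x\<in>{x\<in>X. \<forall>a<M. \<bar>x a - lam a\<bar> \<le> \<epsilon>}. outcome_prob (F x) (tensor_pow (gibbs \<beta> (hamiltonian N M E lam)) n)) \<ge> 1 - \<delta>)"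
proof -
  define d where "d = dual_degree M E"
  \<comment> \<open>Two candidates compatible with the same data have expectations within 2 \<eta>.
    Stability doubles this to 4 \<eta> = \<beta> \<epsilon> for the parameters - \<beta> lam a, and
    division by \<beta> leaves \<epsilon>.\<close>
  define \<eta> where "\<eta> = \<beta> * \<epsilon> / 4"
  let ?touch = "\<lambda>a b. pauli_support (E a) \<inter> pauli_support (E b) \<noteq> {}"
  let ?\<rho> = "\<lambda>lam. gibbs \<beta> (hamiltonian N M E lam)"
  have len: "length (E a) = N" if "a < M" for a
    using word[OF that] by (simp add: pauli_word_def)
  interpret W: orthogonal_word_trace "word_tr N E" ?touch "{..<M}" d
    unfolding d_def by (rule orthogonal_word_trace_pauli[OF len supp traceless orth])
  have "1 \<le> 20000 * (real d + 1)\<^sup>2"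
    using one_le_power[of "real d + 1" 2] by linarith
  then have "1 * \<beta> \<le> 20000 * (real d + 1)\<^sup>2 * \<beta>" using \<beta>(1) by (intro mult_right_mono) simp_all
  then have \<beta>1: "\<beta> \<le> 1" using \<beta>(2) by (simp add: d_def)
  have \<eta>: "0 < \<eta>" "\<eta> \<le> 1"
    using \<beta>(1) \<beta>1 \<epsilon> mult_le_one[of \<beta> \<epsilon>] by (auto simp: \<eta>_def)
  obtain m where m: "m > 0" "real m \<le> 130 / (\<beta>\<^sup>2 * \<epsilon>\<^sup>2) * ln (real M / \<delta>)"
    "real M * (2 * exp (- (real m * \<eta>\<^sup>2 / 4))) \<le> \<delta>"
    using sample_size[OF M \<beta>(1) \<beta>1 \<epsilon> \<delta>] unfolding \<eta>_def by metis
  have "card {b. b < M \<and> b \<noteq> a \<and> ?touch a b} \<le> d" if "a < M" for a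
    unfolding d_def dual_degree_def using that by (intro Max_ge) auto
  then have "\<exists>c. (\<forall>a<M. c a \<le> d) \<and> (\<forall>a<M. \<forall>b<M. a \<noteq> b \<longrightarrow> ?touch a b \<longrightarrow> c a \<noteq> (c b :: nat))"
    by (rule greedy_colouring) (simp_all add: Int_commute)
  then obtain colour :: "nat \<Rightarrow> nat"
    where colour: "\<And>a. a < M \<Longrightarrow> colour a \<le> d"
      "\<And>a b. \<lbrakk>a < M; b < M; a \<noteq> b; ?touch a b\<rbrakk> \<Longrightarrow> colour a \<noteq> colour b"
    by blast
  have "\<exists>p. (\<forall>c. \<forall>i<N. p c i \<in> {1, 2, 3}) \<and> (\<forall>a<M. \<forall>i<N. E a ! i = 0 \<or> E a ! i = p (colour a) i)"
    by (rule colour_class_basis[OF word colour(2)])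
  then obtain p :: "nat \<Rightarrow> nat \<Rightarrow> nat" where p: "\<And>c i. i < N \<Longrightarrow> p c i \<in> {1, 2, 3}"
    "\<And>a i. a < M \<Longrightarrow> i < N \<Longrightarrow> E a ! i = 0 \<or> E a ! i = p (colour a) i"
    by blast
  \<comment> \<open>The d + 1 colours are run through m times, so each colour is used as a setting
    on exactly m copies.\<close>
  define cs where "cs = concat (replicate m [0..<Suc d])"
  define n where "n = length cs"
  have n: "n = m * Suc d"
    by (simp add: n_def cs_def length_concat sum_list_replicate)
  have count: "count_list cs (colour a) = m" if "a < M" for a
    using colour(1)[OF that] by (simp add: cs_def count_list_concat_replicate count_list_upt del: upt_Suc)
  have colour_in: "colour a \<in> set cs" if "a < M" for a
    using colour(1)[OF that] m(1) by (auto simp: cs_def)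
  define B where "B = words (UNIV :: bool set) N"
  define Q where "Q c b = basis_proj N (p c) b" for c b
  define \<Omega> where "\<Omega> = words B n"
  have finB: "finite B" by (simp add: B_def finite_words)
  have Bn: "length b = N" if "b \<in> B" for b using that by (simp add: B_def words_def)
  have Qherm: "herm (2 ^ N) (Q c b)" if "b \<in> B" for c b
    unfolding Q_def by (rule herm_basis_proj) (rule Bn[OF that])
  have Qidem: "Q c b * Q c b = Q c b" for c b
    unfolding Q_def by (rule basis_proj_square) (rule p(1))
  have Qtotal: "(\<Sum>b\<in>B. Q c b $$ (i, j)) = 1\<^sub>m (2 ^ N) $$ (i, j)" if "i < 2 ^ N" "j < 2 ^ N" for c i j
    unfolding Q_def B_def by (rule sum_basis_proj[OF p(1) that])
  have Qeig: "(\<Sum>b\<in>B. complex_of_real (eig (E a) b) * Q (colour a) b $$ (i, j)) = pauli_string (E a) $$ (i, j)"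
    if "a < M" "i < 2 ^ N" "j < 2 ^ N" for a i j
    unfolding Q_def B_def by (rule sum_eig_basis_proj[OF len p(2) p(1)]) (use that in auto)
  define pr where "pr lam c b = Re (mtrace (Q c b * ?\<rho> lam))" for lam c b
  define tr where "tr lam a = (\<Sum>b\<in>B. pr lam (colour a) b * eig (E a) b)" for lam a
  have pr: "mtrace (Q c b * ?\<rho> lam) = of_real (pr lam c b)" "0 \<le> pr lam c b" if "b \<in> B" for lam c b
  proof -
    have "\<exists>t\<ge>0. mtrace (Q c b * ?\<rho> lam) = complex_of_real t"
      by (rule mtrace_projection_gibbs[OF len Qherm[OF that] Qidem])
    then obtain t where "t \<ge> 0" "mtrace (Q c b * ?\<rho> lam) = complex_of_real t"
      by blast
    then show "mtrace (Q c b * ?\<rho> lam) = of_real (pr lam c b)" "0 \<le> pr lam c b"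
      by (simp_all add: pr_def)
  qed
  have mean: "W.mean (\<lambda>a. of_real (-\<beta> * lam a)) a = of_real (tr lam a)" if a: "a < M" for lam a
  proof -
    have "(\<Sum>b\<in>B. complex_of_real (eig (E a) b) * mtrace (Q (colour a) b * ?\<rho> lam)) = mtrace (pauli_string (E a) * ?\<rho> lam)"
      by (rule sum_mtrace_mult[OF herm_carrier[OF Qherm] _ gibbs_carrier Qeig[OF a]])
        (use pauli_string_carrier[of "E a"] len[OF a] in auto)
    also have "\<dots> = W.mean (\<lambda>a. of_real (-\<beta> * lam a)) a"
      unfolding W.mean_def by (rule mtrace_pauli_gibbs[OF len a])
    finally show ?thesis
      by (simp add: pr(1) tr_def mult.commute)
  qed
  \<comment> \<open>Normalization, unlike nonnegativity, needs a nonzero partition function. This is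
    where the bound on \<open>lam\<close> and the high-temperature estimate enter.\<close>
  have pr1: "(\<Sum>b\<in>B. pr lam c b) = 1" if lam: "\<forall>a<M. \<bar>lam a\<bar> \<le> 1" for lam c
  proof -
    let ?A = "complex_of_real (-\<beta>) \<cdot>\<^sub>m hamiltonian N M E lam"
    let ?x = "\<lambda>a. complex_of_real (-\<beta> * lam a)"
    have A: "?A \<in> carrier_mat (2 ^ N) (2 ^ N)" using hamiltonian_carrier by simp
    note eA = mexp_carrier[OF A]
    define D where "D = real d + 1"
    have "1 \<le> D" by (simp add: D_def)
    then have "D \<le> D\<^sup>2" by (rule self_le_power) simp
    then have "10 * D \<le> 20000 * D\<^sup>2" using \<open>1 \<le> D\<close> by linarith
    then have "10 * (real d + 1) * \<beta> \<le> 20000 * (real d + 1)\<^sup>2 * \<beta>"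
      using \<beta>(1) unfolding D_def by (intro mult_right_mono) simp_all
    then have "\<beta> \<le> 1 / (10 * (real d + 1))"
      using \<beta>(2) by (simp add: d_def field_simps)
    moreover have "norm (?x a) \<le> \<beta>" if "a \<in> {..<M}" for a
      unfolding norm_of_real using lam that \<beta>(1) by (simp add: abs_mult mult_left_le)
    ultimately have "norm (?x a) \<le> 1 / (10 * (real d + 1))" if "a \<in> {..<M}" for a
      using that order_trans by blast
    then have "W.Z ?x {..<M} \<noteq> 0"
      by (rule W.high_temperature_bound(1))
    moreover have "mtrace (mexp ?A) = 2 ^ N * W.Z ?x {..<M}"
      using mtrace_pauli_word_mexp[of M E N "[]" \<beta> lam, OF len] eA by simp
    ultimately have Z: "mtrace (mexp ?A) \<noteq> 0" by simp
    have "complex_of_real (\<Sum>b\<in>B. pr lam c b) = (\<Sum>b\<in>B. 1 * mtrace (Q c b * ?\<rho> lam))"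
      by (simp add: pr(1))
    also have "\<dots> = mtrace (1\<^sub>m (2 ^ N) * ?\<rho> lam)"
      by (rule sum_mtrace_mult[OF herm_carrier[OF Qherm] _ gibbs_carrier]) (use Qtotal in auto)
    also have "\<dots> = 1 / mtrace (mexp ?A) * mtrace (1\<^sub>m (2 ^ N) * mexp ?A)"
      unfolding gibbs_def by (rule mtrace_mult_smult[OF one_carrier_mat eA])
    also have "\<dots> = 1"
      using Z left_mult_one_mat[OF eA] by simp
    finally show ?thesis by (simp only: of_real_eq_1_iff)
  qed
  \<comment> \<open>The centre is the expectation predicted by a candidate \<open>lam\<close>.
    Compatibility of data and candidate can therefore be tested by the decoder without reference to
    the true coefficients.\<close>
  define dev where "dev lam a bs = (\<Sum>(c,b)\<leftarrow>zip cs bs. if c = colour a then eig (E a) b - tr lam a else 0)" for lam a bs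
  define good where "good lam bs \<longleftrightarrow> (\<forall>a<M. \<bar>dev lam a bs\<bar> \<le> real m * \<eta>)" for lam bs
  define unit where "unit lam \<longleftrightarrow> (\<forall>a<M. \<bar>lam a\<bar> \<le> (1::real))" for lam
  \<comment> \<open>Any compatible candidate in the unit box serves as the answer; if there is none,
    the default 0 keeps the answer in the box.\<close>
  define dec where "dec bs = (if \<exists>x. unit x \<and> good x bs then SOME x. unit x \<and> good x bs else (\<lambda>_. 0))" for bs
  have dec_unit: "unit (dec bs)" for bs
  proof (cases "\<exists>x. unit x \<and> good x bs")
    case True
    then show ?thesis using someI_ex[OF True] by (simp add: dec_def)
  next
    case False
    then have "dec bs = (\<lambda>_. 0)" unfolding dec_def by (rule if_not_P)
    then show ?thesis by (simp add: unit_def)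
  qed
  \<comment> \<open>No probability is involved: if the true \<open>lam\<close> is compatible with
    the data, then so is the decoded candidate, and stability compares the two.\<close>
  have dec_close: "\<bar>dec bs a - lam a\<bar> \<le> \<epsilon>" if bs: "bs \<in> \<Omega>" and lam: "unit lam" "good lam bs" and a: "a < M" for bs lam a
  proof -
    define x where "x = dec bs"
    have ex: "\<exists>x. unit x \<and> good x bs" using lam by blast
    have x: "unit x" "good x bs"
      using someI_ex[OF ex] ex by (simp_all add: x_def dec_def)
    have close: "\<bar>tr lam a - tr x a\<bar> \<le> 2 * \<eta>" if "a < M" for a
    proof -
      have "length bs = length cs" using bs by (simp add: \<Omega>_def n_def words_def)
      then have "dev x a bs - dev lam a bs = real m * (tr lam a - tr x a)"
        unfolding dev_def using sum_list_zip_diff count[OF that] by metis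
      moreover have "\<bar>dev x a bs\<bar> \<le> real m * \<eta>" "\<bar>dev lam a bs\<bar> \<le> real m * \<eta>"
        using x lam that by (auto simp: good_def)
      ultimately have "\<bar>real m * (tr lam a - tr x a)\<bar> \<le> real m * (2 * \<eta>)"
        by linarith
      then show ?thesis using m(1) by (simp add: abs_mult)
    qed
    have "norm (complex_of_real (-\<beta> * lam a) - of_real (-\<beta> * x a)) \<le> 2 * (2 * \<eta>)"
    proof (rule W.mean_inverse_Lipschitz[of "\<lambda>a. of_real (-\<beta> * x a)" \<beta> "\<lambda>a. of_real (-\<beta> * lam a)"])
      have "\<bar>\<beta> * y\<bar> \<le> \<beta>" if "\<bar>y\<bar> \<le> 1" for y
        using that \<beta>(1) by (simp add: abs_mult)
      then show "norm (complex_of_real (-\<beta> * x b)) \<le> \<beta>" "norm (complex_of_real (-\<beta> * lam b)) \<le> \<beta>"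
        if "b \<in> {..<M}" for b
        using that x lam unfolding norm_of_real by (auto simp: unit_def)
      show "norm (W.mean (\<lambda>a. of_real (-\<beta> * lam a)) b - W.mean (\<lambda>a. of_real (-\<beta> * x a)) b) \<le> 2 * \<eta>"
        if "b \<in> {..<M}" for b
        using that close[of b] unfolding of_real_diff[symmetric] by (simp only: mean lessThan_iff norm_of_real flip: of_real_diff)
    qed (use \<beta> a in \<open>auto simp: d_def\<close>)
    then have "\<bar>\<beta> * (x a - lam a)\<bar> \<le> \<beta> * \<epsilon>"
      unfolding of_real_diff[symmetric] norm_of_real by (simp add: \<eta>_def algebra_simps)
    then show ?thesis using \<beta>(1) by (simp add: abs_mult x_def)
  qed
  define F where "F x = Matrix.mat ((2 ^ N) ^ n) ((2 ^ N) ^ n)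
    (\<lambda>ij. \<Sum>bs\<in>{bs\<in>\<Omega>. dec bs = x}. kron_list (map (\<lambda>(c,b). Q c b) (zip cs bs)) $$ ij)" for x
  have povm: "povm ((2 ^ N) ^ n) (dec ` \<Omega>) F"
    unfolding F_def \<Omega>_def n_def
    by (rule product_measurement(1)) (use finB Qherm Qidem Qtotal in auto)
  have prob: "1 - \<delta> \<le> (\<Sum>x\<in>{x\<in>dec ` \<Omega>. \<forall>a<M. \<bar>x a - lam a\<bar> \<le> \<epsilon>}. outcome_prob (F x) (tensor_pow (?\<rho> lam) n))"
    if lam: "\<forall>a<M. \<bar>lam a\<bar> \<le> 1" for lam
  proof -
    have lam': "unit lam" using lam by (simp add: unit_def)
    let ?P = "\<lambda>bs. \<Prod>(c,b)\<leftarrow>zip cs bs. pr lam c b"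
    have "1 - \<delta> \<le> 1 - real M * (2 * exp (- (real m * \<eta>\<^sup>2 / 4)))" using m(3) by simp
    also have "\<dots> \<le> (\<Sum>bs\<in>{bs\<in>\<Omega>. \<forall>a<M. \<bar>dec bs a - lam a\<bar> \<le> \<epsilon>}. ?P bs)"
    proof (rule union_bound[where U = "\<lambda>a bs. real m * \<eta> < \<bar>dev lam a bs\<bar>"])
      show "finite \<Omega>" unfolding \<Omega>_def by (rule finite_words[OF finB])
      show "0 \<le> ?P bs" if bs: "bs \<in> \<Omega>" for bs
      proof (rule prod_list_nonneg)
        fix y assume "y \<in> set (map (\<lambda>(c,b). pr lam c b) (zip cs bs))"
        then obtain c b where z: "(c, b) \<in> set (zip cs bs)" "y = pr lam c b" by auto
        have "b \<in> B" using set_zip_rightD[OF z(1)] bs by (auto simp: \<Omega>_def words_def)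
        then show "0 \<le> y" using pr(2) z(2) by simp
      qed
      show "(\<Sum>bs\<in>\<Omega>. ?P bs) = 1"
        unfolding \<Omega>_def n_def sum_words_prod_zip pr1[OF lam] by (induction cs) auto
      \<comment> \<open>The decoder can fail only on data that are incompatible with the true
        \<open>lam\<close>, that is, when some empirical mean deviates too far.\<close>
      show "\<exists>a<M. real m * \<eta> < \<bar>dev lam a bs\<bar>" if "bs \<in> \<Omega>" "\<not> (\<forall>a<M. \<bar>dec bs a - lam a\<bar> \<le> \<epsilon>)" for bs
      proof (rule ccontr)
        assume "\<not> (\<exists>a<M. real m * \<eta> < \<bar>dev lam a bs\<bar>)"
        then have "good lam bs" unfolding good_def by (meson not_le)
        then show False using dec_close[OF that(1) lam'] that(2) by blast
      qed
      show "(\<Sum>bs\<in>{bs\<in>\<Omega>. real m * \<eta> < \<bar>dev lam a bs\<bar>}. ?P bs) \<le> 2 * exp (- (real m * \<eta>\<^sup>2 / 4))" if a: "a < M" for a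
        unfolding dev_def \<Omega>_def n_def
        by (rule Chernoff_words_abs[where Y = "eig (E a)"])
          (use finB pr(2) pr1[OF lam] colour_in[OF a] \<eta> count[OF a] in \<open>auto simp: abs_eig tr_def\<close>)
    qed
    also have "\<dots> = (\<Sum>x\<in>{x\<in>dec ` \<Omega>. \<forall>a<M. \<bar>x a - lam a\<bar> \<le> \<epsilon>}. outcome_prob (F x) (tensor_pow (?\<rho> lam) n))"
      unfolding F_def \<Omega>_def n_def
      by (rule product_measurement(2)[symmetric]) (use finB Qherm Qidem Qtotal gibbs_carrier pr(1) in auto)
    finally show ?thesis .
  qed
  have "real n = real m * (real d + 1)" by (simp add: n algebra_simps)
  also have "\<dots> \<le> (130 / (\<beta>\<^sup>2 * \<epsilon>\<^sup>2) * ln (real M / \<delta>)) * (real d + 1)"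
    using m(2) by (intro mult_right_mono) auto
  also have "\<dots> = 130 * (real (dual_degree M E) + 1) / (\<beta>^2 * \<epsilon>^2) * ln (real M / \<delta>)"
    by (simp add: d_def)
  finally have size: "real n \<le> 130 * (real (dual_degree M E) + 1) / (\<beta>^2 * \<epsilon>^2) * ln (real M / \<delta>)" .
  show ?thesis
  proof (intro exI conjI)
    show "povm (2 ^ (N * n)) (dec ` \<Omega>) F" using povm by (simp add: power_mult)
    show "\<forall>x\<in>dec ` \<Omega>. \<forall>a<M. \<bar>x a\<bar> \<le> 1" using dec_unit by (auto simp: unit_def)
  qed (use size prob in auto)
qed

text \<open>The number of copies carries d + 1, the number of colours; a bound proportional to d
  itself would allow no copies when d = 0. Likewise \<delta> \<le> 1/2 keeps the logarithm away from
  0 when there is a single term. The constant precedes all other quantifiers, so it is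
  absolute.\<close>

theorem theorem4p2:
  "\<exists>C::real. C > 0 \<and>
   (\<forall>(N::nat) (M::nat) (E::nat \<Rightarrow> nat list) (\<beta>::real) (\<epsilon>::real) (\<delta>::real).
      M \<ge> 1 \<longrightarrow>
      (\<forall>a<M. pauli_word N (E a)) \<longrightarrow>
      inj_on E {..<M} \<longrightarrow>
      (\<forall>a<M. pauli_support (E a) \<noteq> {}) \<longrightarrow>
      (\<forall>a<M. mtrace (pauli_string (E a)) = 0) \<longrightarrow>
      (\<forall>a<M. \<forall>b<M. mtrace (pauli_string (E a) * pauli_string (E b)) =
                     (if a = b then 2 ^ N else 0)) \<longrightarrow>
      \<beta> > 0 \<longrightarrow>
      100 * exp 6 * (real (dual_degree M E) + 1) ^ 8 * \<beta> \<le> 1 \<longrightarrow>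
      0 < \<epsilon> \<longrightarrow> \<epsilon> \<le> 1 \<longrightarrow> 0 < \<delta> \<longrightarrow> \<delta> \<le> 1 / 2 \<longrightarrow>
      (\<exists>(n::nat) (X::(nat \<Rightarrow> real) set) (F::(nat \<Rightarrow> real) \<Rightarrow> complex mat).
         real n \<le> C * (real (dual_degree M E) + 1) / (\<beta>^2 * \<epsilon>^2) * ln (real M / \<delta>) \<and>
         povm (2 ^ (N * n)) X F \<and>
         (\<forall>x\<in>X. \<forall>a<M. \<bar>x a\<bar> \<le> 1) \<and>
         (\<forall>lam::nat \<Rightarrow> real. (\<forall>a<M. \<bar>lam a\<bar> \<le> 1) \<longrightarrow>
            (\<Sum>x\<in>{x\<in>X. \<forall>a<M. \<bar>x a - lam a\<bar> \<le> \<epsilon>}.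
               outcome_prob (F x) (tensor_pow (gibbs \<beta> (hamiltonian N M E lam)) n))
            \<ge> 1 - \<delta>)))"
proof (rule exI[of _ 130], intro conjI allI impI)
  fix N M :: nat and E :: "nat \<Rightarrow> nat list" and \<beta> \<epsilon> \<delta> :: real
  assume *: "M \<ge> 1" "\<forall>a<M. pauli_word N (E a)" "inj_on E {..<M}" "\<forall>a<M. pauli_support (E a) \<noteq> {}"
    "\<forall>a<M. mtrace (pauli_string (E a)) = 0"
    "\<forall>a<M. \<forall>b<M. mtrace (pauli_string (E a) * pauli_string (E b)) = (if a = b then 2 ^ N else 0)"
    "\<beta> > 0" and \<beta>: "100 * exp 6 * (real (dual_degree M E) + 1) ^ 8 * \<beta> \<le> 1"
    and **: "0 < \<epsilon>" "\<epsilon> \<le> 1" "0 < \<delta>" "\<delta> \<le> 1 / 2"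
  \<comment> \<open>Since e^6 is at least 200 and the base d + 1 is at least 1, the temperature
    condition yields the constant 20000 = 100 times 200 with the exponent 2.\<close>
  have "100 * 200 * (real (dual_degree M E) + 1) ^ 2 * \<beta> \<le> 100 * exp 6 * (real (dual_degree M E) + 1) ^ 8 * \<beta>"
    using exp_6_ge \<open>\<beta> > 0\<close> by (intro mult_right_mono mult_mono power_increasing) auto
  also note \<beta>
  finally have "20000 * (real (dual_degree M E) + 1)\<^sup>2 * \<beta> \<le> 1" by simp
  then show "\<exists>(n::nat) (X::(nat \<Rightarrow> real) set) (F::(nat \<Rightarrow> real) \<Rightarrow> complex mat).
         real n \<le> 130 * (real (dual_degree M E) + 1) / (\<beta>^2 * \<epsilon>^2) * ln (real M / \<delta>) \<and>
         povm (2 ^ (N * n)) X F \<and>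
         (\<forall>x\<in>X. \<forall>a<M. \<bar>x a\<bar> \<le> 1) \<and>
         (\<forall>lam::nat \<Rightarrow> real. (\<forall>a<M. \<bar>lam a\<bar> \<le> 1) \<longrightarrow>
            (\<Sum>x\<in>{x\<in>X. \<forall>a<M. \<bar>x a - lam a\<bar> \<le> \<epsilon>}.
               outcome_prob (F x) (tensor_pow (gibbs \<beta> (hamiltonian N M E lam)) n))
            \<ge> 1 - \<delta>)"
    using * ** by (intro Gibbs_state_learning) auto
qed simp

end
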